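(* There exists a constant $C=C(n)>0$ such that the following holds. Let $n\ge2$ and let $\{A_k\}_{k\in\mathbb{N}}\subset X_1$ with $A_k\rightharpoonup A$ in $X_1$. Assume that (along a subsequence, not relabelled) $|A_k|\rightharpoonup u$ weakly in $L^1(\mathbb{T}^n)$ with \[ u\in L^{\frac{n}{n-1}}(\mathbb{T}^n), \] and that $\mu_k=\det^{\frac{1}{n-1}}(A_k)\,dx \overset{*}{\rightharpoonup}\mu$ and $\nu_k=|\operatorname{div}A_k|\overset{*}{\rightharpoonup}\nu$ weakly-$*$ as measures. Let $\mu^s,\nu^s$ denote the singular parts of $\mu,\nu$ with respect to $\mathcal{L}^n$, and let $\{x_i\}_{i\in\mathbb{N}}$ be the (at most countable) set of points with $\nu^s(\{x_i\})>0$. Then $\mu^s$ is a discrete measure concentrated on $\{x_i\}_{i\in\mathbb{N}}$, and \[ \mu^s\le C(n)\sum_{i=1}^\infty \nu^s(\{x_i\})^{\frac{n}{n-1}}\delta_{x_i}\quad\text{as measures.} \]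
   Context: $\mathbb{T}^n=\mathbb{R}^n/\mathbb{Z}^n$ with Lebesgue measure $\mathcal{L}^n$. $\mathrm{Sym}^+(n)$ is the cone of symmetric positive semi-definite $n\times n$ matrices; $|\cdot|$ is the Frobenius norm. For $p\ge1$, $X_p=\{A\in L^p(\mathbb{T}^n;\mathrm{Sym}^+(n)) : \operatorname{div}A\in\mathcal{M}(\mathbb{T}^n;\mathbb{R}^n)\}$ with row-wise distributional divergence $(\operatorname{div}A)_i=\sum_j\partial_jA_{ij}$. $A_k\rightharpoonup A$ in $X_p$ means $A_k\rightharpoonup A$ weakly in $L^p$ and $\operatorname{div}A_k\overset{*}{\rightharpoonup}\operatorname{div}A$ weakly-$*$ as measures. For a vector-valued measure $\lambda$, $|\lambda|$ denotes its total variation measure. *)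

theory Defs
  imports "HOL-Analysis.Analysis"
begin

text \<open>The torus T^n = R^n / Z^n is represented by the fundamental domain
  Q = [0,1)^n; functions on T^n are functions on R^n considered on Q
  (test functions are Z^n-periodic functions on R^n); Lebesgue measure on T^n
  is Lebesgue measure restricted to Q; finite Borel measures on T^n are finite
  Borel measures on R^n concentrated on Q.\<close>

definition torus_cube :: "(real^'n) set" where
  "torus_cube = {x. \<forall>i. 0 \<le> x $ i \<and> x $ i < 1}"

definition torus_periodic :: "(real^'n \<Rightarrow> 'b) \<Rightarrow> bool" where
  "torus_periodic f \<longleftrightarrow> (\<forall>x i. f (x + axis i 1) = f x)"

fun Ck_fun :: "nat \<Rightarrow> (real^'n \<Rightarrow> 'b::real_normed_vector) \<Rightarrow> bool" where
  "Ck_fun 0 f \<longleftrightarrow> continuous_on UNIV f"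
| "Ck_fun (Suc k) f \<longleftrightarrow> continuous_on UNIV f \<and> (\<forall>x. f differentiable (at x)) \<and>
     (\<forall>j. Ck_fun k (\<lambda>x. frechet_derivative f (at x) (axis j 1)))"

definition smooth_fun :: "(real^'n \<Rightarrow> 'b::real_normed_vector) \<Rightarrow> bool" where
  "smooth_fun f \<longleftrightarrow> (\<forall>k. Ck_fun k f)"

definition pderiv_at :: "(real^'n \<Rightarrow> 'b::real_normed_vector) \<Rightarrow> 'n \<Rightarrow> real^'n \<Rightarrow> 'b" where
  "pderiv_at f j x = frechet_derivative f (at x) (axis j 1)"

definition psd_sym :: "real^'n^'n \<Rightarrow> bool" where
  "psd_sym M \<longleftrightarrow> transpose M = M \<and> (\<forall>v. 0 \<le> v \<bullet> (M *v v))"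

definition torus_measure :: "(real^'n) measure \<Rightarrow> bool" where
  "torus_measure M \<longleftrightarrow> sets M = sets borel \<and> finite_measure M \<and>
     emeasure M (UNIV - torus_cube) = 0"

text \<open>An R^n-valued finite Borel measure lambda on T^n, given in polar form
  lambda = theta |lambda|: sigma = |lambda| is its total variation measure and theta is a
  Borel unit vector field (|theta| = 1 sigma-a.e.).\<close>
definition vector_measure_polar :: "(real^'n \<Rightarrow> real^'n) \<Rightarrow> (real^'n) measure \<Rightarrow> bool" where
  "vector_measure_polar \<theta> \<sigma> \<longleftrightarrow> torus_measure \<sigma> \<and> \<theta> \<in> borel_measurable borel \<and>
     (AE x in \<sigma>. norm (\<theta> x) = 1)"

definition Lp_psd :: "real \<Rightarrow> (real^'n \<Rightarrow> real^'n^'n) \<Rightarrow> bool" where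
  "Lp_psd p A \<longleftrightarrow> A \<in> borel_measurable (lebesgue_on torus_cube) \<and>
     integrable (lebesgue_on torus_cube) (\<lambda>x. norm (A x) powr p) \<and>
     (AE x in lebesgue_on torus_cube. psd_sym (A x))"

definition div_is_measure :: "(real^'n \<Rightarrow> real^'n^'n) \<Rightarrow> (real^'n \<Rightarrow> real^'n) \<Rightarrow> (real^'n) measure \<Rightarrow> bool" where
  "div_is_measure A \<theta> \<sigma> \<longleftrightarrow> vector_measure_polar \<theta> \<sigma> \<and>
     (\<forall>\<phi>::real^'n \<Rightarrow> real^'n. smooth_fun \<phi> \<and> torus_periodic \<phi> \<longrightarrow>
        (\<integral>x. \<phi> x \<bullet> \<theta> x \<partial>\<sigma>) =
        - (\<integral>x. (\<Sum>i\<in>UNIV. \<Sum>j\<in>UNIV. A x $ i $ j * pderiv_at \<phi> j x $ i) \<partial>lebesgue_on torus_cube))"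

text \<open>A \<in> X_p with div A = theta sigma (so |div A| = sigma).\<close>
definition in_Xp :: "real \<Rightarrow> (real^'n \<Rightarrow> real^'n^'n) \<Rightarrow> (real^'n \<Rightarrow> real^'n) \<Rightarrow> (real^'n) measure \<Rightarrow> bool" where
  "in_Xp p A \<theta> \<sigma> \<longleftrightarrow> Lp_psd p A \<and> div_is_measure A \<theta> \<sigma>"

definition weak_L1_conv :: "(nat \<Rightarrow> real^'n \<Rightarrow> 'b::{real_inner,banach,second_countable_topology})
    \<Rightarrow> (real^'n \<Rightarrow> 'b) \<Rightarrow> bool" where
  "weak_L1_conv F f \<longleftrightarrow>
     (\<forall>g::real^'n \<Rightarrow> 'b. g \<in> borel_measurable (lebesgue_on torus_cube) \<and> bounded (range g) \<longrightarrow>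
        (\<lambda>k. \<integral>x. F k x \<bullet> g x \<partial>lebesgue_on torus_cube)
          \<longlonglongrightarrow> (\<integral>x. f x \<bullet> g x \<partial>lebesgue_on torus_cube))"

definition weakstar_conv :: "(nat \<Rightarrow> (real^'n) measure) \<Rightarrow> (real^'n) measure \<Rightarrow> bool" where
  "weakstar_conv M L \<longleftrightarrow>
     (\<forall>\<phi>::real^'n \<Rightarrow> real. continuous_on UNIV \<phi> \<and> torus_periodic \<phi> \<longrightarrow>
        (\<lambda>k. \<integral>x. \<phi> x \<partial>M k) \<longlonglongrightarrow> (\<integral>x. \<phi> x \<partial>L))"

definition weakstar_conv_vec :: "(nat \<Rightarrow> real^'n \<Rightarrow> real^'n) \<Rightarrow> (nat \<Rightarrow> (real^'n) measure)
    \<Rightarrow> (real^'n \<Rightarrow> real^'n) \<Rightarrow> (real^'n) measure \<Rightarrow> bool" where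
  "weakstar_conv_vec \<Theta> \<Sigma> \<theta> \<sigma> \<longleftrightarrow>
     (\<forall>\<phi>::real^'n \<Rightarrow> real^'n. continuous_on UNIV \<phi> \<and> torus_periodic \<phi> \<longrightarrow>
        (\<lambda>k. \<integral>x. \<phi> x \<bullet> \<Theta> k x \<partial>\<Sigma> k) \<longlonglongrightarrow> (\<integral>x. \<phi> x \<bullet> \<theta> x \<partial>\<sigma>))"

definition leb_singular_part :: "(real^'n) measure \<Rightarrow> (real^'n) measure \<Rightarrow> bool" where
  "leb_singular_part M Ms \<longleftrightarrow> sets Ms = sets borel \<and>
     (\<exists>Ma. sets Ma = sets borel \<and> absolutely_continuous lborel Ma \<and>
        (\<exists>N\<in>sets borel. emeasure lborel N = 0 \<and> emeasure Ms (UNIV - N) = 0) \<and>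
        (\<forall>E\<in>sets borel. emeasure M E = emeasure Ma E + emeasure Ms E))"

end

theory Submission
  imports Defs "HOL-Complex_Analysis.Great_Picard"
begin

text \<open>The heart of the proof is a local form of Serre's compensated integrability inequality with a
  non-sharp constant: for a cutoff \<open>\<phi>\<close>,
  \<open>\<integral> (\<phi>\<^sup>n det A)\<^bsup>1/(n-1)\<^esup> \<le> C (\<integral> \<phi> d|div A| + \<integral> |A| |\<nabla>\<phi>|)\<^bsup>n/(n-1)\<^esup>\<close>.
  Given a density \<open>g \<ge> 0\<close>, semidiscrete optimal transport yields convex functions whose gradients
  stay in a cube of volume \<open>\<integral> g\<close> and whose subdifferentials have the prescribed volumes. In the limit
  of fine discretizations, and after mollification, one obtains a smooth convex \<open>\<Psi>\<close> with
  \<open>g det A \<le> (8n A : D\<^sup>2\<Psi>)\<^sup>n\<close> for every positive semi-definite \<open>A\<close>. Testing the divergence of \<open>A\<close> with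
  \<open>\<phi> \<nabla>\<Psi>\<close> bounds \<open>\<integral> \<phi> (g det A)\<^bsup>1/n\<^esup>\<close> by a multiple of \<open>(\<integral> g)\<^bsup>1/n\<^esup>\<close>, and the choice
  \<open>g = (\<phi>\<^sup>n det A)\<^bsup>1/(n-1)\<^esup>\<close> gives the inequality.

  Since \<open>|\<nabla>\<phi>|\<close> is of order \<open>1/r\<close> on balls of radius \<open>r\<close>, passing to the limit and Hoelder's inequality
  give \<open>\<mu>(B\<^sub>r) \<le> C (\<nu>(B\<^sub>2\<^sub>r)\<^bsup>n/(n-1)\<^esup> + \<integral> |u|\<^bsup>n/(n-1)\<^esup>)\<close>, the integral being over \<open>B\<^sub>2\<^sub>r\<close>. Letting
  \<open>r \<rightarrow> 0\<close> bounds the atoms of \<open>\<mu>\<close>; covering a Lebesgue null compact set without atoms of \<open>\<nu>\<close> by such balls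
  with bounded overlap shows that \<open>\<mu>\<close> does not charge it.\<close>

subsection \<open>Smooth functions\<close>

text \<open>The potential is built from the side of its gradients: Lebesgue measure on a cube of
  volume \<integral> g is split into cells, each being the subdifferential at one node. Confinement
  to this cube gives |grad \<Psi>| \<le> C (\<integral> g)^(1/n), and disjointness of the cells
  turns mass of g into volume of gradients.

  The potential is merely convex, so its Hessian is accessed through second differences along the
  columns of a factor B with A = B B^T. Lower bounds on these are linear in the potential and
  therefore survive the refinement limit and averaging.

  A convex potential is not periodic. This is why the inequality is local: cutoffs supported in the
  ball of radius 1/4 turn \<phi> grad \<Psi> into an admissible test field on the torus.

  With the chosen g, the quantity I = \<integral> g stands on both sides, I \<le> C I^(1/n) D, and
  can be divided out only when it is finite; hence g is truncated first and the truncation removed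
  at the end.

  The power n/(n-1) > 1 of \<nu> excludes a diffuse singular part: where balls have small
  \<nu>-mass, \<nu>^(n/(n-1)) is a small multiple of \<nu>.\<close>

lemma Ck_fun_SucI:
  assumes "\<And>x. (f has_derivative D x) (at x)" "\<And>j. Ck_fun k (\<lambda>x. D x (axis j 1))"
  shows "Ck_fun (Suc k) f"
proof -
  have "frechet_derivative f (at x) = D x" for x
    using frechet_derivative_at[OF assms(1)] by simp
  moreover have "continuous_on UNIV f"
    by (rule has_derivative_continuous_on[of _ f D]) (use assms(1) in auto)
  ultimately show ?thesis
    using assms by (auto simp: differentiable_def)
qed

lemma Ck_fun_Suc_has_derivative:
  "Ck_fun (Suc k) f \<Longrightarrow> (f has_derivative frechet_derivative f (at x)) (at x)"
  using frechet_derivative_works by auto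

lemma Ck_fun_SucD: "Ck_fun (Suc k) f \<Longrightarrow> Ck_fun k f"
  by (induction k arbitrary: f) auto

lemma Ck_fun_continuous: "Ck_fun k f \<Longrightarrow> continuous_on UNIV f"
  by (cases k) auto

lemma Ck_fun_const: "Ck_fun k (\<lambda>x. c)"
proof (induction k arbitrary: c)
  case (Suc k)
  show ?case by (rule Ck_fun_SucI[where D = "\<lambda>_ _. 0"]) (auto intro: Suc.IH)
qed simp

lemma Ck_fun_add: "Ck_fun k f \<Longrightarrow> Ck_fun k g \<Longrightarrow> Ck_fun k (\<lambda>x. f x + g x)"
proof (induction k arbitrary: f g)
  case 0
  then show ?case by (auto intro: continuous_intros)
next
  case (Suc k)
  show ?case
  proof (rule Ck_fun_SucI)
    show "((\<lambda>x. f x + g x) has_derivative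
      (\<lambda>v. frechet_derivative f (at x) v + frechet_derivative g (at x) v)) (at x)" for x
      by (intro has_derivative_add Ck_fun_Suc_has_derivative[OF Suc.prems(1)]
          Ck_fun_Suc_has_derivative[OF Suc.prems(2)])
  qed (use Suc in auto)
qed

lemma Ck_fun_sum: "(\<And>i. i \<in> I \<Longrightarrow> Ck_fun k (f i)) \<Longrightarrow> Ck_fun k (\<lambda>x. \<Sum>i\<in>I. f i x)"
  by (induction I rule: infinite_finite_induct) (auto intro: Ck_fun_const Ck_fun_add)

lemma Ck_fun_scaleR:
  fixes f :: "real^'n \<Rightarrow> real"
  shows "Ck_fun k f \<Longrightarrow> Ck_fun k g \<Longrightarrow> Ck_fun k (\<lambda>x. f x *\<^sub>R g x)"
proof (induction k arbitrary: f g)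
  case 0
  then show ?case by (auto intro: continuous_intros)
next
  case (Suc k)
  show ?case
  proof (rule Ck_fun_SucI)
    show "((\<lambda>x. f x *\<^sub>R g x) has_derivative
      (\<lambda>v. f x *\<^sub>R frechet_derivative g (at x) v + frechet_derivative f (at x) v *\<^sub>R g x)) (at x)" for x
      by (intro has_derivative_scaleR Ck_fun_Suc_has_derivative[OF Suc.prems(1)]
          Ck_fun_Suc_has_derivative[OF Suc.prems(2)])
    show "Ck_fun k (\<lambda>x. f x *\<^sub>R frechet_derivative g (at x) (axis j 1) +
          frechet_derivative f (at x) (axis j 1) *\<^sub>R g x)" for j
      using Suc.prems Ck_fun_SucD[OF Suc.prems(1)] Ck_fun_SucD[OF Suc.prems(2)]
      by (intro Ck_fun_add Suc.IH) auto
  qed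
qed

lemmas Ck_fun_mult = Ck_fun_scaleR[where ?'a = real, unfolded real_scaleR_def]

lemma Ck_fun_compose_bounded_linear:
  assumes "bounded_linear T"
  shows "Ck_fun k f \<Longrightarrow> Ck_fun k (\<lambda>x. T (f x))"
proof (induction k arbitrary: f)
  case 0
  then show ?case
    by (auto intro: continuous_on_compose2[OF linear_continuous_on[OF assms, of UNIV]])
next
  case (Suc k)
  show ?case
  proof (rule Ck_fun_SucI)
    show "((\<lambda>x. T (f x)) has_derivative (\<lambda>v. T (frechet_derivative f (at x) v))) (at x)" for x
      by (rule bounded_linear.has_derivative[OF assms Ck_fun_Suc_has_derivative[OF Suc.prems]])
  qed (use Suc in auto)
qed

lemma Ck_fun_id: "Ck_fun k (\<lambda>x. x)"
proof (cases k)
  case (Suc k)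
  show ?thesis unfolding Suc
    by (rule Ck_fun_SucI[where D = "\<lambda>_ v. v"]) (auto intro: Ck_fun_const)
qed auto

lemma Ck_fun_translate: "Ck_fun k f \<Longrightarrow> Ck_fun k (\<lambda>x. f (x - a))"
proof (induction k arbitrary: f)
  case 0
  then show ?case
    by (auto intro!: continuous_on_compose2[of UNIV f UNIV "\<lambda>x. x - a"] continuous_intros)
next
  case (Suc k)
  show ?case
  proof (rule Ck_fun_SucI)
    show "((\<lambda>x. f (x - a)) has_derivative frechet_derivative f (at (x - a))) (at x)" for x
    proof -
      have "((\<lambda>x. x - a) has_derivative (\<lambda>v. v)) (at x)"
        by (auto intro!: derivative_eq_intros)
      from has_derivative_compose[OF this Ck_fun_Suc_has_derivative[OF Suc.prems]]
      show ?thesis by simp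
    qed
    show "Ck_fun k (\<lambda>x. frechet_derivative f (at (x - a)) (axis j 1))" for j
      using Suc.IH[of "\<lambda>x. frechet_derivative f (at x) (axis j 1)"] Suc.prems by auto
  qed
qed

text \<open>Meant for composites with \<open>wrap\<close>, which is itself discontinuous: near each
  point such a composite agrees with a smooth function, but not with the same one everywhere. In the
  induction the derivative inherits the local representation on the same ball.\<close>

lemma Ck_fun_local:
  assumes "\<And>x. \<exists>e>0. \<exists>g. Ck_fun k g \<and> (\<forall>y\<in>ball x e. f y = g y)"
  shows "Ck_fun k f"
  using assms
proof (induction k arbitrary: f)
  case 0
  have "isCont f x" for x
  proof -
    obtain e g where eg: "e > 0" "continuous_on UNIV g" "\<forall>y\<in>ball x e. f y = g y"
      using 0[of x] by auto
    have "continuous_on (ball x e) f"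
      using eg(3) continuous_on_subset[OF eg(2), of "ball x e"]
        continuous_on_cong[of "ball x e" "ball x e" f g] by auto
    then show ?thesis using eg(1) by (auto simp: continuous_on_eq_continuous_at)
  qed
  then show ?case by (auto simp: continuous_on_eq_continuous_at)
next
  case (Suc k)
  have D: "\<exists>e>0. \<exists>g. Ck_fun (Suc k) g \<and> (\<forall>y\<in>ball x e. f y = g y \<and>
      (f has_derivative frechet_derivative g (at y)) (at y))" for x
  proof -
    obtain e g where eg: "e > 0" "Ck_fun (Suc k) g" "\<forall>y\<in>ball x e. f y = g y"
      using Suc.prems[of x] by blast
    have "(f has_derivative frechet_derivative g (at y)) (at y)" if "y \<in> ball x e" for y
      by (rule has_derivative_transform_within_open[OF Ck_fun_Suc_has_derivative[OF eg(2)] open_ball that])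
        (use eg(3) in auto)
    then show ?thesis using eg by blast
  qed
  show ?case
  proof (rule Ck_fun_SucI)
    show "(f has_derivative frechet_derivative f (at x)) (at x)" for x
    proof -
      obtain e g where "e > 0" "\<forall>y\<in>ball x e. (f has_derivative frechet_derivative g (at y)) (at y)"
        using D[of x] by blast
      then have d: "(f has_derivative frechet_derivative g (at x)) (at x)" by simp
      show ?thesis using d unfolding frechet_derivative_at[OF d, symmetric] .
    qed
    show "Ck_fun k (\<lambda>x. frechet_derivative f (at x) (axis j 1))" for j
    proof (rule Suc.IH)
      fix x
      obtain e g where eg: "e > 0" "Ck_fun (Suc k) g" "\<And>y. y \<in> ball x e \<Longrightarrow>
          (f has_derivative frechet_derivative g (at y)) (at y)" using D[of x] by blast
      have "\<forall>y\<in>ball x e. frechet_derivative f (at y) (axis j 1) = frechet_derivative g (at y) (axis j 1)"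
        using frechet_derivative_at[OF eg(3)] by simp
      then show "\<exists>e>0. \<exists>g. Ck_fun k g \<and>
            (\<forall>y\<in>ball x e. frechet_derivative f (at y) (axis j 1) = g y)"
        using eg(1,2) by (intro exI[of _ e] conjI exI[of _ "\<lambda>y. frechet_derivative g (at y) (axis j 1)"]) auto
    qed
  qed
qed

text \<open>The chain rule turns \<open>H i\<close> into \<open>H (Suc i)\<close> times a derivative
  of \<open>q\<close>, so the outer function is given together with all its derivatives and the
  induction on \<open>k\<close> covers every \<open>i\<close> at once.\<close>

lemma Ck_fun_compose_real:
  fixes H :: "nat \<Rightarrow> real \<Rightarrow> real"
  assumes H: "\<And>i s. (H i has_real_derivative H (Suc i) s) (at s)"
  shows "Ck_fun k q \<Longrightarrow> Ck_fun k (\<lambda>x. H i (q x))"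
proof (induction k arbitrary: i)
  case 0
  have "continuous_on UNIV (H i)"
    by (intro continuous_at_imp_continuous_on ballI DERIV_isCont[OF H])
  then show ?case using 0 by (auto intro: continuous_on_compose2[of UNIV "H i" UNIV q])
next
  case (Suc k)
  show ?case
  proof (rule Ck_fun_SucI)
    show "((\<lambda>x. H i (q x)) has_derivative
        (\<lambda>v. H (Suc i) (q x) * frechet_derivative q (at x) v)) (at x)" for x
      using has_derivative_compose[OF Ck_fun_Suc_has_derivative[OF Suc.prems]
          H[of i, unfolded has_field_derivative_def]] by simp
    show "Ck_fun k (\<lambda>x. H (Suc i) (q x) * frechet_derivative q (at x) (axis j 1))" for j
      using Suc.prems by (intro Ck_fun_mult Suc.IH[OF Ck_fun_SucD[OF Suc.prems]]) auto
  qed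
qed

lemma smooth_fun_pderiv: "smooth_fun f \<Longrightarrow> smooth_fun (pderiv_at f j)"
  unfolding smooth_fun_def
proof
  fix k assume "\<forall>k. Ck_fun k f"
  then have "Ck_fun (Suc k) f" by blast
  then show "Ck_fun k (pderiv_at f j)" by (simp add: pderiv_at_def[abs_def])
qed

lemma smooth_fun_continuous: "smooth_fun f \<Longrightarrow> continuous_on UNIV f"
  using Ck_fun_continuous unfolding smooth_fun_def by blast

lemma smooth_fun_has_derivative:
  fixes f :: "real^'n \<Rightarrow> 'b::real_normed_vector"
  assumes "smooth_fun f"
  shows "(f has_derivative (\<lambda>v. \<Sum>j\<in>UNIV. v $ j *\<^sub>R pderiv_at f j x)) (at x)"
proof -
  have "Ck_fun (Suc 0) f" using assms unfolding smooth_fun_def by blast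
  then have d: "(f has_derivative frechet_derivative f (at x)) (at x)"
    by (rule Ck_fun_Suc_has_derivative)
  interpret bounded_linear "frechet_derivative f (at x)"
    using d by (rule has_derivative_bounded_linear)
  have "frechet_derivative f (at x) v = (\<Sum>j\<in>UNIV. v $ j *\<^sub>R pderiv_at f j x)" for v
  proof -
    have "v = (\<Sum>j\<in>UNIV. v $ j *\<^sub>R axis j 1)"
      using basis_expansion[of v] by (simp add: scalar_mult_eq_scaleR)
    then have "frechet_derivative f (at x) v
      = frechet_derivative f (at x) (\<Sum>j\<in>UNIV. v $ j *\<^sub>R axis j 1)" by simp
    then show ?thesis by (simp add: sum scaleR pderiv_at_def)
  qed
  then have "frechet_derivative f (at x) = (\<lambda>v. \<Sum>j\<in>UNIV. v $ j *\<^sub>R pderiv_at f j x)"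
    by (rule ext)
  with d show ?thesis by simp
qed

lemma pderiv_atI: "(f has_derivative D) (at x) \<Longrightarrow> pderiv_at f j x = D (axis j 1)"
  unfolding pderiv_at_def by (simp add: frechet_derivative_at[symmetric])

text \<open>The functions s^(-m) exp(-1/s), extended by 0 to s \<le> 0, span a space that is closed under
  differentiation.\<close>

definition flat :: "nat \<Rightarrow> real \<Rightarrow> real" where
  "flat m s = (if s \<le> 0 then 0 else inverse s ^ m * exp (- inverse s))"

lemma flat_tendsto_0: "(flat m \<longlongrightarrow> 0) (at_right 0)"
proof -
  have "((\<lambda>s. inverse s ^ m / exp (inverse s)) \<longlongrightarrow> (0::real)) (at_right 0)"
    by (rule filterlim_compose[OF tendsto_power_div_exp_0 filterlim_inverse_at_top_right])
  moreover have "\<forall>\<^sub>F s in at_right 0. inverse s ^ m / exp (inverse s) = flat m s"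
    using eventually_at_right_less[of "0::real"]
    by eventually_elim (auto simp: flat_def exp_minus field_simps)
  ultimately show ?thesis using tendsto_cong by force
qed

text \<open>Only s = 0 is delicate: there the right difference quotient of \<open>flat m\<close> is
  \<open>flat (Suc m)\<close>, which tends to 0, and the left one vanishes.\<close>

lemma flat_has_derivative:
  "(flat m has_real_derivative flat (m + 2) s - real m * flat (m + 1) s) (at s)"
proof (cases "s = 0")
  case False
  show ?thesis
  proof (cases "s < 0")
    case True
    have "((\<lambda>_. 0) has_real_derivative 0) (at s)" by simp
    then have "(flat m has_real_derivative 0) (at s)"
      by (rule has_field_derivative_transform_within_open[of _ _ _ "{..<0}"])
        (use True in \<open>auto simp: flat_def\<close>)
    then show ?thesis using True by (simp add: flat_def)
  next
    case F: False
    with False have s: "s > 0" by simp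
    have "((\<lambda>s. inverse s ^ m * exp (- inverse s)) has_real_derivative
        real m * (- (inverse s * inverse s)) * inverse s ^ (m - 1) * exp (- inverse s)
        + inverse s ^ m * (exp (- inverse s) * (inverse s * inverse s))) (at s)"
      using s by (auto intro!: derivative_eq_intros)
    moreover have "real m * (- (inverse s * inverse s)) * inverse s ^ (m - 1) * exp (- inverse s)
        + inverse s ^ m * (exp (- inverse s) * (inverse s * inverse s))
        = flat (m + 2) s - real m * flat (m + 1) s"
      using s by (cases m) (simp_all add: flat_def algebra_simps)
    ultimately have "((\<lambda>s. inverse s ^ m * exp (- inverse s)) has_real_derivative
        flat (m + 2) s - real m * flat (m + 1) s) (at s)" by simp
    then show ?thesis
      by (rule has_field_derivative_transform_within_open[of _ _ _ "{0<..}"])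
        (use s in \<open>auto simp: flat_def\<close>)
  qed
next
  case True
  have "((\<lambda>h. flat m h / h) \<longlongrightarrow> 0) (at_right 0)"
  proof (rule Lim_transform_eventually[OF flat_tendsto_0[of "Suc m"]])
    show "\<forall>\<^sub>F s in at_right 0. flat (Suc m) s = flat m s / s"
      using eventually_at_right_less[of "0::real"]
      by eventually_elim (auto simp: flat_def field_simps)
  qed
  moreover have "((\<lambda>h. flat m h / h) \<longlongrightarrow> 0) (at_left 0)"
  proof (rule Lim_transform_eventually[of "\<lambda>_. 0"])
    show "\<forall>\<^sub>F s in at_left 0. 0 = flat m s / s"
      by (auto simp: flat_def eventually_at_filter)
  qed simp
  ultimately have "((\<lambda>h. flat m h / h) \<longlongrightarrow> 0) (at 0)"
    by (simp add: filterlim_split_at)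
  then show ?thesis using True by (simp add: DERIV_def) (simp add: flat_def)
qed

text \<open>A list of pairs (m, c) encodes the combination of the functions \<open>flat m\<close>
  with coefficients c, and \<open>flat_deriv i xs\<close> encodes its i-th derivative. These lists
  supply the family \<open>H\<close> of \<open>Ck_fun_compose_real\<close>.\<close>

fun flat_deriv :: "nat \<Rightarrow> (nat \<times> real) list \<Rightarrow> (nat \<times> real) list" where
  "flat_deriv 0 xs = xs"
| "flat_deriv (Suc i) xs = concat (map (\<lambda>(m, c). [(m + 2, c), (m + 1, - real m * c)]) (flat_deriv i xs))"

definition flat_sum :: "(nat \<times> real) list \<Rightarrow> real \<Rightarrow> real" where
  "flat_sum xs s = (\<Sum>(m, c)\<leftarrow>xs. c * flat m s)"

lemma flat_sum_has_derivative:
  "(flat_sum xs has_real_derivative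
     flat_sum (concat (map (\<lambda>(m, c). [(m + 2, c), (m + 1, - real m * c)]) xs)) s) (at s)"
proof (induction xs)
  case Nil
  then show ?case by (simp add: flat_sum_def[abs_def])
next
  case (Cons a xs)
  obtain m c where a: "a = (m, c)" by force
  have e: "flat_sum (a # xs) = (\<lambda>s. c * flat m s + flat_sum xs s)"
    by (auto simp: flat_sum_def a)
  show ?case unfolding e
    by (rule DERIV_cong[OF DERIV_add[OF DERIV_cmult[OF flat_has_derivative] Cons]])
      (simp add: a flat_sum_def algebra_simps)
qed

lemma Ck_fun_flat_compose:
  fixes q :: "real^'n \<Rightarrow> real"
  assumes "Ck_fun k q"
  shows "Ck_fun k (\<lambda>x. flat 0 (q x))"
proof -
  have "Ck_fun k (\<lambda>x. flat_sum (flat_deriv 0 [(0, 1)]) (q x))"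
    by (rule Ck_fun_compose_real[OF _ assms, of "\<lambda>i. flat_sum (flat_deriv i [(0, 1)])"])
      (use flat_sum_has_derivative in simp)
  then show ?thesis by (simp add: flat_sum_def)
qed

section \<open>Bump functions with gradient of order 1/r\<close>

definition bump :: "real \<Rightarrow> real^'n \<Rightarrow> real" where
  "bump r x = flat 0 (1 - (x \<bullet> x) / r\<^sup>2)"

lemma smooth_bump: "smooth_fun (bump r :: real^'n \<Rightarrow> real)"
  unfolding smooth_fun_def bump_def[abs_def]
proof (intro allI Ck_fun_flat_compose)
  fix k
  have "Ck_fun k (\<lambda>x::real^'n. x $ i)" for i
    by (rule Ck_fun_compose_bounded_linear[OF bounded_linear_vec_nth Ck_fun_id])
  then have "Ck_fun k (\<lambda>x::real^'n. 1 + (- 1 / r\<^sup>2) * (\<Sum>i\<in>UNIV. x $ i * x $ i))"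
    by (intro Ck_fun_add Ck_fun_const Ck_fun_mult Ck_fun_sum)
  then show "Ck_fun k (\<lambda>x::real^'n. 1 - (x \<bullet> x) / r\<^sup>2)"
    by (simp add: inner_vec_def)
qed

lemma bump_nonneg: "0 \<le> bump r x"
  by (simp add: bump_def flat_def)

lemma bump_eq_0: "r > 0 \<Longrightarrow> r \<le> norm x \<Longrightarrow> bump r x = 0"
  using power_mono[of r "norm x" 2]
  by (simp add: bump_def flat_def power2_norm_eq_inner field_simps)

lemma bump_pos: "r > 0 \<Longrightarrow> norm x < r \<Longrightarrow> 0 < bump r x"
  using power_strict_mono[of "norm x" r 2]
  by (simp add: bump_def flat_def power2_norm_eq_inner field_simps)

lemma bump_le_1: "bump r x \<le> 1"
  by (simp add: bump_def flat_def)

lemma bump_ge: "r > 0 \<Longrightarrow> norm x \<le> r / 2 \<Longrightarrow> exp (- 2) \<le> bump r x"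
proof -
  assume r: "r > 0" and x: "norm x \<le> r / 2"
  have "x \<bullet> x \<le> (r / 2)\<^sup>2" using power_mono[OF x, of 2] by (simp add: power2_norm_eq_inner)
  then have s: "3/4 \<le> 1 - (x \<bullet> x) / r\<^sup>2" using r by (simp add: field_simps power2_eq_square)
  define s where "s = 1 - (x \<bullet> x) / r\<^sup>2"
  have "s > 0" using s unfolding s_def by linarith
  moreover have "inverse s \<le> inverse (3/4)"
    using s unfolding s_def by (intro le_imp_inverse_le) auto
  ultimately have "inverse s \<le> 2" "s > 0" by simp_all
  then show ?thesis by (simp add: bump_def s_def[symmetric] flat_def)
qed

text \<open>\<open>flat 2\<close> is the derivative of \<open>flat 0\<close>, so this constant
  controls the gradient of \<open>bump\<close>. It comes from y^2 / 2 \<le> exp y with y =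
  1/s.\<close>

lemma flat_2_le: "flat 2 s \<le> 2"
proof (cases "s \<le> 0")
  case False
  define y where "y = inverse s"
  have "y > 0" using False by (simp add: y_def)
  have "y\<^sup>2 / 2 \<le> exp y" using exp_lower_Taylor_quadratic[of y] \<open>y > 0\<close> by simp
  then have "y\<^sup>2 * exp (- y) \<le> 2" by (simp add: exp_minus field_simps)
  then show ?thesis using False by (simp add: flat_def y_def)
qed (simp add: flat_def)

lemma flat_nonneg: "0 \<le> flat m s" by (simp add: flat_def)

lemma bump_has_derivative:
  "(bump r has_derivative (\<lambda>v. - flat 2 (1 - (x \<bullet> x) / r\<^sup>2) * (2 * (x \<bullet> v) / r\<^sup>2))) (at x)"
proof -
  have "((\<lambda>x. 1 - (x \<bullet> x) / r\<^sup>2) has_derivative (\<lambda>v. - (2 * (x \<bullet> v) / r\<^sup>2))) (at x)"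
    unfolding divide_inverse by (auto intro!: derivative_eq_intros simp: inner_commute)
  from has_derivative_compose[OF this flat_has_derivative[of 0, unfolded has_field_derivative_def]]
  show ?thesis by (simp add: bump_def[abs_def] numeral_2_eq_2)
qed

lemma norm_gradient_bump_le:
  fixes x :: "real^'n"
  assumes "r > 0"
  shows "norm (\<chi> j. pderiv_at (bump r) j x) \<le> 4 / r"
proof (cases "norm x < r")
  case True
  have "(\<chi> j. pderiv_at (bump r) j x) = (- flat 2 (1 - (x \<bullet> x) / r\<^sup>2) * 2 / r\<^sup>2) *\<^sub>R x"
    by (simp add: vec_eq_iff pderiv_atI[OF bump_has_derivative] inner_axis)
  then have "norm (\<chi> j. pderiv_at (bump r) j x) = flat 2 (1 - (x \<bullet> x) / r\<^sup>2) * 2 / r\<^sup>2 * norm x"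
    by (simp add: flat_nonneg abs_mult)
  also have "\<dots> \<le> 2 * 2 / r\<^sup>2 * r"
    using True assms flat_2_le flat_nonneg by (intro mult_mono divide_right_mono) auto
  finally show ?thesis using assms by (simp add: power2_eq_square)
next
  case False
  then have "1 - (x \<bullet> x) / r\<^sup>2 \<le> 0" using power_mono[of r "norm x" 2] assms
    by (simp add: power2_norm_eq_inner field_simps)
  then have "(\<chi> j. pderiv_at (bump r) j x) = 0"
    by (simp add: vec_eq_iff pderiv_atI[OF bump_has_derivative] flat_def)
  then show ?thesis using assms by simp
qed

lemma gradient_bump_eq_0:
  fixes x :: "real^'n"
  assumes "r > 0" "r \<le> norm x"
  shows "pderiv_at (bump r) j x = 0"
proof -
  have "1 - (x \<bullet> x) / r\<^sup>2 \<le> 0" using power_mono[of r "norm x" 2] assms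
    by (simp add: power2_norm_eq_inner field_simps)
  then show ?thesis
    by (simp add: pderiv_atI[OF bump_has_derivative] flat_def)
qed

text \<open>Convolution over the fixed compact cube [-1,1]^n, so that the Leibniz rule over a box
  applies to every continuous \<open>w\<close>. It agrees with the convolution over the whole space
  wherever the translated kernel is supported in the cube.\<close>

definition box_conv :: "(real^'n \<Rightarrow> real) \<Rightarrow> (real^'n \<Rightarrow> real) \<Rightarrow> real^'n \<Rightarrow> real" where
  "box_conv f w x = integral (cbox (-1) 1) (\<lambda>y. f (x - y) * w y)"

lemma box_conv_has_derivative:
  fixes f :: "real^'n \<Rightarrow> real"
  assumes f: "smooth_fun f" and w: "continuous_on UNIV w"
  shows "(box_conv f w has_derivative (\<lambda>v. \<Sum>j\<in>UNIV. v $ j * box_conv (pderiv_at f j) w x)) (at x)"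
proof -
  \<comment> \<open>\<open>leibniz_rule\<close> integrates the derivative as an element of the space
    of bounded linear functions, hence the assembly from coordinate functionals.\<close>
  define fx where "fx x y = (\<Sum>j\<in>UNIV. (w y * pderiv_at f j (x - y)) *\<^sub>R Blinfun (\<lambda>v::real^'n. v $ j))" for x y
  have bl: "blinfun_apply (Blinfun (\<lambda>v::real^'n. v $ j)) = (\<lambda>v. v $ j)" for j
    by (rule bounded_linear_Blinfun_apply) (rule bounded_linear_vec_nth)
  have fx: "blinfun_apply (fx x y) = (\<lambda>v. \<Sum>j\<in>UNIV. v $ j * (pderiv_at f j (x - y) * w y))" for x y
    unfolding fx_def by (rule ext) (simp add: blinfun.sum_left blinfun.scaleR_left bl mult_ac)
  have cf: "continuous_on UNIV f" and cp: "continuous_on UNIV (pderiv_at f j)" for j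
    using f smooth_fun_continuous smooth_fun_pderiv by blast+
  have c1: "continuous_on S (\<lambda>y. g (x - y) * w y)" if "continuous_on UNIV g" for g S x
    by (intro continuous_intros continuous_on_compose2[OF that] continuous_on_subset[OF w]) auto
  have "((\<lambda>x. integral (cbox (-1) 1) (\<lambda>y. f (x - y) * w y)) has_derivative
      blinfun_apply (integral (cbox (-1) 1) (fx x))) (at x within UNIV)"
  proof (rule leibniz_rule)
    fix x y :: "real^'n"
    have "((\<lambda>x. x - y) has_derivative (\<lambda>v. v)) (at x)"
      by (auto intro!: derivative_eq_intros)
    from has_derivative_compose[OF this smooth_fun_has_derivative[OF f, of "x - y"]]
    have "((\<lambda>x. f (x - y)) has_derivative (\<lambda>v. \<Sum>j\<in>UNIV. v $ j *\<^sub>R pderiv_at f j (x - y))) (at x)" .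
    from has_derivative_mult_left[OF this, of "w y"]
    show "((\<lambda>x. f (x - y) * w y) has_derivative blinfun_apply (fx x y)) (at x within UNIV)"
      by (simp add: fx sum_distrib_left mult_ac)
  next
    show "(\<lambda>y. f (x - y) * w y) integrable_on cbox (-1) 1" for x
      by (rule integrable_continuous) (rule c1[OF cf])
    show "continuous_on (UNIV \<times> cbox (-1) 1) (\<lambda>(x, y). fx x y)"
      unfolding fx_def case_prod_unfold
      by (intro continuous_intros continuous_on_compose2[OF cp] continuous_on_compose2[OF w]) auto
  qed auto
  moreover have "blinfun_apply (integral (cbox (-1) 1) (fx x))
      = (\<lambda>v. \<Sum>j\<in>UNIV. v $ j * box_conv (pderiv_at f j) w x)"
  proof
    fix v
    have "fx x integrable_on cbox (-1) 1"
      unfolding fx_def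
      by (intro integrable_continuous continuous_intros continuous_on_compose2[OF cp]
          continuous_on_subset[OF w]) auto
    then have "blinfun_apply (integral (cbox (-1) 1) (fx x)) v = integral (cbox (-1) 1) (\<lambda>y. fx x y v)"
      by (rule blinfun_apply_integral)
    also have "\<dots> = (\<Sum>j\<in>UNIV. integral (cbox (-1) 1) (\<lambda>y. v $ j * (pderiv_at f j (x - y) * w y)))"
      unfolding fx
      by (intro integral_sum) (auto intro!: integrable_continuous continuous_intros c1 cp)
    finally show "blinfun_apply (integral (cbox (-1) 1) (fx x)) v
      = (\<Sum>j\<in>UNIV. v $ j * box_conv (pderiv_at f j) w x)" by (simp add: box_conv_def)
  qed
  ultimately show ?thesis unfolding box_conv_def[abs_def] by simp
qed

lemma Ck_fun_box_conv:
  assumes "continuous_on UNIV w"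
  shows "smooth_fun f \<Longrightarrow> Ck_fun k (box_conv f w)"
proof (induction k arbitrary: f)
  case 0
  show ?case
    using has_derivative_continuous_on[of UNIV, OF has_derivative_at_withinI[OF box_conv_has_derivative[OF 0 assms]]]
    by simp
next
  case (Suc k)
  show ?case
  proof (rule Ck_fun_SucI[OF box_conv_has_derivative[OF Suc.prems assms]])
    show "Ck_fun k (\<lambda>x. \<Sum>i\<in>UNIV. axis j 1 $ i * box_conv (pderiv_at f i) w x)" for j
      using Suc.IH smooth_fun_pderiv[OF Suc.prems]
      by (intro Ck_fun_sum Ck_fun_mult Ck_fun_const) auto
  qed
qed

lemma smooth_fun_box_conv: "smooth_fun f \<Longrightarrow> continuous_on UNIV w \<Longrightarrow> smooth_fun (box_conv f w)"
  using Ck_fun_box_conv smooth_fun_def by blast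

subsection \<open>Factorization of positive semi-definite matrices\<close>

lemma quadratic_form_add_axis:
  fixes A :: "real^'n^'n"
  assumes "transpose A = A"
  shows "(w + t *\<^sub>R axis s 1) \<bullet> (A *v (w + t *\<^sub>R axis s 1))
    = w \<bullet> (A *v w) + 2 * t * (A *v w) $ s + t\<^sup>2 * A $ s $ s"
proof -
  have 1: "(A *v axis s 1) $ s = A $ s $ s"
    by (simp add: matrix_vector_mult_def axis_def if_distrib cong: if_cong)
  have "w \<bullet> (A *v axis s 1) = (A *v w) \<bullet> axis s 1"
    using dot_lmul_matrix[of w A "axis s 1"] assms
    by (metis transpose_matrix_vector)
  then have 2: "w \<bullet> (A *v axis s 1) = (A *v w) $ s" by (simp add: inner_axis)
  show ?thesis
    by (simp add: matrix_vector_right_distrib inner_add_left inner_add_right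
        matrix_vector_mult_scaleR 2 1 inner_axis' power2_eq_square algebra_simps)
qed

lemma linear_nonneg_imp_zero:
  fixes a b :: real
  assumes "\<And>t. 0 \<le> a + t * b"
  shows "b = 0"
proof (rule ccontr)
  assume "b \<noteq> 0"
  then show False using assms[of "- (a + 1) / b"] by simp
qed

text \<open>The reduced matrix is the Schur complement of the pivot \<open>A $ s $ s\<close>: its
  quadratic form at w is the minimum over t of the form of \<open>A\<close> at w + t e_s, attained
  at t = - (A w)_s / A_ss.\<close>

lemma psd_sym_rank_one_reduce:
  fixes A :: "real^'n^'n"
  assumes A: "psd_sym A" and pos: "A $ s $ s > 0"
  shows "psd_sym (\<chi> i j. A $ i $ j - A $ s $ i * A $ s $ j / A $ s $ s)" (is "psd_sym ?A'")
proof -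
  have sym: "transpose A = A" using A by (simp add: psd_sym_def)
  have "0 \<le> w \<bullet> (?A' *v w)" for w
  proof -
    define c where "c = (A *v w) $ s"
    have c: "A $ s \<bullet> w = c" by (simp add: c_def matrix_vector_mult_def inner_vec_def)
    have "?A' *v w = A *v w - (c / A $ s $ s) *\<^sub>R (A $ s)"
      by (simp add: vec_eq_iff matrix_vector_mult_def c[symmetric] inner_vec_def
          algebra_simps sum_subtractf sum_distrib_left sum_divide_distrib)
    then have "w \<bullet> (?A' *v w) = w \<bullet> (A *v w) - c * c / A $ s $ s"
      using c by (simp add: inner_diff_right inner_commute)
    also have "\<dots> = (w + (- c / A $ s $ s) *\<^sub>R axis s 1) \<bullet> (A *v (w + (- c / A $ s $ s) *\<^sub>R axis s 1))"
      unfolding quadratic_form_add_axis[OF sym] c_def[symmetric]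
      using pos by (simp add: field_simps power2_eq_square)
    also have "\<dots> \<ge> 0" using A by (simp add: psd_sym_def)
    finally show ?thesis .
  qed
  moreover have "transpose ?A' = ?A'"
    using sym by (simp add: transpose_def vec_eq_iff mult.commute)
  ultimately show ?thesis by (simp add: psd_sym_def)
qed

text \<open>Along the line e_j + t e_s the quadratic form has no t^2 term. It is affine in t and
  nonnegative, so its slope 2 A_sj vanishes.\<close>

lemma psd_sym_zero_diagonal:
  fixes A :: "real^'n^'n"
  assumes A: "psd_sym A" and "A $ s $ s = 0"
  shows "A $ s $ j = 0"
proof -
  have sym: "transpose A = A" using A by (simp add: psd_sym_def)
  have "0 \<le> axis j 1 \<bullet> (A *v axis j 1) + t * (2 * (A *v axis j 1) $ s)" for t
  proof -
    have "0 \<le> (axis j 1 + t *\<^sub>R axis s 1) \<bullet> (A *v (axis j 1 + t *\<^sub>R axis s 1))"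
      using A by (simp only: psd_sym_def)
    then show ?thesis unfolding quadratic_form_add_axis[OF sym] assms(2) by (simp add: mult_ac)
  qed
  from linear_nonneg_imp_zero[OF this] show ?thesis
    by (simp add: matrix_vector_mult_def axis_def if_distrib cong: if_cong)
qed

text \<open>Cholesky elimination. The induction runs over a set of indices outside which the rows
  vanish; each step removes one index, either because its row is already zero or by passing to the
  Schur complement.\<close>

lemma psd_sym_eq_sum_supported:
  fixes A :: "real^'n^'n"
  assumes "finite S" "psd_sym A" "\<And>i j. i \<notin> S \<Longrightarrow> A $ i $ j = 0"
  shows "\<exists>v :: 'n \<Rightarrow> real^'n. \<forall>i j. A $ i $ j = (\<Sum>k\<in>S. v k $ i * v k $ j)"
  using assms
proof (induction S arbitrary: A rule: finite_induct)
  case empty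
  then show ?case by auto
next
  case (insert s S)
  have "transpose A $ i $ j = A $ i $ j" for i j
    using insert.prems(1) by (simp only: psd_sym_def)
  then have sym: "A $ i $ j = A $ j $ i" for i j by (simp add: transpose_def)
  show ?case
  proof (cases "A $ s $ s = 0")
    case True
    have "\<exists>v. \<forall>i j. A $ i $ j = (\<Sum>k\<in>S. v k $ i * v k $ j)"
    proof (rule insert.IH[OF insert.prems(1)])
      show "A $ i $ j = 0" if "i \<notin> S" for i j
        using that insert.prems(2)[of i j] psd_sym_zero_diagonal[OF insert.prems(1) True]
        by (cases "i = s") auto
    qed
    then obtain v where v: "\<And>i j. A $ i $ j = (\<Sum>k\<in>S. v k $ i * v k $ j)" by blast
    have "A $ i $ j = (\<Sum>k\<in>insert s S. (v(s := 0)) k $ i * (v(s := 0)) k $ j)" for i j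
    proof -
      have "(\<Sum>k\<in>S. (v(s := 0)) k $ i * (v(s := 0)) k $ j) = (\<Sum>k\<in>S. v k $ i * v k $ j)"
        using insert.hyps by (intro sum.cong) auto
      then show ?thesis using insert.hyps v by simp
    qed
    then show ?thesis by blast
  next
    case False
    have "0 \<le> axis s 1 \<bullet> (A *v axis s 1)" using insert.prems(1) by (simp add: psd_sym_def)
    then have "0 \<le> (A *v axis s 1) $ s" by (simp add: inner_axis')
    then have pos: "A $ s $ s > 0" using False
      by (simp add: matrix_vector_mult_def axis_def if_distrib cong: if_cong)
    let ?A = "\<chi> i j. A $ i $ j - A $ s $ i * A $ s $ j / A $ s $ s"
    have "\<exists>v. \<forall>i j. ?A $ i $ j = (\<Sum>k\<in>S. v k $ i * v k $ j)"
    proof (rule insert.IH[OF psd_sym_rank_one_reduce[OF insert.prems(1) pos]])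
      show "?A $ i $ j = 0" if "i \<notin> S" for i j
        using that insert.prems(2)[of i j] insert.prems(2)[of i s] sym[of i s] pos
        by (cases "i = s") auto
    qed
    then obtain v where v: "\<And>i j. A $ i $ j - A $ s $ i * A $ s $ j / A $ s $ s = (\<Sum>k\<in>S. v k $ i * v k $ j)"
      by auto
    define v' where "v' = v(s := (1 / sqrt (A $ s $ s)) *\<^sub>R (A $ s))"
    have "A $ i $ j = (\<Sum>k\<in>insert s S. v' k $ i * v' k $ j)" for i j
    proof -
      have "(\<Sum>k\<in>S. v' k $ i * v' k $ j) = (\<Sum>k\<in>S. v k $ i * v k $ j)"
        using insert.hyps by (intro sum.cong) (auto simp: v'_def)
      moreover have "v' s $ i * v' s $ j = A $ s $ i * A $ s $ j / A $ s $ s"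
        using pos by (simp add: v'_def)
      ultimately show ?thesis using insert.hyps v[of i j] by simp
    qed
    then show ?thesis by blast
  qed
qed

text \<open>The columns of B are the directions of all later second differences: A : M becomes the
  sum of the quadratic form of M over them, and det A = (det B)^2.\<close>

lemma psd_sym_factorization:
  fixes A :: "real^'n^'n"
  assumes "psd_sym A"
  obtains B :: "real^'n^'n" where "A = B ** transpose B"
proof -
  obtain v :: "'n \<Rightarrow> real^'n" where v: "\<And>i j. A $ i $ j = (\<Sum>k\<in>UNIV. v k $ i * v k $ j)"
    using psd_sym_eq_sum_supported[of UNIV A] assms by auto
  show thesis
    by (rule that[of "\<chi> i k. v k $ i"])
      (simp add: vec_eq_iff matrix_matrix_mult_def transpose_def v)
qed

lemma psd_sym_det_nonneg: "psd_sym A \<Longrightarrow> 0 \<le> det A"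
  by (metis psd_sym_factorization det_mul det_transpose zero_le_square)

subsection \<open>Semidiscrete optimal transport\<close>

text \<open>The slack \<open>s\<close> serves two purposes: s = 0 gives the cells of the transport,
  s > 0 the enlarged cells of the variational argument.\<close>

lemma closed_affine_cell: "closed {p. \<forall>w\<in>I. p \<bullet> w - a w \<le> p \<bullet> v - a v + (s::real)}"
proof -
  have "{p. \<forall>w\<in>I. p \<bullet> w - a w \<le> p \<bullet> v - a v + s}
      = (\<Inter>w\<in>I. {p. p \<bullet> w - a w \<le> p \<bullet> v - a v + s})" by auto
  then show ?thesis by (auto intro!: closed_INT closed_Collect_le continuous_intros)
qed

lemma lmeasurable_affine_cell:
  "{p \<in> cbox l u. \<forall>w\<in>I. p \<bullet> w - a w \<le> p \<bullet> v - a v + (s::real)} \<in> lmeasurable"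
proof -
  have "{p \<in> cbox l u. \<forall>w\<in>I. p \<bullet> w - a w \<le> p \<bullet> v - a v + s}
      = cbox l u \<inter> {p. \<forall>w\<in>I. p \<bullet> w - a w \<le> p \<bullet> v - a v + s}" by auto
  then show ?thesis
    by (simp only: lmeasurable_compact compact_Int_closed compact_cbox closed_affine_cell)
qed

text \<open>Legendre transform of the function with value \<open>a v\<close> at the nodes v in
  \<open>I\<close> and infinity elsewhere. Its variable p is a gradient of the potential to be
  constructed; the pieces of this piecewise affine function are the transport cells.\<close>

definition max_affine :: "'a::euclidean_space set \<Rightarrow> ('a \<Rightarrow> real) \<Rightarrow> 'a \<Rightarrow> real" where
  "max_affine I a p = Max ((\<lambda>v. p \<bullet> v - a v) ` I)"

context
  fixes I :: "'a::euclidean_space set"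
  assumes fin: "finite I" and ne: "I \<noteq> {}"
begin

lemma max_affine_ge: "v \<in> I \<Longrightarrow> p \<bullet> v - a v \<le> max_affine I a p"
  unfolding max_affine_def using fin by auto

lemma max_affine_attained: "\<exists>v\<in>I. max_affine I a p = p \<bullet> v - a v"
proof -
  have "max_affine I a p \<in> (\<lambda>v. p \<bullet> v - a v) ` I"
    unfolding max_affine_def using fin ne by (intro Max_in) auto
  then show ?thesis by blast
qed

lemma max_affine_le: "(\<And>v. v \<in> I \<Longrightarrow> p \<bullet> v - a v \<le> y) \<Longrightarrow> max_affine I a p \<le> y"
  using max_affine_attained[of a p] by auto

lemma max_affine_lipschitz:
  assumes "\<And>v. v \<in> I \<Longrightarrow> norm v \<le> B"
  shows "\<bar>max_affine I a p - max_affine I a q\<bar> \<le> B * norm (p - q)"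
proof -
  have *: "max_affine I a p \<le> max_affine I a q + B * norm (p - q)" for p q
  proof (rule max_affine_le)
    fix v assume v: "v \<in> I"
    have "(p - q) \<bullet> v \<le> norm (p - q) * norm v" by (rule norm_cauchy_schwarz)
    also have "\<dots> \<le> norm (p - q) * B" using assms[OF v] by (intro mult_left_mono) auto
    finally show "p \<bullet> v - a v \<le> max_affine I a q + B * norm (p - q)"
      using max_affine_ge[OF v, of q a] by (simp add: inner_diff_left mult.commute)
  qed
  show ?thesis using *[of p q] *[of q p] by (simp add: norm_minus_commute)
qed

lemma max_affine_continuous: "continuous_on S (max_affine I a)"
proof -
  have "norm v \<le> (\<Sum>v\<in>I. norm v)" if "v \<in> I" for v
    using fin that by (intro member_le_sum) auto
  from max_affine_lipschitz[OF this] have "(\<Sum>v\<in>I. norm v)-lipschitz_on S (max_affine I a)"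
    by (intro lipschitz_onI) (auto simp: dist_norm sum_nonneg)
  then show ?thesis by (rule lipschitz_on_continuous_on)
qed

lemma max_affine_shift:
  assumes "\<And>v. v \<in> I \<Longrightarrow> b v = a v + c"
  shows "max_affine I b p = max_affine I a p - c"
proof (rule antisym)
  show "max_affine I b p \<le> max_affine I a p - c"
    using max_affine_ge assms by (intro max_affine_le) fastforce
  have "max_affine I a p \<le> max_affine I b p + c"
    using max_affine_ge[of _ p b] assms by (intro max_affine_le) fastforce
  then show "max_affine I a p - c \<le> max_affine I b p" by simp
qed

context
  fixes m :: "'a \<Rightarrow> real" and l u :: 'a
  assumes mpos: "\<And>v. v \<in> I \<Longrightarrow> 0 < m v"
    and total: "sum m I = measure lborel (cbox l u)"
begin

text \<open>The Kantorovich dual functional of the transport from Lebesgue measure on a box to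
  \<open>\<Sum>v\<in>I. m v \<delta>\<^sub>v\<close>.\<close>

definition dual_functional :: "('a \<Rightarrow> real) \<Rightarrow> real" where
  "dual_functional a = integral (cbox l u) (max_affine I a) + (\<Sum>v\<in>I. m v * a v)"

lemma integrable_max_affine: "max_affine I a integrable_on cbox l u"
  by (intro integrable_continuous max_affine_continuous)

text \<open>Adding c to the potential lowers the integral by c times the volume of the box and
  raises the sum by c times the total mass; these agree by \<open>total\<close>. A minimizer can
  thus be sought among potentials with minimum 0.\<close>

lemma dual_functional_shift:
  assumes "\<And>v. v \<in> I \<Longrightarrow> b v = a v + c"
  shows "dual_functional b = dual_functional a"
proof -
  have "integral (cbox l u) (max_affine I b) = integral (cbox l u) (\<lambda>p. max_affine I a p - c)"
    using max_affine_shift[of b a c] assms by (simp cong: integral_cong)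
  also have "\<dots> = integral (cbox l u) (max_affine I a) - measure lborel (cbox l u) * c"
    by (subst integral_diff) (auto intro: integrable_max_affine)
  moreover have "(\<Sum>v\<in>I. m v * b v) = (\<Sum>v\<in>I. m v * a v) + sum m I * c"
    using assms by (simp add: algebra_simps sum.distrib sum_distrib_left)
  ultimately show ?thesis by (simp add: dual_functional_def total)
qed

lemma dual_functional_lipschitz:
  "\<bar>dual_functional a - dual_functional b\<bar>
    \<le> (measure lborel (cbox l u) + sum m I) * (\<Sum>v\<in>I. \<bar>a v - b v\<bar>)"
proof -
  let ?d = "\<Sum>v\<in>I. \<bar>a v - b v\<bar>"
  have le: "\<bar>a v - b v\<bar> \<le> ?d" if "v \<in> I" for v
    using fin that by (intro member_le_sum) auto
  have *: "dual_functional a \<le> dual_functional b + (measure lborel (cbox l u) + sum m I) * ?d"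
    if le: "\<And>v. v \<in> I \<Longrightarrow> \<bar>a v - b v\<bar> \<le> ?d" for a b :: "'a \<Rightarrow> real"
  proof -
    have "max_affine I a p \<le> max_affine I b p + ?d" for p
    proof (rule max_affine_le)
      fix v assume "v \<in> I"
      then show "p \<bullet> v - a v \<le> max_affine I b p + ?d"
        using max_affine_ge[of v p b] le[of v] by linarith
    qed
    then have "integral (cbox l u) (max_affine I a) \<le> integral (cbox l u) (\<lambda>p. max_affine I b p + ?d)"
      by (intro integral_le integrable_max_affine integrable_add) auto
    also have "\<dots> = integral (cbox l u) (max_affine I b) + measure lborel (cbox l u) * ?d"
      by (subst integral_add) (auto intro: integrable_max_affine)
    finally have 1: "integral (cbox l u) (max_affine I a)
      \<le> integral (cbox l u) (max_affine I b) + measure lborel (cbox l u) * ?d" .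
    have "(\<Sum>v\<in>I. m v * a v) \<le> (\<Sum>v\<in>I. m v * (b v + ?d))"
    proof (intro sum_mono mult_left_mono)
      fix v assume "v \<in> I"
      then show "a v \<le> b v + ?d" "0 \<le> m v" using le[of v] mpos[of v] by linarith+
    qed
    then have "(\<Sum>v\<in>I. m v * a v) \<le> (\<Sum>v\<in>I. m v * b v) + sum m I * ?d"
      by (simp add: distrib_left sum.distrib sum_distrib_right)
    with 1 show ?thesis by (simp add: dual_functional_def algebra_simps)
  qed
  have "(\<Sum>v\<in>I. \<bar>b v - a v\<bar>) = ?d" by (simp add: abs_minus_commute)
  moreover have "dual_functional a - dual_functional b
      \<le> (measure lborel (cbox l u) + sum m I) * ?d"
    using *[of a b] le by simp
  moreover have "dual_functional b - dual_functional a
      \<le> (measure lborel (cbox l u) + sum m I) * (\<Sum>v\<in>I. \<bar>b v - a v\<bar>)"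
    using *[of b a] le by (simp add: calculation(1) abs_minus_commute)
  ultimately show ?thesis by (simp add: abs_le_iff)
qed

text \<open>Keep only the affine piece of the lowest node \<open>w\<close> in the maximum and only
  the term of \<open>v\<close> in the sum of the nonnegative m x (a x - a w). Equal total masses
  cancel the remaining multiples of \<open>a w\<close>.\<close>

lemma dual_functional_coercive:
  assumes L: "\<And>p v. p \<in> cbox l u \<Longrightarrow> v \<in> I \<Longrightarrow> \<bar>p \<bullet> v\<bar> \<le> L"
    and w: "w \<in> I" "\<And>v. v \<in> I \<Longrightarrow> a w \<le> a v" and v: "v \<in> I"
  shows "m v * (a v - a w) - L * measure lborel (cbox l u) \<le> dual_functional a"
proof -
  have "integral (cbox l u) (\<lambda>p. - L - a w) \<le> integral (cbox l u) (max_affine I a)"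
  proof (intro integral_le integrable_max_affine integrable_const)
    fix p assume "p \<in> cbox l u"
    then show "- L - a w \<le> max_affine I a p"
      using L[OF _ w(1)] max_affine_ge[OF w(1), of p a] by fastforce
  qed
  then have 1: "- L * measure lborel (cbox l u) - sum m I * a w \<le> integral (cbox l u) (max_affine I a)"
    by (simp add: total algebra_simps)
  have "m v * (a v - a w) \<le> (\<Sum>x\<in>I. m x * (a x - a w))"
    using w(2) mpos v fin by (intro member_le_sum) (auto intro!: mult_nonneg_nonneg simp: less_imp_le)
  then have "m v * (a v - a w) \<le> (\<Sum>x\<in>I. m x * a x) - sum m I * a w"
    by (simp add: right_diff_distrib sum_subtractf sum_distrib_right)
  with 1 show ?thesis by (simp add: dual_functional_def)
qed

lemma dual_functional_attains_min: "\<exists>a. \<forall>b. dual_functional a \<le> dual_functional b"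
proof -
  obtain B where B: "\<And>p. p \<in> cbox l u \<Longrightarrow> norm p \<le> B"
    using bounded_cbox[of l u] by (auto simp: bounded_iff)
  define L where "L = \<bar>B\<bar> * (\<Sum>v\<in>I. norm v)"
  have L: "\<bar>p \<bullet> v\<bar> \<le> L" if "p \<in> cbox l u" "v \<in> I" for p v
  proof -
    have "\<bar>p \<bullet> v\<bar> \<le> norm p * norm v" by (rule Cauchy_Schwarz_ineq2)
    also have "\<dots> \<le> L" unfolding L_def
      using B[OF that(1)] fin that(2) by (intro mult_mono member_le_sum) auto
    finally show ?thesis .
  qed
  define mm where "mm = Min (m ` I)"
  have mm: "0 < mm" "\<And>v. v \<in> I \<Longrightarrow> mm \<le> m v"
    unfolding mm_def using fin ne mpos by auto
  define c where "c = measure lborel (cbox l u)"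
  \<comment> \<open>Chosen so that a normalized potential with some value above \<open>M\<close>
    has, by coercivity, a functional no smaller than the zero potential has.\<close>
  define M where "M = (dual_functional (\<lambda>_. 0) + L * c) / mm"
  obtain v0 where v0: "v0 \<in> I" using ne by blast
  have M: "0 \<le> M" "dual_functional (\<lambda>_. 0) = mm * M - L * c"
    using dual_functional_coercive[OF L v0, of "\<lambda>_. 0" v0] v0 mm(1)
    by (auto simp: M_def c_def intro!: divide_nonneg_pos)
  \<comment> \<open>Coordinates outside \<open>I\<close> are pinned to 0, so the set is compact in
    the product topology on all functions.\<close>
  define X where "X = PiE UNIV (\<lambda>v. if v \<in> I then {0..M} else {0})"
  have "compactin (product_topology (\<lambda>_. euclidean) UNIV) X"
    unfolding X_def compactin_PiE by auto
  then have "compact X" by (simp add: euclidean_product_topology)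
  moreover have zX: "(\<lambda>_. 0) \<in> X" using M by (auto simp: X_def)
  moreover have "continuous_on X dual_functional"
    unfolding continuous_on
  proof
    fix a assume "a \<in> X"
    let ?g = "\<lambda>b. (c + sum m I) * (\<Sum>v\<in>I. \<bar>b v - a v\<bar>)"
    have "continuous_on X ?g"
      by (intro continuous_intros continuous_on_subset[OF continuous_on_product_coordinates]) auto
    then have "(?g \<longlongrightarrow> ?g a) (at a within X)" using \<open>a \<in> X\<close> by (simp only: continuous_on)
    then have "(?g \<longlongrightarrow> 0) (at a within X)" by simp
    then have "((\<lambda>b. dual_functional b - dual_functional a) \<longlongrightarrow> 0) (at a within X)"
      by (rule Lim_null_comparison[rotated])
        (use dual_functional_lipschitz in \<open>auto simp: c_def\<close>)
    then show "(dual_functional \<longlongrightarrow> dual_functional a) (at a within X)"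
      by (simp add: LIM_zero_iff)
  qed
  ultimately obtain a where a: "a \<in> X" "\<And>b. b \<in> X \<Longrightarrow> dual_functional a \<le> dual_functional b"
    using continuous_attains_inf[of X dual_functional] by blast
  have "dual_functional a \<le> dual_functional b" for b
  proof -
    obtain w where w: "w \<in> I" "\<And>v. v \<in> I \<Longrightarrow> b w \<le> b v"
      using ex_min_if_finite[of "b ` I"] fin ne by (metis arg_min_if_finite(1) arg_min_least)
    define b' where "b' v = (if v \<in> I then b v - b w else 0)" for v
    have eq: "dual_functional b = dual_functional b'"
      by (rule dual_functional_shift[of _ _ "b w"]) (auto simp: b'_def)
    show ?thesis
    proof (cases "b' \<in> X")
      case True
      then show ?thesis using a(2) eq by simp
    next
      case False
      then obtain v where v: "v \<in> I" "b' v > M"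
        using w M(1) by (auto simp: X_def b'_def PiE_iff split: if_splits)
      have "mm * M \<le> m v * (b' v - b' w)"
        using mm(1) mm(2)[OF v(1)] v M(1) w by (intro mult_mono) (auto simp: b'_def)
      then have "dual_functional a \<le> m v * (b' v - b' w) - L * c"
        using a(2)[OF zX] M(2) by simp
      also have "\<dots> \<le> dual_functional b'" unfolding c_def
        by (rule dual_functional_coercive[OF L w(1) _ v(1)]) (use w in \<open>auto simp: b'_def\<close>)
      finally show ?thesis using eq by simp
    qed
  qed
  then show ?thesis by blast
qed

text \<open>One-sided variation: lowering \<open>a\<close> at \<open>v\<close> by \<open>s\<close>
  lowers the sum by s m_v, and raises the maximum by at most \<open>s\<close>, only on the cell
  enlarged by slack \<open>s\<close>. Minimality compares the two.\<close>

lemma minimizer_cell_measure: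
  assumes min: "\<And>b. dual_functional a \<le> dual_functional b" and v: "v \<in> I" and s: "s > 0"
  shows "m v \<le> measure lebesgue {p \<in> cbox l u. \<forall>w\<in>I. p \<bullet> w - a w \<le> p \<bullet> v - a v + s}"
    (is "_ \<le> measure lebesgue ?V")
proof -
  define b where "b = a(v := a v - s)"
  have lm: "?V \<in> lmeasurable" by (rule lmeasurable_affine_cell)
  have "max_affine I b p \<le> max_affine I a p + s * indicator ?V p" if p: "p \<in> cbox l u" for p
  proof (rule max_affine_le)
    fix w assume w: "w \<in> I"
    show "p \<bullet> w - b w \<le> max_affine I a p + s * indicator ?V p"
    proof (cases "w = v \<and> p \<notin> ?V")
      case True
      then obtain x where "x \<in> I" "p \<bullet> v - a v + s < p \<bullet> x - a x" using p by auto
      then show ?thesis using True max_affine_ge[of x p a] by (simp add: b_def)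
    next
      case False
      then show ?thesis using max_affine_ge[OF w, of p a] s
        by (auto simp: b_def indicator_def)
    qed
  qed
  moreover have int: "(\<lambda>p. s * indicator ?V p) integrable_on cbox l u"
    "integral (cbox l u) (\<lambda>p. s * indicator ?V p) = s * measure lebesgue ?V"
  proof -
    have "?V \<inter> cbox l u = ?V" by auto
    then have "(indicator ?V has_integral measure lebesgue ?V) (cbox l u)"
      unfolding has_integral_iff
      using lm integral_indicator[of ?V "cbox l u"] integrable_on_indicator[of ?V "cbox l u"]
      by simp
    from has_integral_mult_right[OF this, of s]
    show "(\<lambda>p. s * indicator ?V p) integrable_on cbox l u"
      "integral (cbox l u) (\<lambda>p. s * indicator ?V p) = s * measure lebesgue ?V"
      by (auto simp: has_integral_iff)
  qed
  ultimately have "integral (cbox l u) (max_affine I b)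
      \<le> integral (cbox l u) (\<lambda>p. max_affine I a p + s * indicator ?V p)"
    by (intro integral_le integrable_add integrable_max_affine) auto
  also have "\<dots> = integral (cbox l u) (max_affine I a) + s * measure lebesgue ?V"
    using int by (subst integral_add) (auto intro: integrable_max_affine)
  moreover have "(\<Sum>w\<in>I. m w * b w) = (\<Sum>w\<in>I. m w * a w) - s * m v"
    using fin v by (simp add: b_def sum.remove[of I v] algebra_simps)
  ultimately have "s * m v \<le> s * measure lebesgue ?V"
    using min[of b] by (simp add: dual_functional_def)
  then show ?thesis using s by simp
qed

text \<open>The cells with slack 1/(n+1) decrease to the exact cell and have finite measure, so the
  bound of \<open>minimizer_cell_measure\<close> passes to the limit.\<close>

lemma semidiscrete_transport:
  "\<exists>a. \<forall>v\<in>I. m v \<le> measure lebesgue {p \<in> cbox l u. \<forall>w\<in>I. p \<bullet> w - a w \<le> p \<bullet> v - a v}"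
proof -
  obtain a where a: "\<And>b. dual_functional a \<le> dual_functional b"
    using dual_functional_attains_min by blast
  have "m v \<le> measure lebesgue {p \<in> cbox l u. \<forall>w\<in>I. p \<bullet> w - a w \<le> p \<bullet> v - a v}" if v: "v \<in> I" for v
  proof -
    define V where "V n = {p \<in> cbox l u. \<forall>w\<in>I. p \<bullet> w - a w \<le> p \<bullet> v - a v + 1 / Suc n}" for n
    have V: "V n \<in> lmeasurable" for n
      unfolding V_def by (rule lmeasurable_affine_cell)
    have "decseq V"
    proof (rule decseq_SucI)
      fix n
      have "1 / real (Suc (Suc n)) \<le> 1 / real (Suc n)" by (simp add: frac_le)
      then show "V (Suc n) \<subseteq> V n" unfolding V_def by fastforce
    qed
    moreover have "range V \<subseteq> sets lebesgue" "emeasure lebesgue (V n) \<noteq> \<infinity>" for n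
      using fmeasurableD[OF V] fmeasurableD2[OF V] by auto
    ultimately have "(\<lambda>n. measure lebesgue (V n)) \<longlonglongrightarrow> measure lebesgue (\<Inter>n. V n)"
      by (intro Lim_measure_decseq)
    moreover have "m v \<le> measure lebesgue (V n)" for n
      unfolding V_def by (rule minimizer_cell_measure[OF a v]) simp
    ultimately have "m v \<le> measure lebesgue (\<Inter>n. V n)"
      by (intro LIMSEQ_le_const) auto
    also have "(\<Inter>n. V n) = {p \<in> cbox l u. \<forall>w\<in>I. p \<bullet> w - a w \<le> p \<bullet> v - a v}"
    proof -
      have lim: "x \<le> y" if "\<And>n. x \<le> y + 1 / Suc n" for x y :: real
      proof (rule LIMSEQ_le_const)
        show "(\<lambda>n. y + 1 / Suc n) \<longlonglongrightarrow> y"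
          using tendsto_add[OF tendsto_const[of y] LIMSEQ_inverse_real_of_nat] by (simp add: inverse_eq_divide)
      qed (use that in auto)
      show ?thesis
      proof (intro set_eqI iffI)
        fix p assume "p \<in> (\<Inter>n. V n)"
        then have p: "p \<in> V n" for n by blast
        have "p \<bullet> w - a w \<le> p \<bullet> v - a v" if "w \<in> I" for w
        proof (rule lim)
          show "p \<bullet> w - a w \<le> p \<bullet> v - a v + 1 / Suc n" for n
            using p[of n] that by (simp add: V_def)
        qed
        then show "p \<in> {p \<in> cbox l u. \<forall>w\<in>I. p \<bullet> w - a w \<le> p \<bullet> v - a v}"
          using p[of 0] by (simp add: V_def)
      qed (auto simp: V_def intro: order_trans)
    qed
    finally show ?thesis .
  qed
  then show ?thesis by blast
qed

end

end

subsection \<open>Lebesgue measure of linear images\<close>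

text \<open>The library states the scaling of Lebesgue measure under linear maps only for well-ordered
  index types.\<close>

lemma det_shear:
  fixes m n :: "'n::finite"
  assumes "m \<noteq> n"
  shows "det (matrix (\<lambda>x::real^'n. \<chi> i. if i = m then x $ m + x $ n else x $ i)) = 1"
proof -
  have "matrix (\<lambda>x::real^'n. \<chi> i. if i = m then x $ m + x $ n else x $ i)
      = (\<chi> k. if k = m then row m (mat 1) + 1 *s row n (mat 1) else row k (mat 1 :: real^'n^'n))"
    by (auto simp: matrix_def row_def mat_def axis_def vec_eq_iff)
  then show ?thesis using det_row_operation[OF assms, of "mat 1 :: real^'n^'n" 1] by simp
qed

lemma measure_shear_cbox:
  fixes a b :: "real^'n"
  assumes "m \<noteq> n"
  shows "measure lebesgue ((\<lambda>x. \<chi> i. if i = m then x $ m + x $ n else x $ i) ` cbox a b)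
    = measure lebesgue (cbox a b)" (is "measure lebesgue (?f ` _) = _")
proof (cases "cbox a b = {}")
  case False
  \<comment> \<open>Subtracting c makes the n-th lower bound of the box equal to 0, which meets the
    sign condition of \<open>measure_shear_interval\<close>.\<close>
  define c where "c = axis n (a $ n)"
  have lin: "linear ?f"
    by (rule linearI) (auto simp: vec_eq_iff algebra_simps)
  have "?f ` cbox a b = (+) (?f c) ` ?f ` cbox (a - c) (b - c)"
  proof -
    have "cbox a b = (+) c ` cbox (a - c) (b - c)"
      using cbox_translation[of c "a - c" "b - c"] by simp
    then show ?thesis by (simp add: image_comp o_def linear_add[OF lin])
  qed
  then have "measure lebesgue (?f ` cbox a b) = measure lebesgue (?f ` cbox (a - c) (b - c))"
    by (simp add: measure_translation)
  also have "\<dots> = measure lebesgue (cbox (a - c) (b - c))"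
  proof (rule measure_shear_interval[OF assms])
    show "cbox (a - c) (b - c) \<noteq> {}" using False by (auto simp: interval_ne_empty_cart)
  qed (simp add: c_def)
  also have "cbox (a - c) (b - c) = (+) (- c) ` cbox a b"
    using cbox_translation[of "- c" a b] by simp
  also have "measure lebesgue \<dots> = measure lebesgue (cbox a b)" by (rule measure_translation)
  finally show ?thesis .
qed simp

lemma swap_cbox:
  fixes a b :: "real^'n"
  shows "measure lebesgue ((\<lambda>x. \<chi> i. x $ Transposition.transpose m n i) ` cbox a b)
    = measure lebesgue (cbox a b)" (is "measure lebesgue (?f ` _) = _")
proof (cases "cbox a b = {}")
  case False
  have inv: "?f (?f x) = x" for x by (simp add: vec_eq_iff)
  have sub: "?f ` cbox a b \<subseteq> cbox (?f a) (?f b)" for a b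
    by (auto simp: mem_box_cart)
  have "cbox (?f a) (?f b) \<subseteq> ?f ` cbox a b"
  proof
    fix x assume "x \<in> cbox (?f a) (?f b)"
    then have "?f x \<in> cbox a b" using sub[of "?f a" "?f b"] by (simp only: inv) blast
    then show "x \<in> ?f ` cbox a b" by (metis inv image_eqI)
  qed
  with sub have eq: "?f ` cbox a b = cbox (?f a) (?f b)" by blast
  have ne: "cbox (?f a) (?f b) \<noteq> {}" using False eq by blast
  have "(\<Prod>i\<in>UNIV. (b - a) $ Transposition.transpose m n i) = (\<Prod>i\<in>UNIV. (b - a) $ i)"
    using prod.permute[OF permutes_swap_id, of m UNIV n "\<lambda>i. (b - a) $ i"] by (simp add: o_def)
  then show ?thesis unfolding eq using False ne by (simp add: content_cbox_cart)
qed simp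

lemma det_swap: "\<bar>det (matrix (\<lambda>x::real^'n. \<chi> i. x $ Transposition.transpose m n i))\<bar> = 1"
proof -
  have "matrix (\<lambda>x::real^'n. \<chi> i. x $ Transposition.transpose m n i)
      = (\<chi> i. (mat 1 :: real^'n^'n) $ Transposition.transpose m n i)"
    by (auto simp: matrix_def mat_def axis_def vec_eq_iff)
  then show ?thesis
    using det_permute_rows[OF permutes_swap_id, of m n "mat 1 :: real^'n^'n"]
    by (simp add: abs_mult sign_def)
qed

text \<open>Linear maps are generated by maps with a vanishing coordinate, coordinate stretchings,
  transpositions and shears. For the last two the volume of boxes is preserved, and
  \<open>measure_linear_sufficient\<close> passes from boxes to measurable sets.\<close>

lemma lebesgue_linear_image:
  fixes f :: "real^'n \<Rightarrow> real^'n"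
  assumes "linear f" "S \<in> lmeasurable"
  shows "f ` S \<in> lmeasurable \<and> measure lebesgue (f ` S) = \<bar>det (matrix f)\<bar> * measure lebesgue S"
proof -
  have "\<forall>S \<in> lmeasurable. f ` S \<in> lmeasurable \<and> measure lebesgue (f ` S) = \<bar>det (matrix f)\<bar> * measure lebesgue S"
  proof (induct rule: induct_linear_elementary[OF assms(1), case_names comp zeroes const swap idplus])
    case (comp f g)
    show ?case
    proof
      fix S :: "(real^'n) set" assume "S \<in> lmeasurable"
      then have g: "g ` S \<in> lmeasurable" "measure lebesgue (g ` S) = \<bar>det (matrix g)\<bar> * measure lebesgue S"
        using comp(4) by auto
      then show "(f \<circ> g) ` S \<in> lmeasurable \<and>
          measure lebesgue ((f \<circ> g) ` S) = \<bar>det (matrix (f \<circ> g))\<bar> * measure lebesgue S"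
        using comp(3) unfolding image_comp[symmetric] matrix_compose[OF comp(2,1)]
        by (simp add: abs_mult det_mul)
    qed
  next
    case (zeroes f i)
    then have "\<not> surj f" by (metis UNIV_I image_iff one_neq_zero vec_component)
    then have "\<not> inj f" using zeroes(1) linear_injective_imp_surjective by blast
    then have "negligible (f ` S)" for S using negligible_linear_singular_image zeroes(1) by blast
    moreover have "det (matrix f) = 0" using \<open>\<not> inj f\<close> det_nz_iff_inj zeroes(1) by blast
    ultimately show ?case by (auto simp: negligible_iff_measure)
  next
    case (const c)
    have "matrix (\<lambda>x::real^'n. \<chi> i. c i * x $ i) = (\<chi> i j. if i = j then c i else 0)"
      by (auto simp: matrix_def axis_def vec_eq_iff)
    then have "det (matrix (\<lambda>x::real^'n. \<chi> i. c i * x $ i)) = prod c UNIV"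
      by (simp add: det_diagonal)
    then show ?case by (simp add: measurable_stretch measure_stretch)
  next
    case (swap m n)
    have "linear (\<lambda>x::real^'n. \<chi> i. x $ Transposition.transpose m n i)"
      by (rule linearI) (auto simp: vec_eq_iff)
    note lin = this
    show ?case
    proof
      fix S :: "(real^'n) set" assume S: "S \<in> lmeasurable"
      let ?f = "\<lambda>x::real^'n. \<chi> i. x $ Transposition.transpose m n i"
      have "?f ` S \<in> lmeasurable \<and> 1 * measure lebesgue S = measure lebesgue (?f ` S)"
        by (rule measure_linear_sufficient[OF lin S]) (simp only: swap_cbox mult_1)
      then show "?f ` S \<in> lmeasurable \<and> measure lebesgue (?f ` S) = \<bar>det (matrix ?f)\<bar> * measure lebesgue S"
        using det_swap[of m n] by simp
    qed
  next
    case (idplus m n)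
    have "linear (\<lambda>x::real^'n. \<chi> i. if i = m then x $ m + x $ n else x $ i)"
      by (rule linearI) (auto simp: vec_eq_iff algebra_simps)
    note lin = this
    show ?case
    proof
      fix S :: "(real^'n) set" assume S: "S \<in> lmeasurable"
      let ?f = "\<lambda>x::real^'n. \<chi> i. if i = m then x $ m + x $ n else x $ i"
      have "?f ` S \<in> lmeasurable \<and> 1 * measure lebesgue S = measure lebesgue (?f ` S)"
        by (rule measure_linear_sufficient[OF lin S]) (simp only: measure_shear_cbox[OF idplus] mult_1)
      then show "?f ` S \<in> lmeasurable \<and> measure lebesgue (?f ` S) = \<bar>det (matrix ?f)\<bar> * measure lebesgue S"
        using det_shear[OF idplus] by simp
    qed
  qed
  with assms(2) show ?thesis by blast
qed

lemma measure_matrix_image: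
  fixes B :: "real^'n^'n"
  assumes "S \<in> lmeasurable"
  shows "(*v) B ` S \<in> lmeasurable" "measure lebesgue ((*v) B ` S) = \<bar>det B\<bar> * measure lebesgue S"
  using lebesgue_linear_image[OF matrix_vector_mul_linear assms, of B] by auto

subsection \<open>Convex functions with prescribed subdifferential volume\<close>

text \<open>Conjugate with the dual variable confined to \<open>K\<close>. The confinement bounds
  the Lipschitz constant of the transform by the radius of \<open>K\<close>, whatever the potential
  is.\<close>

definition legendre :: "'a::euclidean_space set \<Rightarrow> ('a \<Rightarrow> real) \<Rightarrow> 'a \<Rightarrow> real" where
  "legendre K \<phi> x = Sup ((\<lambda>p. p \<bullet> x - \<phi> p) ` K)"

context
  fixes K :: "'a::euclidean_space set"
  assumes K: "compact K" "K \<noteq> {}"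
begin

lemma legendre_attained_ge:
  assumes "continuous_on K \<phi>"
  shows "\<exists>p\<in>K. legendre K \<phi> x = p \<bullet> x - \<phi> p" "p \<in> K \<Longrightarrow> p \<bullet> x - \<phi> p \<le> legendre K \<phi> x"
proof -
  have "continuous_on K (\<lambda>p. p \<bullet> x - \<phi> p)" by (intro continuous_intros assms)
  from continuous_attains_sup[OF K this]
  obtain p0 where p0: "p0 \<in> K" "\<And>p. p \<in> K \<Longrightarrow> p \<bullet> x - \<phi> p \<le> p0 \<bullet> x - \<phi> p0"
    by blast
  have "legendre K \<phi> x = p0 \<bullet> x - \<phi> p0"
    unfolding legendre_def by (rule cSup_eq_maximum) (use p0 in auto)
  then show "\<exists>p\<in>K. legendre K \<phi> x = p \<bullet> x - \<phi> p" "p \<in> K \<Longrightarrow> p \<bullet> x - \<phi> p \<le> legendre K \<phi> x"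
    using p0 by auto
qed

lemmas legendre_attained = legendre_attained_ge(1) and legendre_ge = legendre_attained_ge(2)

lemma legendre_convex:
  assumes "continuous_on K \<phi>"
  shows "convex_on UNIV (legendre K \<phi>)"
proof (intro convex_onI)
  fix t :: real and x y :: 'a assume t: "0 < t" "t < 1"
  obtain p where p: "p \<in> K" "legendre K \<phi> ((1 - t) *\<^sub>R x + t *\<^sub>R y) = p \<bullet> ((1 - t) *\<^sub>R x + t *\<^sub>R y) - \<phi> p"
    using legendre_attained[OF assms] by blast
  have "p \<bullet> ((1 - t) *\<^sub>R x + t *\<^sub>R y) - \<phi> p = (1 - t) * (p \<bullet> x - \<phi> p) + t * (p \<bullet> y - \<phi> p)"
    by (simp add: inner_add_right algebra_simps)
  also have "\<dots> \<le> (1 - t) * legendre K \<phi> x + t * legendre K \<phi> y"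
    using legendre_ge[OF assms p(1)] t by (intro add_mono mult_left_mono) auto
  finally show "legendre K \<phi> ((1 - t) *\<^sub>R x + t *\<^sub>R y) \<le> (1 - t) * legendre K \<phi> x + t * legendre K \<phi> y"
    using p(2) by simp
qed auto

lemma legendre_lipschitz:
  assumes "continuous_on K \<phi>" and L: "\<And>p. p \<in> K \<Longrightarrow> norm p \<le> L"
  shows "\<bar>legendre K \<phi> x - legendre K \<phi> y\<bar> \<le> L * norm (x - y)"
proof -
  have *: "legendre K \<phi> x - legendre K \<phi> y \<le> L * norm (x - y)" for x y
  proof -
    obtain p where p: "p \<in> K" "legendre K \<phi> x = p \<bullet> x - \<phi> p"
      using legendre_attained[OF assms(1)] by blast
    have "legendre K \<phi> x - legendre K \<phi> y \<le> p \<bullet> (x - y)"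
      using p legendre_ge[OF assms(1) p(1), of y] by (simp add: inner_diff_right)
    also have "\<dots> \<le> norm p * norm (x - y)" by (rule norm_cauchy_schwarz)
    also have "\<dots> \<le> L * norm (x - y)" using L[OF p(1)] by (intro mult_right_mono) auto
    finally show ?thesis .
  qed
  from *[of x y] *[of y x] show ?thesis by (simp add: norm_minus_commute abs_le_iff)
qed

lemma legendre_close:
  assumes "continuous_on K \<phi>" "continuous_on K \<phi>'" and e: "\<And>p. p \<in> K \<Longrightarrow> \<bar>\<phi> p - \<phi>' p\<bar> \<le> e"
  shows "\<bar>legendre K \<phi> x - legendre K \<phi>' x\<bar> \<le> e"
proof -
  have *: "legendre K \<phi> x - legendre K \<phi>' x \<le> e"
    if c: "continuous_on K \<phi>" "continuous_on K \<phi>'" and e: "\<And>p. p \<in> K \<Longrightarrow> \<bar>\<phi> p - \<phi>' p\<bar> \<le> e" for \<phi> \<phi>'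
  proof -
    obtain p where p: "p \<in> K" "legendre K \<phi> x = p \<bullet> x - \<phi> p"
      using legendre_attained[OF c(1)] by blast
    then show ?thesis using legendre_ge[OF c(2) p(1), of x] e[OF p(1)] by linarith
  qed
  from *[OF assms] *[of \<phi>' \<phi>] assms show ?thesis by (simp add: abs_le_iff abs_minus_commute)
qed

end

text \<open>Symmetric second difference, the substitute for a second derivative of a function that
  is only convex. Being linear in f, it passes to pointwise limits and to averages.\<close>

definition sdiff :: "('a::real_vector \<Rightarrow> real) \<Rightarrow> 'a \<Rightarrow> 'a \<Rightarrow> real" where
  "sdiff f x v = f (x + v) + f (x - v) - 2 * f x"

lemma sdiff_nonneg:
  assumes "convex_on UNIV f"
  shows "0 \<le> sdiff f x v"
proof -
  have "f ((1 - 1/2) *\<^sub>R (x + v) + (1/2) *\<^sub>R (x - v)) \<le> (1 - 1/2) * f (x + v) + (1/2) * f (x - v)"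
    using assms by (intro convex_onD) auto
  moreover have "(1 - 1/2) *\<^sub>R (x + v) + (1/2) *\<^sub>R (x - v) = x"
    by (simp add: algebra_simps flip: scaleR_add_left)
  ultimately show ?thesis by (simp add: sdiff_def)
qed

text \<open>Subtracting the supporting affine function at \<open>q\<close> leaves a convex w \<ge> 0
  with w(0) = 0. On the cross-polytope with vertices \<plusminus>t times the columns of
  \<open>B\<close>, w is at most its largest vertex value, and the sum of all vertex values is the
  sum of the second differences.\<close>

lemma convex_cross_polytope_bound:
  fixes B :: "real^'n^'n"
  assumes conv: "convex_on UNIV \<psi>" and sub: "\<And>y. \<psi> q + p0 \<bullet> (y - q) \<le> \<psi> y"
    and t: "t > 0" and z: "(\<Sum>j\<in>UNIV. \<bar>z $ j\<bar>) \<le> t"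
  shows "\<psi> (q + B *v z) - \<psi> q - p0 \<bullet> (B *v z) \<le> (\<Sum>j\<in>UNIV. sdiff \<psi> q (t *\<^sub>R column j B))"
proof -
  define w where "w y = \<psi> (q + y) - \<psi> q - p0 \<bullet> y" for y
  have w0: "w y \<ge> 0" for y using sub[of "q + y"] by (simp add: w_def)
  have wz: "w 0 = 0" by (simp add: w_def)
  have wconv: "convex_on UNIV w"
  proof (intro convex_onI)
    fix s :: real and x y :: "real^'n" assume s: "0 < s" "s < 1"
    have "\<psi> ((1 - s) *\<^sub>R (q + x) + s *\<^sub>R (q + y)) \<le> (1 - s) * \<psi> (q + x) + s * \<psi> (q + y)"
      using s by (intro convex_onD[OF conv]) auto
    moreover have "(1 - s) *\<^sub>R (q + x) + s *\<^sub>R (q + y) = q + ((1 - s) *\<^sub>R x + s *\<^sub>R y)"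
      by (simp add: algebra_simps)
    ultimately show "w ((1 - s) *\<^sub>R x + s *\<^sub>R y) \<le> (1 - s) * w x + s * w y"
      by (simp add: w_def inner_add_right algebra_simps)
  qed auto
  define W where "W = (\<Sum>j\<in>UNIV. sdiff \<psi> q (t *\<^sub>R column j B))"
  have W: "W = (\<Sum>j\<in>UNIV. w (t *\<^sub>R column j B) + w (- (t *\<^sub>R column j B)))"
    unfolding W_def by (intro sum.cong) (auto simp: w_def sdiff_def)
  have "w (B *v z) \<le> W"
  proof (cases "z = 0")
    case True
    then show ?thesis using w0 wz by (simp add: W sum_nonneg)
  next
    case False
    \<comment> \<open>z is s times the convex combination, with weights |z_j| / |z|_1, of the
      vertices t sgn(z_j) e_j; in the images below, \<open>c j\<close> are the weights and
      \<open>u j\<close> the vertices.\<close>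
    define s where "s = (\<Sum>j\<in>UNIV. \<bar>z $ j\<bar>) / t"
    have s0: "0 < (\<Sum>j\<in>UNIV. \<bar>z $ j\<bar>)"
      using False by (metis abs_ge_zero less_le sum_nonneg norm_le_l1_cart norm_le_zero_iff)
    then have s: "0 < s" "s \<le> 1" using z t by (auto simp: s_def)
    define c where "c j = \<bar>z $ j\<bar> / (t * s)" for j
    define u where "u j = (sgn (z $ j) * t) *\<^sub>R column j B" for j
    have c1: "(\<Sum>j\<in>UNIV. c j) = 1" "\<And>j. 0 \<le> c j" "\<And>j. c j \<le> 1"
    proof -
      show 1: "(\<Sum>j\<in>UNIV. c j) = 1"
        using s0 t by (simp add: c_def s_def flip: sum_divide_distrib)
      show 2: "0 \<le> c j" for j using s t by (simp add: c_def)
      show "c j \<le> 1" for j using member_le_sum[of j UNIV c] 1 2 by simp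
    qed
    have "B *v z = s *\<^sub>R (\<Sum>j\<in>UNIV. c j *\<^sub>R u j)"
    proof -
      have "s *\<^sub>R (c j *\<^sub>R u j) = z $ j *s column j B" for j
        using s t by (simp add: c_def u_def scalar_mult_eq_scaleR abs_sgn mult.commute)
      then show ?thesis by (simp add: scaleR_sum_right matrix_mult_sum)
    qed
    then have "w (B *v z) = w ((1 - s) *\<^sub>R 0 + s *\<^sub>R (\<Sum>j\<in>UNIV. c j *\<^sub>R u j))" by simp
    also have "\<dots> \<le> (1 - s) * w 0 + s * w (\<Sum>j\<in>UNIV. c j *\<^sub>R u j)"
      using s by (intro convex_onD[OF wconv]) auto
    also have "\<dots> \<le> w (\<Sum>j\<in>UNIV. c j *\<^sub>R u j)"
      using w0 wz s by (simp add: mult_left_le_one_le)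
    also have "\<dots> \<le> (\<Sum>j\<in>UNIV. c j * w (u j))"
      using c1 by (intro convex_on_sum[OF _ _ wconv]) auto
    also have "\<dots> \<le> (\<Sum>j\<in>UNIV. w (u j))"
      using c1 w0 by (intro sum_mono) (simp add: mult_left_le_one_le)
    also have "\<dots> \<le> W" unfolding W
    proof (rule sum_mono)
      fix j
      consider "sgn (z $ j) = 1" | "sgn (z $ j) = -1" | "sgn (z $ j) = 0"
        using sgn_real_def by metis
      then show "w (u j) \<le> w (t *\<^sub>R column j B) + w (- (t *\<^sub>R column j B))"
        by cases (use w0 wz in \<open>auto simp: u_def\<close>)
    qed
    finally show ?thesis .
  qed
  then show ?thesis by (simp add: w_def W_def)
qed

text \<open>From the point with coordinates \<open>z\<close> a step of \<plusminus>t/2 along column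
  j stays in the cross-polytope of size t. There the subtracted function is at most the sum W of the
  second differences; it is nonnegative at the start and grows at least with slope p - p0, so (t/2)
  |(p - p0) . column j| \<le> W.\<close>

lemma subgradient_bound:
  fixes B :: "real^'n^'n"
  assumes conv: "convex_on UNIV \<psi>" and sub: "\<And>y. \<psi> q + p0 \<bullet> (y - q) \<le> \<psi> y"
    and t: "t > 0" and z: "(\<Sum>j\<in>UNIV. \<bar>z $ j\<bar>) \<le> t / 2"
    and subv: "\<And>y. \<psi> (q + B *v z) + p \<bullet> (y - (q + B *v z)) \<le> \<psi> y"
  shows "\<bar>(p - p0) \<bullet> column j B\<bar> \<le> 2 * (\<Sum>j\<in>UNIV. sdiff \<psi> q (t *\<^sub>R column j B)) / t"
proof -
  have *: "\<sigma> * (t / 2) * ((p - p0) \<bullet> column j B) \<le> (\<Sum>j\<in>UNIV. sdiff \<psi> q (t *\<^sub>R column j B))"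
    if \<sigma>: "\<bar>\<sigma>\<bar> = 1" for \<sigma>
  proof -
    define z' where "z' = z + (\<sigma> * (t / 2)) *\<^sub>R axis j 1"
    have Bz': "B *v z' = B *v z + (\<sigma> * (t / 2)) *\<^sub>R column j B"
      by (simp add: z'_def matrix_vector_right_distrib matrix_vector_mult_scaleR matrix_vector_mult_basis)
    have "(\<Sum>i\<in>UNIV. \<bar>z' $ i\<bar>) \<le> (\<Sum>i\<in>UNIV. \<bar>z $ i\<bar> + (if i = j then t / 2 else 0))"
      using \<sigma> t by (intro sum_mono) (auto simp: z'_def axis_def abs_mult intro: order_trans[OF abs_triangle_ineq])
    also have "\<dots> \<le> t" using z by (simp add: sum.distrib)
    finally have "\<psi> (q + B *v z') - \<psi> q - p0 \<bullet> (B *v z') \<le> (\<Sum>j\<in>UNIV. sdiff \<psi> q (t *\<^sub>R column j B))"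
      by (rule convex_cross_polytope_bound[OF conv sub t])
    moreover have "\<psi> (q + B *v z) + p \<bullet> ((\<sigma> * (t / 2)) *\<^sub>R column j B) \<le> \<psi> (q + B *v z')"
      using subv[of "q + B *v z'"] by (simp add: Bz')
    moreover have "\<psi> q + p0 \<bullet> (B *v z) \<le> \<psi> (q + B *v z)"
      using sub[of "q + B *v z"] by simp
    ultimately show ?thesis by (simp add: Bz' inner_add_right inner_diff_left algebra_simps)
  qed
  from *[of 1] *[of "-1"] t show ?thesis
    by (simp add: abs_le_iff field_simps)
qed

text \<open>The numbers p . column j B are the coordinates of B^T p. Hence B^T maps \<open>S\<close>
  into a cube of side 2s, while it scales volume by |det B|.\<close>

lemma measure_slab_bound:
  fixes B :: "real^'n^'n"
  assumes S: "S \<in> lmeasurable" and s: "s \<ge> 0"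
    and bd: "\<And>p j. p \<in> S \<Longrightarrow> \<bar>(p - p0) \<bullet> column j B\<bar> \<le> s"
  shows "measure lebesgue S * \<bar>det B\<bar> \<le> (2 * s) ^ CARD('n)"
proof -
  let ?c = "transpose B *v p0"
  have comp: "(transpose B *v p) $ j = p \<bullet> column j B" for p j
    by (simp add: matrix_vector_mult_def transpose_def column_def inner_vec_def mult.commute)
  have sub: "(*v) (transpose B) ` S \<subseteq> cbox (?c - vec s) (?c + vec s)"
  proof
    fix y assume "y \<in> (*v) (transpose B) ` S"
    then obtain p where p: "p \<in> S" "y = transpose B *v p" by blast
    have "p0 \<bullet> column j B - s \<le> p \<bullet> column j B \<and> p \<bullet> column j B \<le> p0 \<bullet> column j B + s" for j
      using bd[OF p(1), of j] by (simp add: inner_diff_left abs_le_iff)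
    then show "y \<in> cbox (?c - vec s) (?c + vec s)" unfolding p(2) mem_box_cart by (simp del: transpose_matrix_vector add: comp)
  qed
  have "measure lebesgue S * \<bar>det B\<bar> = measure lebesgue ((*v) (transpose B) ` S)"
    using measure_matrix_image(2)[OF S, of "transpose B"] by (simp add: det_transpose)
  also have "\<dots> \<le> measure lebesgue (cbox (?c - vec s) (?c + vec s))"
    by (rule measure_mono_fmeasurable[OF sub fmeasurableD[OF measure_matrix_image(1)[OF S]]]) simp
  also have "\<dots> = (2 * s) ^ CARD('n)"
    using s by (subst measure_completion) (auto simp: content_cbox_cart interval_ne_empty_cart)
  finally show ?thesis .
qed

lemma small_borel_partition:
  fixes S :: "'a::euclidean_space set"
  assumes "compact S" "h > 0"
  obtains I C where "finite I" "I \<subseteq> S" "\<And>v. C v \<in> sets borel" "\<And>v. v \<in> I \<Longrightarrow> C v \<subseteq> ball v h"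
    "disjoint_family_on C I" "(\<Union>v\<in>I. C v) = S"
proof -
  have "S \<subseteq> (\<Union>v\<in>S. ball v h)" using assms by auto
  then obtain I where I: "I \<subseteq> S" "finite I" "S \<subseteq> (\<Union>v\<in>I. ball v h)"
    using compactE_image[OF assms(1), of S "\<lambda>v. ball v h"] by auto
  obtain idx :: "'a \<Rightarrow> nat" where idx: "inj_on idx I"
    using finite_imp_inj_to_nat_seg[OF I(2)] by metis
  \<comment> \<open>Every point goes to the covering ball of least index that contains it.\<close>
  define C where "C v = S \<inter> (ball v h - (\<Union>w\<in>{w \<in> I. idx w < idx v}. ball w h))" for v
  show thesis
  proof (rule that[OF I(2,1)])
    show "C v \<in> sets borel" for v
    proof -
      have "open (\<Union>w\<in>{w \<in> I. idx w < idx v}. ball w h)" by auto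
      then show ?thesis using assms(1)
        unfolding C_def by (intro sets.Int sets.Diff borel_compact borel_open) auto
    qed
    show "C v \<subseteq> ball v h" for v by (auto simp: C_def)
    show "disjoint_family_on C I"
      unfolding disjoint_family_on_def
    proof (intro ballI impI)
      fix v w assume "v \<in> I" "w \<in> I" "v \<noteq> w"
      then have "idx v < idx w \<or> idx w < idx v" using idx by (meson inj_onD linorder_neqE_nat)
      then show "C v \<inter> C w = {}" using \<open>v \<in> I\<close> \<open>w \<in> I\<close> by (auto simp: C_def)
    qed
    show "(\<Union>v\<in>I. C v) = S"
    proof (intro equalityI subsetI)
      fix x assume x: "x \<in> S"
      define J where "J = {v \<in> I. x \<in> ball v h}"
      have "x \<in> (\<Union>v\<in>I. ball v h)" using I(3) x by blast
      then have "J \<noteq> {}" "finite J" using I(2) by (auto simp: J_def)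
      define v where "v = arg_min_on idx J"
      have v: "v \<in> J" "\<And>w. w \<in> J \<Longrightarrow> idx v \<le> idx w"
        unfolding v_def using \<open>J \<noteq> {}\<close> \<open>finite J\<close> arg_min_if_finite(1) arg_min_least by metis+
      have "x \<in> C v" using x v by (auto simp: C_def J_def not_less[symmetric])
      then show "x \<in> (\<Union>v\<in>I. C v)" using v(1) by (auto simp: J_def)
    qed (auto simp: C_def)
  qed
qed

text \<open>A Monge-Ampere inequality at resolution \<open>h\<close>: the mass of a parallelepiped
  is carried by nodes near it, each mass is at most the volume of the cell of subgradients at its
  node, the cells overlap in null sets, and all these subgradients satisfy the slab bound. The
  condition on the vectors \<open>e\<close> says that the parallelepiped, centred at 0, contains the
  ball of radius \<open>h\<close>, so that it is coarser than the discretization. Normalization and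
  Lipschitz bound of \<phi> prepare the compactness argument for h \<rightarrow> 0.\<close>

lemma discrete_subdifferential_volume:
  fixes \<nu> :: "(real^'n) measure" and S :: "(real^'n) set"
  assumes \<nu>: "sets \<nu> = sets borel" "finite_measure \<nu>" and S: "compact S" "emeasure \<nu> (- S) = 0"
    and M: "measure \<nu> UNIV = (2 * R) ^ CARD('n)" and R: "R > 0"
    and N: "\<And>x. x \<in> S \<Longrightarrow> norm x \<le> N" and h: "h > 0"
  shows "\<exists>\<phi>. continuous_on (cbox (vec (- R)) (vec R)) \<phi> \<and> \<phi> 0 = 0 \<and>
    (\<forall>p q. \<bar>\<phi> p - \<phi> q\<bar> \<le> N * norm (p - q)) \<and>
    (\<forall>q (B :: real^'n^'n) t. 0 < t \<and>
       (\<forall>e. norm e \<le> h \<longrightarrow> (\<exists>z. B *v z = e \<and> (\<forall>j. \<bar>z $ j\<bar> \<le> t / (4 * CARD('n))))) \<longrightarrow>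
       measure \<nu> ((\<lambda>z. q + B *v z) ` cbox (vec (- (t / (4 * CARD('n))))) (vec (t / (4 * CARD('n))))) * \<bar>det B\<bar>
       \<le> (4 * (\<Sum>j\<in>UNIV. sdiff (legendre (cbox (vec (- R)) (vec R)) \<phi>) q (t *\<^sub>R column j B)) / t) ^ CARD('n))"
proof -
  interpret \<nu>: finite_measure \<nu> by fact
  have sp: "space \<nu> = UNIV" using \<nu>(1) sets_eq_imp_space_eq by fastforce
  let ?K = "cbox (vec (- R)) (vec R) :: (real^'n) set"
  have K: "compact ?K" "?K \<noteq> {}" and zK: "0 \<in> ?K"
    using R by (auto simp: mem_box_cart interval_ne_empty_cart)
  obtain I0 C where C: "finite I0" "I0 \<subseteq> S" "\<And>v. C v \<in> sets borel" "\<And>v. v \<in> I0 \<Longrightarrow> C v \<subseteq> ball v h"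
    "disjoint_family_on C I0" "(\<Union>v\<in>I0. C v) = S"
    using small_borel_partition[OF S(1) h] by blast
  define m where "m v = measure \<nu> (C v)" for v
  \<comment> \<open>Only nodes of positive mass are kept, as the coercivity of the dual functional
    requires.\<close>
  define I where "I = {v \<in> I0. 0 < m v}"
  have finI: "finite I" using C(1) by (simp add: I_def)
  have Sm: "S \<in> sets \<nu>" using \<nu>(1) S(1) by (simp add: borel_compact)
  have total: "measure \<nu> (S \<inter> D) \<le> (\<Sum>v\<in>{v \<in> I. C v \<inter> D \<noteq> {}}. m v)" if D: "D \<in> sets borel" for D
  proof -
    have "measure \<nu> (S \<inter> D) = measure \<nu> (\<Union>v\<in>I0. C v \<inter> D)"
      using C(6) by (intro arg_cong[where f = "measure \<nu>"]) auto
    also have "\<dots> \<le> (\<Sum>v\<in>I0. measure \<nu> (C v \<inter> D))"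
      using C(1,3) D \<nu>(1) by (intro \<nu>.finite_measure_subadditive_finite) auto
    also have "\<dots> \<le> (\<Sum>v\<in>I0. if v \<in> I \<and> C v \<inter> D \<noteq> {} then m v else 0)"
    proof (rule sum_mono)
      fix v assume "v \<in> I0"
      have "measure \<nu> (C v \<inter> D) \<le> m v"
        unfolding m_def using C(3) \<nu>(1) by (intro \<nu>.finite_measure_mono) auto
      moreover have "m v \<ge> 0" by (simp add: m_def)
      ultimately show "measure \<nu> (C v \<inter> D) \<le> (if v \<in> I \<and> C v \<inter> D \<noteq> {} then m v else 0)"
        using \<open>v \<in> I0\<close> by (auto simp: I_def)
    qed
    also have "\<dots> = (\<Sum>v\<in>{v \<in> I. C v \<inter> D \<noteq> {}}. m v)"
      using C(1) by (subst sum.inter_filter[symmetric]) (auto simp: I_def intro: sum.cong)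
    finally show ?thesis .
  qed
  have \<nu>S: "measure \<nu> D = measure \<nu> (S \<inter> D)" if D: "D \<in> sets borel" for D
  proof (rule measure_eq_AE)
    have "AE x in \<nu>. x \<notin> - S" using S(2) Sm sp \<nu>(1) by (intro AE_not_in null_setsI) (auto simp: Compl_eq_Diff_UNIV)
    then show "AE x in \<nu>. (x \<in> D) = (x \<in> S \<inter> D)" by eventually_elim auto
  qed (use D Sm \<nu>(1) in auto)
  have Mpos: "0 < measure \<nu> UNIV" using M R by simp
  have sumI: "sum m I = measure \<nu> UNIV"
  proof -
    have "sum m I = sum m I0"
      unfolding I_def by (rule sum.mono_neutral_left) (auto simp: C(1) m_def less_le)
    also have "\<dots> = measure \<nu> (\<Union>v\<in>I0. C v)"
      unfolding m_def using C \<nu>(1) by (intro \<nu>.finite_measure_finite_Union[symmetric]) auto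
    finally show ?thesis using C(6) \<nu>S[of UNIV] by simp
  qed
  then have neI: "I \<noteq> {}" using Mpos by auto
  have "measure lborel ?K = (2 * R) ^ CARD('n)"
    using R by (auto simp: content_cbox_cart interval_ne_empty_cart)
  then have tot: "sum m I = measure lborel ?K" using sumI M by simp
  have mpos: "0 < m v" if "v \<in> I" for v using that by (simp add: I_def)
  obtain a where a: "\<And>v. v \<in> I \<Longrightarrow>
      m v \<le> measure lebesgue {p \<in> ?K. \<forall>w\<in>I. p \<bullet> w - a w \<le> p \<bullet> v - a v}"
    using semidiscrete_transport[OF finI neI mpos tot] by blast
  define V where "V v = {p \<in> ?K. \<forall>w\<in>I. p \<bullet> w - a w \<le> p \<bullet> v - a v}" for v
  have V: "V v \<in> lmeasurable" for v
    using lmeasurable_affine_cell[of "vec (- R)" "vec R" I a v 0] by (simp add: V_def)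
  \<comment> \<open>Subtracting this constant gives \<phi>(0) = 0, which makes the potentials
    uniformly bounded as the discretization is refined.\<close>
  define c0 where "c0 = max_affine I a 0"
  define \<phi> where "\<phi> p = max_affine I a p - c0" for p
  have \<phi>c: "continuous_on ?K \<phi>" unfolding \<phi>_def
    by (intro continuous_intros max_affine_continuous finI neI)
  have "norm v \<le> N" if "v \<in> I" for v using that C(2) N by (auto simp: I_def)
  then have lip: "\<bar>\<phi> p - \<phi> q\<bar> \<le> N * norm (p - q)" for p q
    using max_affine_lipschitz[OF finI neI, of N a p q] by (simp add: \<phi>_def)
  define \<psi> where "\<psi> = legendre ?K \<phi>"
  have conv: "convex_on UNIV \<psi>" unfolding \<psi>_def by (rule legendre_convex[OF K \<phi>c])
  \<comment> \<open>The elements of the cell of \<open>v\<close> are subgradients of \<psi> at the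
    node \<open>v\<close>.\<close>
  have subV: "\<psi> v + p \<bullet> (y - v) \<le> \<psi> y" if v: "v \<in> I" and p: "p \<in> V v" for v p y
  proof -
    have "\<phi> p = p \<bullet> v - a v - c0"
    proof -
      have "max_affine I a p \<le> p \<bullet> v - a v"
        using p by (intro max_affine_le finI neI) (auto simp: V_def)
      then show ?thesis using max_affine_ge[OF finI neI v, of p a] by (simp add: \<phi>_def)
    qed
    moreover have "\<psi> v \<le> a v + c0"
    proof -
      obtain p' where "p' \<in> ?K" "\<psi> v = p' \<bullet> v - \<phi> p'"
        using legendre_attained[OF K \<phi>c] unfolding \<psi>_def by blast
      then show ?thesis using max_affine_ge[OF finI neI v, of p' a] by (simp add: \<phi>_def)
    qed
    moreover have "p \<bullet> y - \<phi> p \<le> \<psi> y"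
      unfolding \<psi>_def using p by (intro legendre_ge[OF K \<phi>c]) (simp add: V_def)
    ultimately show ?thesis by (simp add: inner_diff_right)
  qed
  have main: "measure \<nu> ((\<lambda>z. q + B *v z) ` cbox (vec (- r)) (vec r)) * \<bar>det B\<bar>
       \<le> (4 * (\<Sum>j\<in>UNIV. sdiff \<psi> q (t *\<^sub>R column j B)) / t) ^ CARD('n)"
    if t: "0 < t" and r: "r = t / (4 * CARD('n))"
      and hB: "\<And>e. norm e \<le> h \<Longrightarrow> \<exists>z. B *v z = e \<and> (\<forall>j. \<bar>z $ j\<bar> \<le> r)"
    for q and B :: "real^'n^'n" and t r
  proof -
    define W where "W = (\<Sum>j\<in>UNIV. sdiff \<psi> q (t *\<^sub>R column j B))"
    have W: "W \<ge> 0" unfolding W_def by (intro sum_nonneg sdiff_nonneg conv)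
    define D where "D = (\<lambda>z. q + B *v z) ` cbox (vec (- r)) (vec r)"
    have "compact D" unfolding D_def
      by (intro compact_continuous_image continuous_intros compact_cbox
          linear_continuous_on linear_linear[THEN iffD2] matrix_vector_mul_bounded_linear)
    then have Db: "D \<in> sets borel" by (rule borel_compact)
    define J where "J = {v \<in> I. C v \<inter> D \<noteq> {}}"
    \<comment> \<open>Moving from a point of the parallelepiped to its node costs another
      \<open>r\<close> per coordinate. The n coordinates of size at most 2r sum to t/2, the room
      required by \<open>subgradient_bound\<close>; this is the origin of r = t / (4n).\<close>
    have J: "\<exists>z. v = q + B *v z \<and> (\<Sum>j\<in>UNIV. \<bar>z $ j\<bar>) \<le> t / 2" if vJ: "v \<in> J" for v
    proof -
      obtain x where x: "x \<in> C v" "x \<in> D" "v \<in> I" using vJ by (auto simp: J_def)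
      then have "norm (v - x) \<le> h" using C(4)[of v] by (auto simp: I_def dist_norm)
      then obtain z' where z': "B *v z' = v - x" "\<And>j. \<bar>z' $ j\<bar> \<le> r" using hB by blast
      obtain z where z: "x = q + B *v z" "z \<in> cbox (vec (- r)) (vec r)" using x(2) by (auto simp: D_def)
      have "\<bar>z $ j\<bar> \<le> r" for j using z(2) by (simp add: mem_box_cart abs_le_iff) (metis minus_le_iff)
      then have "\<bar>(z + z') $ j\<bar> \<le> 2 * r" for j
        using z'(2)[of j] abs_triangle_ineq[of "z $ j" "z' $ j"] by (smt (verit) vector_add_component)
      then have "(\<Sum>j\<in>UNIV. \<bar>(z + z') $ j\<bar>) \<le> (\<Sum>j\<in>(UNIV :: 'n set). 2 * r)" by (intro sum_mono)
      also have "\<dots> = t / 2" by (simp add: r)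
      finally have "(\<Sum>j\<in>UNIV. \<bar>(z + z') $ j\<bar>) \<le> t / 2" .
      moreover have "v = q + B *v (z + z')" using z(1) z'(1) by (simp add: matrix_vector_right_distrib)
      ultimately show ?thesis by blast
    qed
    obtain p0 where p0: "p0 \<in> ?K" "\<psi> q = p0 \<bullet> q - \<phi> p0"
      using legendre_attained[OF K \<phi>c] unfolding \<psi>_def by blast
    have sub: "\<psi> q + p0 \<bullet> (y - q) \<le> \<psi> y" for y
      using legendre_ge[OF K \<phi>c p0(1), of y] p0(2) by (simp add: \<psi>_def inner_diff_right)
    have finJ: "finite J" using finI by (simp add: J_def)
    have JI: "J \<subseteq> I" by (auto simp: J_def)
    have "measure \<nu> D \<le> (\<Sum>v\<in>J. m v)" using total[OF Db] \<nu>S[OF Db] by (simp add: J_def)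
    also have "\<dots> \<le> (\<Sum>v\<in>J. measure lebesgue (V v))"
      using a JI unfolding V_def by (intro sum_mono) auto
    also have "\<dots> = measure lebesgue (\<Union>(V ` J))"
    proof (rule measure_negligible_finite_Union_image[OF finJ V, symmetric])
      show "pairwise (\<lambda>v w. negligible (V v \<inter> V w)) J"
      proof (rule pairwiseI)
        fix v w assume vw: "v \<in> J" "w \<in> J" "v \<noteq> w"
        have "V v \<inter> V w \<subseteq> {p. (v - w) \<bullet> p = a v - a w}"
        proof
          fix p assume "p \<in> V v \<inter> V w"
          then have "p \<bullet> w - a w \<le> p \<bullet> v - a v" "p \<bullet> v - a v \<le> p \<bullet> w - a w"
            using vw JI by (auto simp: V_def)
          then show "p \<in> {p. (v - w) \<bullet> p = a v - a w}"
            using inner_diff_right[of p v w] by (simp add: inner_commute[of _ p])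
        qed
        moreover have "negligible {p. (v - w) \<bullet> p = a v - a w}"
          using vw(3) by (intro negligible_hyperplane) auto
        ultimately show "negligible (V v \<inter> V w)" using negligible_subset by blast
      qed
    qed
    finally have "measure \<nu> D * \<bar>det B\<bar> \<le> measure lebesgue (\<Union>(V ` J)) * \<bar>det B\<bar>"
      by (intro mult_right_mono) auto
    also have "\<dots> \<le> (2 * (2 * W / t)) ^ CARD('n)"
    proof (rule measure_slab_bound[where ?p0.0 = p0])
      show "\<Union>(V ` J) \<in> lmeasurable" using finJ V by (intro fmeasurable.finite_UN) auto
      show "0 \<le> 2 * W / t" using W t by simp
      fix p j assume "p \<in> \<Union>(V ` J)"
      then obtain v where v: "v \<in> J" "p \<in> V v" by blast
      obtain z where z: "v = q + B *v z" "(\<Sum>j\<in>UNIV. \<bar>z $ j\<bar>) \<le> t / 2" using J[OF v(1)] by blast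
      show "\<bar>(p - p0) \<bullet> column j B\<bar> \<le> 2 * W / t"
        unfolding W_def
        by (rule subgradient_bound[OF conv sub t z(2)]) (use subV[OF _ v(2)] v JI z in auto)
    qed
    finally show ?thesis by (simp add: D_def W_def)
  qed
  show ?thesis
  proof (rule exI[of _ \<phi>], intro conjI allI impI \<phi>c)
    show "\<phi> 0 = 0" by (simp add: \<phi>_def c0_def)
    show "\<bar>\<phi> p - \<phi> q\<bar> \<le> N * norm (p - q)" for p q by (rule lip)
  next
    fix q t and B :: "real^'n^'n"
    assume as: "0 < t \<and>
       (\<forall>e. norm e \<le> h \<longrightarrow> (\<exists>z. B *v z = e \<and> (\<forall>j. \<bar>z $ j\<bar> \<le> t / (4 * CARD('n)))))"
    show "measure \<nu> ((\<lambda>z. q + B *v z) ` cbox (vec (- (t / (4 * CARD('n))))) (vec (t / (4 * CARD('n))))) * \<bar>det B\<bar>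
       \<le> (4 * (\<Sum>j\<in>UNIV. sdiff (legendre ?K \<phi>) q (t *\<^sub>R column j B)) / t) ^ CARD('n)"
      by (rule main[unfolded \<psi>_def]) (use as in auto)
  qed
qed

lemma legendre_tendsto:
  assumes K: "compact K" "K \<noteq> {}" and c: "\<And>n. continuous_on K (\<phi> n)" "continuous_on K \<phi>'"
    and lim: "\<And>e. 0 < e \<Longrightarrow> \<exists>N. \<forall>n p. n \<ge> N \<and> p \<in> K \<longrightarrow> norm (\<phi> n p - \<phi>' p) < e"
  shows "(\<lambda>n. legendre K (\<phi> n) x) \<longlonglongrightarrow> legendre K \<phi>' x"
proof (rule LIMSEQ_I)
  fix r :: real assume "0 < r"
  then obtain N where "\<forall>n p. n \<ge> N \<and> p \<in> K \<longrightarrow> norm (\<phi> n p - \<phi>' p) < r / 2"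
    using lim[of "r / 2"] by auto
  then have "\<bar>legendre K (\<phi> n) x - legendre K \<phi>' x\<bar> \<le> r / 2" if "n \<ge> N" for n
    using that by (intro legendre_close[OF K c]) (auto intro: less_imp_le)
  then show "\<exists>N. \<forall>n\<ge>N. norm (legendre K (\<phi> n) x - legendre K \<phi>' x) < r"
    using \<open>0 < r\<close> by (intro exI[of _ N]) fastforce
qed

text \<open>Discretizations with h = 1/(k+1) have potentials that are equi-Lipschitz and vanish at
  0; by Arzela-Ascoli a subsequence converges uniformly, and the Legendre transforms, hence the
  second differences, converge with it. For fixed invertible B the resolution condition holds
  eventually. The cube has side 2R with (2R)^n equal to the total mass, and its points have norm at
  most nR: this is the Lipschitz constant.\<close>

lemma exists_convex_with_subdifferential_volume:
  fixes \<nu> :: "(real^'n) measure" and S :: "(real^'n) set" and R :: real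
  assumes \<nu>: "sets \<nu> = sets borel" "finite_measure \<nu>" and S: "compact S" "emeasure \<nu> (- S) = 0"
    and M: "measure \<nu> UNIV = (2 * R) ^ CARD('n)" and R: "R > 0"
  obtains \<psi> where "convex_on UNIV \<psi>" "\<And>x y. \<bar>\<psi> x - \<psi> y\<bar> \<le> (CARD('n) * R) * norm (x - y)"
    "\<And>q (B :: real^'n^'n) t. 0 < t \<Longrightarrow> det B \<noteq> 0 \<Longrightarrow>
       measure \<nu> ((\<lambda>z. q + B *v z) ` cbox (vec (- (t / (4 * CARD('n))))) (vec (t / (4 * CARD('n))))) * \<bar>det B\<bar>
       \<le> (4 * (\<Sum>j\<in>UNIV. sdiff \<psi> q (t *\<^sub>R column j B)) / t) ^ CARD('n)"
proof -
  let ?K = "cbox (vec (- R)) (vec R) :: (real^'n) set"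
  have K: "compact ?K" "?K \<noteq> {}" and zK: "0 \<in> ?K"
    using R by (auto simp: mem_box_cart interval_ne_empty_cart)
  have normK: "norm p \<le> CARD('n) * R" if "p \<in> ?K" for p
  proof -
    have "\<bar>p $ i\<bar> \<le> R" for i using that by (simp add: mem_box_cart abs_le_iff) (metis minus_le_iff)
    then have "(\<Sum>i\<in>UNIV. \<bar>p $ i\<bar>) \<le> (\<Sum>i\<in>(UNIV :: 'n set). R)" by (intro sum_mono)
    then show ?thesis using norm_le_l1_cart[of p] by simp
  qed
  obtain N where N: "\<And>x. x \<in> S \<Longrightarrow> norm x \<le> N" "N > 0"
    using compact_imp_bounded[OF S(1)] by (metis bounded_pos)
  define P where "P h \<phi> \<longleftrightarrow> continuous_on ?K \<phi> \<and> \<phi> 0 = 0 \<and>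
    (\<forall>p q. \<bar>\<phi> p - \<phi> q\<bar> \<le> N * norm (p - q)) \<and>
    (\<forall>q (B :: real^'n^'n) t. 0 < t \<and>
       (\<forall>e. norm e \<le> h \<longrightarrow> (\<exists>z. B *v z = e \<and> (\<forall>j. \<bar>z $ j\<bar> \<le> t / (4 * CARD('n))))) \<longrightarrow>
       measure \<nu> ((\<lambda>z. q + B *v z) ` cbox (vec (- (t / (4 * CARD('n))))) (vec (t / (4 * CARD('n))))) * \<bar>det B\<bar>
       \<le> (4 * (\<Sum>j\<in>UNIV. sdiff (legendre ?K \<phi>) q (t *\<^sub>R column j B)) / t) ^ CARD('n))" for h \<phi>
  have "\<exists>\<phi>. P (1 / real (Suc k)) \<phi>" for k
    unfolding P_def by (rule discrete_subdifferential_volume[OF assms N(1)]) simp_all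
  then obtain \<Phi> where \<Phi>: "\<And>k. P (1 / real (Suc k)) (\<Phi> k)" by metis
  have \<Phi>c: "continuous_on ?K (\<Phi> k)" and \<Phi>lip: "\<bar>\<Phi> k p - \<Phi> k q\<bar> \<le> N * norm (p - q)"
    and \<Phi>0: "\<Phi> k 0 = 0" for k p q using \<Phi>[of k] by (simp_all add: P_def)
  obtain \<phi> k where \<phi>: "continuous_on ?K \<phi>" "strict_mono (k :: nat \<Rightarrow> nat)"
    "\<And>e. 0 < e \<Longrightarrow> \<exists>N. \<forall>n x. n \<ge> N \<and> x \<in> ?K \<longrightarrow> norm (\<Phi> (k n) x - \<phi> x) < e"
  proof (rule Arzela_Ascoli[OF K(1), of \<Phi> "N * (CARD('n) * R)"])
    fix n and p :: "real^'n" assume p: "p \<in> ?K"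
    have "\<bar>\<Phi> n p - \<Phi> n 0\<bar> \<le> N * norm (p - 0)" by (rule \<Phi>lip)
    also have "\<dots> \<le> N * (CARD('n) * R)" using normK[OF p] N(2) by (intro mult_left_mono) auto
    finally show "norm (\<Phi> n p) \<le> N * (CARD('n) * R)" by (simp add: \<Phi>0)
  next
    fix p :: "real^'n" and e :: real assume "0 < e"
    show "\<exists>d>0. \<forall>n y. y \<in> ?K \<and> norm (p - y) < d \<longrightarrow> norm (\<Phi> n p - \<Phi> n y) < e"
    proof (intro exI[of _ "e / N"] conjI allI impI)
      fix n y assume "y \<in> ?K \<and> norm (p - y) < e / N"
      then have "N * norm (p - y) < e" using N(2) by (simp add: field_simps)
      then show "norm (\<Phi> n p - \<Phi> n y) < e" using \<Phi>lip[of n p y] by simp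
    qed (use N(2) \<open>0 < e\<close> in simp)
  qed blast
  define \<psi> where "\<psi> = legendre ?K \<phi>"
  have lim: "(\<lambda>n. legendre ?K (\<Phi> (k n)) x) \<longlonglongrightarrow> \<psi> x" for x
    unfolding \<psi>_def by (rule legendre_tendsto[OF K \<Phi>c \<phi>(1,3)])
  show thesis
  proof (rule that[of \<psi>])
    show "convex_on UNIV \<psi>" unfolding \<psi>_def by (rule legendre_convex[OF K \<phi>(1)])
    show "\<bar>\<psi> x - \<psi> y\<bar> \<le> (CARD('n) * R) * norm (x - y)" for x y
      unfolding \<psi>_def by (rule legendre_lipschitz[OF K \<phi>(1) normK])
  next
    fix q t and B :: "real^'n^'n" assume t: "0 < (t::real)" and B: "det B \<noteq> 0"
    let ?r = "t / (4 * CARD('n))"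
    have r: "?r > 0" using t by simp
    let ?m = "measure \<nu> ((\<lambda>z. q + B *v z) ` cbox (vec (- ?r)) (vec ?r)) * \<bar>det B\<bar>"
    obtain B' where inv: "B ** B' = mat 1"
      using B invertible_det_nz unfolding invertible_def by blast
    obtain c where c: "c > 0" "\<And>e. norm (B' *v e) \<le> norm e * c"
      using bounded_linear.pos_bounded[OF matrix_vector_mul_bounded_linear[of "B'"]] by blast
    \<comment> \<open>From this index on, the inverse of B maps the ball of radius h into the cube
      of half-side t / (4n).\<close>
    obtain n0 where n0: "c / ?r < real n0" using reals_Archimedean2 by blast
    have ev: "?m \<le> (4 * (\<Sum>j\<in>UNIV. sdiff (legendre ?K (\<Phi> (k n))) q (t *\<^sub>R column j B)) / t) ^ CARD('n)"
      if n: "n \<ge> n0" for n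
    proof -
      have "real n0 \<le> real (k n)" using n seq_suble[OF \<phi>(2), of n] by linarith
      then have "c / ?r < real (Suc (k n))" using n0 by simp
      then have small: "1 / real (Suc (k n)) * c \<le> ?r" using r c(1) by (simp add: field_simps)
      have "\<exists>z. B *v z = e \<and> (\<forall>j. \<bar>z $ j\<bar> \<le> ?r)" if e: "norm e \<le> 1 / real (Suc (k n))" for e
      proof (intro exI[of _ "B' *v e"] conjI allI)
        show "B *v (B' *v e) = e" by (simp add: matrix_vector_mul_assoc inv)
        fix j
        have "\<bar>(B' *v e) $ j\<bar> \<le> norm (B' *v e)" by (rule component_le_norm_cart)
        also have "\<dots> \<le> norm e * c" by (rule c(2))
        also have "\<dots> \<le> 1 / real (Suc (k n)) * c" using e c(1) by (intro mult_right_mono) auto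
        finally show "\<bar>(B' *v e) $ j\<bar> \<le> ?r" using small by linarith
      qed
      then show ?thesis using \<Phi>[of "k n"] t unfolding P_def by blast
    qed
    show "?m \<le> (4 * (\<Sum>j\<in>UNIV. sdiff \<psi> q (t *\<^sub>R column j B)) / t) ^ CARD('n)"
    proof (rule LIMSEQ_le_const)
      show "(\<lambda>n. (4 * (\<Sum>j\<in>UNIV. sdiff (legendre ?K (\<Phi> (k n))) q (t *\<^sub>R column j B)) / t) ^ CARD('n))
          \<longlonglongrightarrow> (4 * (\<Sum>j\<in>UNIV. sdiff \<psi> q (t *\<^sub>R column j B)) / t) ^ CARD('n)"
        unfolding sdiff_def using t by (intro tendsto_intros lim) auto
    qed (use ev in blast)
  qed
qed

subsection \<open>Mollification\<close>

lemma bump_conv_integrable: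
  fixes x :: "real^'n"
  assumes "r > 0" "continuous_on UNIV w"
  shows "integrable lborel (\<lambda>y. bump r (x - y) * w y)"
proof -
  have c: "continuous_on UNIV (\<lambda>y. bump r (x - y) * w y)"
    by (intro continuous_intros assms(2) continuous_on_compose2[OF smooth_fun_continuous[OF smooth_bump]]) auto
  have "integrable lborel (\<lambda>y. indicator (cball x r) y *\<^sub>R (bump r (x - y) * w y))"
    by (rule borel_integrable_compact) (auto intro: continuous_on_subset[OF c])
  moreover have "(\<lambda>y. indicator (cball x r) y *\<^sub>R (bump r (x - y) * w y)) = (\<lambda>y. bump r (x - y) * w y)"
  proof
    fix y show "indicator (cball x r) y *\<^sub>R (bump r (x - y) * w y) = bump r (x - y) * w y"
      using bump_eq_0[OF assms(1), of "x - y"] by (auto simp: indicator_def dist_norm)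
  qed
  ultimately show ?thesis by (simp only:)
qed

text \<open>The kernel centred at x + v is supported in the unit ball, so the integral over the cube
  is one over the whole space, and a translation moves \<open>v\<close> from the kernel to
  \<open>w\<close>.\<close>

lemma box_conv_bump_shift:
  fixes x v :: "real^'n"
  assumes "r > 0" "continuous_on UNIV w" "norm (x + v) + r \<le> 1"
  shows "box_conv (bump r) w (x + v) = (LINT y|lborel. bump r (x - y) * w (y + v))"
proof -
  have z: "bump r (x + v - y) * w y = 0" if "y \<notin> cbox (-1) 1" for y
  proof -
    have "\<exists>i. \<not> (\<bar>y $ i\<bar> \<le> 1)"
    proof (rule ccontr)
      assume "\<nexists>i. \<not> (\<bar>y $ i\<bar> \<le> 1)"
      then have "\<bar>y $ i\<bar> \<le> 1" for i by blast
      then have "-1 \<le> y $ i \<and> y $ i \<le> 1" for i using abs_le_iff[of "y $ i" 1] by (simp add: minus_le_iff)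
      then show False using that by (simp add: mem_box_cart)
    qed
    then obtain i where "\<not> (\<bar>y $ i\<bar> \<le> 1)" by blast
    then have "1 < norm y" using component_le_norm_cart[of y i] by linarith
    then have "r \<le> norm (x + v - y)"
      using norm_triangle_ineq2[of y "x + v"] assms(3) by (simp add: norm_minus_commute)
    then show ?thesis using bump_eq_0[OF assms(1), of "x + v - y"] by simp
  qed
  have "box_conv (bump r) w (x + v)
      = integral UNIV (\<lambda>y. if y \<in> cbox (-1) 1 then bump r (x + v - y) * w y else 0)"
    by (simp add: box_conv_def integral_restrict_UNIV)
  also have "\<dots> = integral UNIV (\<lambda>y. bump r (x + v - y) * w y)"
    using z by (intro integral_cong) auto
  also have "\<dots> = (LINT y|lborel. bump r (x + v - y) * w y)"
    by (intro integral_lborel bump_conv_integrable assms)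
  also have "\<dots> = (LINT y|distr lborel borel ((+) v). bump r (x + v - y) * w y)"
    by (simp only: lborel_distr_plus)
  also have "\<dots> = (LINT y|lborel. bump r (x + v - (v + y)) * w (v + y))"
  proof (rule integral_distr)
    have "continuous_on UNIV (\<lambda>y. bump r (x + v - y) * w y)"
      by (intro continuous_intros assms(2) continuous_on_compose2[OF smooth_fun_continuous[OF smooth_bump]]) auto
    then show "(\<lambda>y. bump r (x + v - y) * w y) \<in> borel_measurable borel"
      by (rule borel_measurable_continuous_onI)
  qed simp
  finally show ?thesis by (simp add: add.commute)
qed

definition bump_mass :: "real \<Rightarrow> 'n::finite itself \<Rightarrow> real" where
  "bump_mass r _ = (LINT y|lborel. bump r (- (y :: real^'n)))"

lemma integral_bump:
  fixes x :: "real^'n"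
  assumes "r > 0" "norm x + r \<le> 1"
  shows "(LINT y|lborel. bump r (x - y)) = bump_mass r TYPE('n)"
proof -
  have c: "continuous_on UNIV (\<lambda>_::real^'n. 1::real)" by simp
  show ?thesis
    using box_conv_bump_shift[OF assms(1) c, of x 0] box_conv_bump_shift[OF assms(1) c, of 0 x] assms(2)
    by (simp add: bump_mass_def)
qed

lemma bump_mass_pos:
  assumes "r > 0"
  shows "0 < bump_mass r TYPE('n::finite)"
proof -
  let ?f = "\<lambda>y::real^'n. bump r (- y)"
  have int: "integrable lborel ?f" using bump_conv_integrable[OF assms, of "\<lambda>_. 1" 0] by simp
  have "\<not> (AE y in lborel. ?f y = 0)"
  proof
    assume "AE y in lborel. ?f y = 0"
    moreover have "{y \<in> space lborel. ?f y \<noteq> 0} \<in> sets lborel"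
      using borel_measurable_integrable[OF int] by measurable
    ultimately have "emeasure lborel {y \<in> space lborel. ?f y \<noteq> 0} = 0"
      by (auto simp: AE_iff_measurable[OF _ refl])
    moreover have "ball (0::real^'n) r \<subseteq> {y \<in> space lborel. ?f y \<noteq> 0}"
    proof
      fix y :: "real^'n" assume "y \<in> ball 0 r"
      then show "y \<in> {y \<in> space lborel. ?f y \<noteq> 0}"
        using bump_pos[OF assms, of "- y"] by simp
    qed
    ultimately have "emeasure lborel (ball (0::real^'n) r) = 0"
      using emeasure_mono[of "ball 0 r" "{y \<in> space lborel. ?f y \<noteq> 0}" lborel]
        \<open>{y \<in> space lborel. ?f y \<noteq> 0} \<in> sets lborel\<close> by auto
    then have "measure lborel (ball (0::real^'n) r) = 0" by (simp add: measure_def)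
    then show False using content_ball_pos[OF assms, of "0::real^'n"] by simp
  qed
  then show ?thesis
    unfolding bump_mass_def
    using integral_nonneg_eq_0_iff_AE[OF int] Bochner_Integration.integral_nonneg[of lborel ?f] bump_nonneg
    by (auto simp: less_le)
qed

text \<open>A weighted mean of the values of \<open>w\<close> near x only where norm x + r \<le> 1;
  elsewhere the truncation to the cube interferes.\<close>

definition mollify :: "real \<Rightarrow> (real^'n \<Rightarrow> real) \<Rightarrow> real^'n \<Rightarrow> real" where
  "mollify r w x = box_conv (bump r) w x / bump_mass r TYPE('n)"

lemma smooth_mollify: "continuous_on UNIV w \<Longrightarrow> smooth_fun (mollify r w)"
  using Ck_fun_mult[OF Ck_fun_const[of _ "1 / bump_mass r TYPE('a)"], of _ "box_conv (bump r) w"]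
    smooth_fun_box_conv[OF smooth_bump, of w r]
  by (auto simp: smooth_fun_def mollify_def[abs_def])

lemma mollify_lipschitz:
  fixes x v :: "real^'n"
  assumes r: "r > 0" and w: "continuous_on UNIV w" and L: "\<And>x y. \<bar>w x - w y\<bar> \<le> L * norm (x - y)"
    and x: "norm (x + v) + r \<le> 1" "norm x + r \<le> 1"
  shows "\<bar>mollify r w (x + v) - mollify r w x\<bar> \<le> L * norm v"
proof -
  let ?m = "bump_mass r TYPE('n)"
  have m: "?m > 0" by (rule bump_mass_pos[OF r])
  have wv: "continuous_on UNIV (\<lambda>y. w (y + v))"
    by (intro continuous_on_compose2[OF w] continuous_intros) auto
  have "box_conv (bump r) w (x + v) - box_conv (bump r) w x
      = (LINT y|lborel. bump r (x - y) * w (y + v)) - (LINT y|lborel. bump r (x - y) * w y)"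
    using box_conv_bump_shift[OF r w x(1)] box_conv_bump_shift[OF r w, of x 0] x(2) by simp
  also have "\<dots> = (LINT y|lborel. bump r (x - y) * (w (y + v) - w y))"
    by (simp add: right_diff_distrib bump_conv_integrable[OF r] w wv)
  also have "\<bar>\<dots>\<bar> \<le> (LINT y|lborel. \<bar>bump r (x - y) * (w (y + v) - w y)\<bar>)"
    using integral_norm_bound[of lborel "\<lambda>y. bump r (x - y) * (w (y + v) - w y)"] by simp
  also have "\<dots> \<le> (LINT y|lborel. bump r (x - y) * (L * norm v))"
  proof (rule integral_mono)
    show "integrable lborel (\<lambda>y. \<bar>bump r (x - y) * (w (y + v) - w y)\<bar>)"
      by (intro integrable_abs bump_conv_integrable[OF r] continuous_intros w wv)
    show "\<bar>bump r (x - y) * (w (y + v) - w y)\<bar> \<le> bump r (x - y) * (L * norm v)" for y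
      using L[of "y + v" y] bump_nonneg[of r "x - y"] by (simp add: abs_mult mult_left_mono)
  qed (intro bump_conv_integrable[OF r] continuous_intros)
  also have "\<dots> = ?m * (L * norm v)"
    using integral_bump[OF r x(2)] by simp
  finally show ?thesis using m
    by (simp add: mollify_def field_simps flip: diff_divide_distrib)
qed

text \<open>Second differences commute with averaging, so a lower bound that holds throughout the
  support of the kernel persists with the same constant.\<close>

lemma mollify_sdiff_ge:
  fixes x :: "real^'n" and v :: "'n \<Rightarrow> real^'n"
  assumes r: "r > 0" and w: "continuous_on UNIV w"
    and x: "norm x + r \<le> 1" "\<And>j. norm x + norm (v j) + r \<le> 1"
    and ge: "\<And>y. norm (x - y) < r \<Longrightarrow> c \<le> (\<Sum>j\<in>UNIV. sdiff w y (v j))"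
  shows "c \<le> (\<Sum>j\<in>UNIV. sdiff (mollify r w) x (v j))"
proof -
  let ?m = "bump_mass r TYPE('n)"
  have m: "?m > 0" by (rule bump_mass_pos[OF r])
  have wv: "continuous_on UNIV (\<lambda>y. w (y + u))" for u
    by (intro continuous_on_compose2[OF w] continuous_intros) auto
  have int: "integrable lborel (\<lambda>y. bump r (x - y) * w (y + u))" for u
    by (rule bump_conv_integrable[OF r wv])
  have shift: "box_conv (bump r) w (x + u) = (LINT y|lborel. bump r (x - y) * w (y + u))"
    if "norm u \<le> norm (v j)" for u j
    using x(2)[of j] that norm_triangle_ineq[of x u] by (intro box_conv_bump_shift[OF r w]) linarith
  have sd: "(\<lambda>y. bump r (x - y) * sdiff w y (v j)) = (\<lambda>y. (bump r (x - y) * w (y + v j)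
      + bump r (x - y) * w (y + - v j)) - 2 * (bump r (x - y) * w (y + 0)))" for j
    by (auto simp: sdiff_def algebra_simps)
  have ints: "integrable lborel (\<lambda>y. bump r (x - y) * sdiff w y (v j))" for j
    unfolding sd by (intro Bochner_Integration.integrable_diff Bochner_Integration.integrable_add
        integrable_mult_right int)
  have "sdiff (box_conv (bump r) w) x (v j) = (LINT y|lborel. bump r (x - y) * sdiff w y (v j))" for j
  proof -
    have "(LINT y|lborel. bump r (x - y) * sdiff w y (v j)) = (LINT y|lborel. bump r (x - y) * w (y + v j))
      + (LINT y|lborel. bump r (x - y) * w (y + - v j)) - 2 * (LINT y|lborel. bump r (x - y) * w (y + 0))"
      unfolding sd
      by (simp only: Bochner_Integration.integral_diff Bochner_Integration.integral_add
          integral_mult_right_zero int Bochner_Integration.integrable_add integrable_mult_right)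
    then show ?thesis
      using shift[of "v j" j] shift[of "- v j" j] shift[of 0 j] by (simp add: sdiff_def)
  qed
  then have "(\<Sum>j\<in>UNIV. sdiff (box_conv (bump r) w) x (v j))
      = (LINT y|lborel. (\<Sum>j\<in>UNIV. bump r (x - y) * sdiff w y (v j)))"
    using ints by (simp add: Bochner_Integration.integral_sum)
  also have "\<dots> = (LINT y|lborel. bump r (x - y) * (\<Sum>j\<in>UNIV. sdiff w y (v j)))"
    by (simp add: sum_distrib_left)
  also have "\<dots> \<ge> (LINT y|lborel. bump r (x - y) * c)"
  proof (rule integral_mono)
    show "integrable lborel (\<lambda>y. bump r (x - y) * (\<Sum>j\<in>UNIV. sdiff w y (v j)))"
      unfolding sum_distrib_left by (intro Bochner_Integration.integrable_sum ints)
    fix y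
    show "bump r (x - y) * c \<le> bump r (x - y) * (\<Sum>j\<in>UNIV. sdiff w y (v j))"
    proof (cases "norm (x - y) < r")
      case True
      then show ?thesis using ge bump_nonneg by (intro mult_left_mono) auto
    next
      case False
      then show ?thesis using bump_eq_0[OF r, of "x - y"] by simp
    qed
  qed (intro bump_conv_integrable[OF r] continuous_intros)
  also have "(LINT y|lborel. bump r (x - y) * c) = ?m * c"
    using integral_bump[OF r x(1)] by simp
  finally have "?m * c \<le> (\<Sum>j\<in>UNIV. sdiff (box_conv (bump r) w) x (v j))" .
  moreover have "(\<Sum>j\<in>UNIV. sdiff (box_conv (bump r) w) x (v j)) = ?m * (\<Sum>j\<in>UNIV. sdiff (mollify r w) x (v j))"
    unfolding sum_distrib_left using m by (intro sum.cong) (auto simp: sdiff_def mollify_def field_simps)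
  ultimately show ?thesis using m by simp
qed

section \<open>Gradient and Hessian as limits of difference quotients\<close>

definition grad :: "(real^'n \<Rightarrow> real) \<Rightarrow> real^'n \<Rightarrow> real^'n" where
  "grad f x = (\<chi> i. pderiv_at f i x)"

lemma smooth_has_derivative_grad:
  fixes f :: "real^'n \<Rightarrow> real"
  assumes "smooth_fun f"
  shows "(f has_derivative (\<lambda>v. v \<bullet> grad f x)) (at x)"
  using smooth_fun_has_derivative[OF assms, of x] by (simp add: grad_def inner_vec_def)

lemma smooth_line_derivative:
  fixes f :: "real^'n \<Rightarrow> real"
  assumes "smooth_fun f"
  shows "((\<lambda>s. f (x + s *\<^sub>R v)) has_real_derivative (v \<bullet> grad f (x + s *\<^sub>R v))) (at s)"
proof -
  have "((\<lambda>s. x + s *\<^sub>R v) has_derivative (\<lambda>s. s *\<^sub>R v)) (at s)"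
    by (auto intro!: derivative_eq_intros)
  from has_derivative_compose[OF this smooth_has_derivative_grad[OF assms]]
  show ?thesis by (rule has_derivative_imp_has_field_derivative) simp
qed

text \<open>The difference quotient in the direction of the gradient itself gives |grad f|^2 \<le> L
  |grad f|.\<close>

lemma norm_grad_le:
  fixes f :: "real^'n \<Rightarrow> real"
  assumes f: "smooth_fun f" and L: "L \<ge> 0" and d: "d > 0"
    and lip: "\<And>v. norm v < d \<Longrightarrow> \<bar>f (x + v) - f x\<bar> \<le> L * norm v"
  shows "norm (grad f x) \<le> L"
proof -
  define v where "v = grad f x"
  have "((\<lambda>s. f (x + s *\<^sub>R v)) has_real_derivative (v \<bullet> v)) (at 0)"
    using smooth_line_derivative[OF f, of x v 0] by (simp add: v_def)
  then have "((\<lambda>h. (f (x + h *\<^sub>R v) - f x) / h) \<longlongrightarrow> v \<bullet> v) (at_right 0)"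
    by (auto simp: DERIV_def intro: tendsto_mono[OF at_le[OF subset_UNIV]])
  moreover have "\<forall>\<^sub>F h in at_right 0. (f (x + h *\<^sub>R v) - f x) / h \<le> L * norm v"
  proof -
    have "\<forall>\<^sub>F h in at_right 0. h < d / (norm v + 1)"
      using eventually_at_right_real[of 0 "d / (norm v + 1)"] d
      by (auto simp: add_nonneg_pos elim: eventually_mono)
    with eventually_at_right_less show ?thesis
    proof eventually_elim
      case (elim h)
      have "0 < norm v + 1" by (simp add: add_nonneg_pos)
      then have "h * (norm v + 1) < d" using elim by (simp only: pos_less_divide_eq)
      moreover have "h * norm v \<le> h * (norm v + 1)" using elim by simp
      ultimately have "h * norm v < d" by linarith
      then have "norm (h *\<^sub>R v) < d" using elim by simp
      from lip[OF this] elim show ?case by (simp add: field_simps)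
    qed
  qed
  ultimately have "v \<bullet> v \<le> L * norm v"
    by (rule tendsto_upperbound) simp
  then have "norm v * norm v \<le> L * norm v" by (simp add: power2_norm_eq_inner[symmetric] power2_eq_square)
  then have "norm v \<le> L" using L by (cases "norm v = 0") auto
  then show ?thesis by (simp add: v_def)
qed

definition hess :: "(real^'n \<Rightarrow> real) \<Rightarrow> real^'n \<Rightarrow> real^'n^'n" where
  "hess f x = (\<chi> i j. pderiv_at (pderiv_at f i) j x)"

text \<open>One application of l'Hospital's rule replaces the second difference by (h1(t) - h1(-t))
  / (2t), where h1 is the derivative along the line. This converges by differentiability of h1 at
  0.\<close>

lemma sdiff_limit:
  fixes f :: "real^'n \<Rightarrow> real"
  assumes f: "smooth_fun f"
  shows "((\<lambda>t. sdiff f x (t *\<^sub>R v) / t\<^sup>2) \<longlongrightarrow> v \<bullet> (hess f x *v v)) (at_right 0)"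
proof -
  define h1 where "h1 s = v \<bullet> grad f (x + s *\<^sub>R v)" for s
  have h1: "((\<lambda>s. f (x + s *\<^sub>R v)) has_real_derivative h1 s) (at s)" for s
    unfolding h1_def by (rule smooth_line_derivative[OF f])
  have h1': "((\<lambda>t. f (x - t *\<^sub>R v)) has_real_derivative - h1 (- s)) (at s)" for s
    using DERIV_chain'[OF DERIV_minus[OF DERIV_ident, of s UNIV] h1] by simp
  have h2: "(h1 has_real_derivative v \<bullet> (hess f x *v v)) (at 0)"
  proof -
    have e: "h1 = (\<lambda>s. \<Sum>i\<in>UNIV. v $ i * pderiv_at f i (x + s *\<^sub>R v))"
      by (auto simp: h1_def grad_def inner_vec_def)
    have "(h1 has_real_derivative (\<Sum>i\<in>UNIV. v $ i * (v \<bullet> grad (pderiv_at f i) (x + 0 *\<^sub>R v)))) (at 0)"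
      unfolding e
      by (intro DERIV_sum DERIV_cmult smooth_line_derivative smooth_fun_pderiv f)
    moreover have "(\<Sum>i\<in>UNIV. v $ i * (v \<bullet> grad (pderiv_at f i) (x + 0 *\<^sub>R v))) = v \<bullet> (hess f x *v v)"
      by (simp add: grad_def hess_def inner_vec_def matrix_vector_mult_def mult.commute)
    ultimately show ?thesis by simp
  qed
  have lim: "((\<lambda>t. (h1 t - h1 (- t)) / (2 * t)) \<longlongrightarrow> v \<bullet> (hess f x *v v)) (at_right 0)"
  proof -
    have a: "((\<lambda>t. (h1 t - h1 0) / t) \<longlongrightarrow> v \<bullet> (hess f x *v v)) (at 0)"
      using h2 by (simp add: DERIV_def)
    then have b: "((\<lambda>t. (h1 t - h1 0) / t) \<longlongrightarrow> v \<bullet> (hess f x *v v)) (at_right 0)"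
      "((\<lambda>t. (h1 t - h1 0) / t) \<longlongrightarrow> v \<bullet> (hess f x *v v)) (at_left 0)"
      by (rule tendsto_mono[OF at_le[OF subset_UNIV]])+
    have "((\<lambda>t. (h1 (- t) - h1 0) / - t) \<longlongrightarrow> v \<bullet> (hess f x *v v)) (at_right 0)"
      using b(2) by (simp add: filterlim_at_left_to_right)
    from tendsto_mult[OF tendsto_const[of "1/2"] tendsto_add[OF b(1) this]]
    show ?thesis by (simp add: add_divide_distrib diff_divide_distrib algebra_simps)
  qed
  show ?thesis
  proof (rule lhopital_right_0[where f' = "\<lambda>t. h1 t - h1 (- t)" and g' = "\<lambda>t. 2 * t"])
    have "isCont (\<lambda>t. sdiff f x (t *\<^sub>R v)) 0" unfolding sdiff_def
      by (intro continuous_intros DERIV_isCont[OF h1] DERIV_isCont[OF h1'])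
    then have "((\<lambda>t. sdiff f x (t *\<^sub>R v)) \<longlongrightarrow> 0) (at 0)" by (simp add: isCont_def sdiff_def)
    then show "((\<lambda>t. sdiff f x (t *\<^sub>R v)) \<longlongrightarrow> 0) (at_right 0)"
      by (rule tendsto_mono[OF at_le[OF subset_UNIV]])
    show "((\<lambda>t::real. t\<^sup>2) \<longlongrightarrow> 0) (at_right 0)" by (auto intro!: tendsto_eq_intros)
    show "\<forall>\<^sub>F t::real in at_right 0. t\<^sup>2 \<noteq> 0"
      using eventually_at_right_less[of "0::real"] by eventually_elim auto
    show "\<forall>\<^sub>F t::real in at_right 0. 2 * t \<noteq> 0"
      using eventually_at_right_less[of "0::real"] by eventually_elim auto
    show "\<forall>\<^sub>F t in at_right 0. ((\<lambda>t. sdiff f x (t *\<^sub>R v)) has_real_derivative h1 t - h1 (- t)) (at t)"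
    proof (intro always_eventually allI)
      fix t
      show "((\<lambda>t. sdiff f x (t *\<^sub>R v)) has_real_derivative h1 t - h1 (- t)) (at t)"
        unfolding sdiff_def
        using DERIV_diff[OF DERIV_add[OF h1 h1'] DERIV_const[of "2 * f x"], of t] by simp
    qed
    show "\<forall>\<^sub>F t::real in at_right 0. ((\<lambda>t. t\<^sup>2) has_real_derivative 2 * t) (at t)"
      by (intro always_eventually allI) (auto intro!: derivative_eq_intros)
  qed (rule lim)
qed

definition contract :: "real^'n^'n \<Rightarrow> real^'n^'n \<Rightarrow> real" where
  "contract A M = (\<Sum>i\<in>UNIV. \<Sum>j\<in>UNIV. A $ i $ j * M $ i $ j)"

lemma contract_factorization:
  fixes B :: "real^'n^'n"
  shows "contract (B ** transpose B) M = (\<Sum>k\<in>UNIV. column k B \<bullet> (M *v column k B))"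
proof -
  have "(\<Sum>k\<in>UNIV. column k B \<bullet> (M *v column k B))
      = (\<Sum>k\<in>UNIV. \<Sum>i\<in>UNIV. \<Sum>j\<in>UNIV. B $ i $ k * B $ j $ k * M $ i $ j)"
    by (simp add: column_def inner_vec_def matrix_vector_mult_def sum_distrib_left mult_ac)
  also have "\<dots> = (\<Sum>i\<in>UNIV. \<Sum>k\<in>UNIV. \<Sum>j\<in>UNIV. B $ i $ k * B $ j $ k * M $ i $ j)"
    by (rule sum.swap)
  also have "\<dots> = (\<Sum>i\<in>UNIV. \<Sum>j\<in>UNIV. \<Sum>k\<in>UNIV. B $ i $ k * B $ j $ k * M $ i $ j)"
    by (intro sum.cong refl sum.swap)
  also have "\<dots> = contract (B ** transpose B) M"
    by (simp add: contract_def matrix_matrix_mult_def transpose_def sum_distrib_right)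
  finally show ?thesis ..
qed

lemma contract_hess_limit:
  fixes f :: "real^'n \<Rightarrow> real" and B :: "real^'n^'n"
  assumes "smooth_fun f"
  shows "((\<lambda>t. (\<Sum>k\<in>UNIV. sdiff f x (t *\<^sub>R column k B)) / t\<^sup>2)
    \<longlongrightarrow> contract (B ** transpose B) (hess f x)) (at_right 0)"
  unfolding contract_factorization sum_divide_distrib
  by (intro tendsto_sum sdiff_limit assms)

subsection \<open>A smooth potential with prescribed Hessian determinant\<close>

abbreviation unit_box :: "(real^'n) set" where
  "unit_box \<equiv> cbox (vec (- (1/2))) (vec (1/2))"

lemma measure_density_ge:
  fixes f :: "'a::euclidean_space \<Rightarrow> real"
  assumes f: "f \<in> borel_measurable borel" and C: "C \<in> sets borel" and D: "D \<in> sets borel" "D \<subseteq> C"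
    and ge: "\<And>x. x \<in> D \<Longrightarrow> \<gamma> \<le> f x" "0 \<le> \<gamma>"
    and fin: "finite_measure (density lborel (\<lambda>x. ennreal (f x) * indicator C x))"
  shows "\<gamma> * measure lborel D \<le> measure (density lborel (\<lambda>x. ennreal (f x) * indicator C x)) D"
proof -
  let ?\<nu> = "density lborel (\<lambda>x. ennreal (f x) * indicator C x)"
  interpret finite_measure ?\<nu> by fact
  have "ennreal \<gamma> * emeasure lborel D = (\<integral>\<^sup>+x. ennreal \<gamma> * indicator D x \<partial>lborel)"
    using D by (simp add: nn_integral_cmult_indicator)
  also have "\<dots> \<le> (\<integral>\<^sup>+x. ennreal (f x) * indicator C x * indicator D x \<partial>lborel)"
    using D(2) ge(1) by (intro nn_integral_mono) (auto simp: indicator_def intro: ennreal_leI)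
  also have "\<dots> = emeasure ?\<nu> D"
    using f C D by (subst emeasure_density) auto
  finally have "ennreal \<gamma> * emeasure lborel D \<le> emeasure ?\<nu> D" .
  then have "enn2real (ennreal \<gamma> * emeasure lborel D) \<le> enn2real (emeasure ?\<nu> D)"
    using emeasure_finite[of D] by (intro enn2real_mono) (auto simp: less_top[symmetric])
  then show ?thesis using ge(2) by (simp add: measure_def enn2real_mult)
qed

lemma finite_measure_density_box:
  fixes f :: "'a::euclidean_space \<Rightarrow> real" and a b :: 'a
  assumes f: "continuous_on UNIV f" "\<And>x. 0 \<le> f x"
  defines "\<nu> \<equiv> density lborel (\<lambda>x. ennreal (f x) * indicator (cbox a b) x)"
  shows "finite_measure \<nu>" "measure \<nu> UNIV = (LINT x:cbox a b|lborel. f x)"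
proof -
  have fb: "f \<in> borel_measurable borel" by (rule borel_measurable_continuous_onI[OF f(1)])
  have "set_integrable lborel (cbox a b) f"
    unfolding set_integrable_def
    by (rule borel_integrable_compact) (auto intro: continuous_on_subset[OF f(1)])
  then have int: "integrable lborel (\<lambda>x. indicator (cbox a b) x *\<^sub>R f x)" by (simp add: set_integrable_def)
  have "emeasure \<nu> UNIV = (\<integral>\<^sup>+x. ennreal (f x) * indicator (cbox a b) x \<partial>lborel)"
    unfolding \<nu>_def using fb by (subst emeasure_density) auto
  also have "\<dots> = (\<integral>\<^sup>+x. ennreal (indicator (cbox a b) x *\<^sub>R f x) \<partial>lborel)"
    by (intro nn_integral_cong) (auto simp: indicator_def)
  also have "\<dots> = ennreal (LINT x:cbox a b|lborel. f x)"
    unfolding set_lebesgue_integral_def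
    using f(2) by (intro nn_integral_eq_integral int) auto
  finally have e: "emeasure \<nu> UNIV = ennreal (LINT x:cbox a b|lborel. f x)" .
  show "finite_measure \<nu>" by (rule finite_measureI) (use e in \<open>simp add: \<nu>_def\<close>)
  have "0 \<le> (LINT x:cbox a b|lborel. f x)"
    unfolding set_lebesgue_integral_def using f(2) by (intro Bochner_Integration.integral_nonneg) auto
  then show "measure \<nu> UNIV = (LINT x:cbox a b|lborel. f x)" using e by (simp add: measure_def)
qed

lemma measure_parallelepiped:
  fixes B :: "real^'n^'n"
  assumes "r \<ge> 0"
  shows "measure lborel ((\<lambda>z. q + B *v z) ` cbox (vec (- r)) (vec r)) = \<bar>det B\<bar> * (2 * r) ^ CARD('n)"
    and "(\<lambda>z. q + B *v z) ` cbox (vec (- r)) (vec r) \<in> sets borel"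
proof -
  have "compact ((\<lambda>z. q + B *v z) ` cbox (vec (- r)) (vec r))"
    by (intro compact_continuous_image continuous_intros compact_cbox
        linear_continuous_on linear_linear[THEN iffD2] matrix_vector_mul_bounded_linear)
  then show b: "(\<lambda>z. q + B *v z) ` cbox (vec (- r)) (vec r) \<in> sets borel" by (rule borel_compact)
  have "measure lborel ((\<lambda>z. q + B *v z) ` cbox (vec (- r)) (vec r))
      = measure lebesgue ((+) q ` (*v) B ` cbox (vec (- r)) (vec r))"
    using b by (simp add: image_image)
  also have "\<dots> = \<bar>det B\<bar> * measure lebesgue (cbox (vec (- r)) (vec r :: real^'n))"
    by (simp add: measure_translation measure_matrix_image)
  also have "measure lebesgue (cbox (vec (- r)) (vec r :: real^'n)) = (2 * r) ^ CARD('n)"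
    using assms by (auto simp: content_cbox_cart interval_ne_empty_cart)
  finally show "measure lborel ((\<lambda>z. q + B *v z) ` cbox (vec (- r)) (vec r)) = \<bar>det B\<bar> * (2 * r) ^ CARD('n)" .
qed

text \<open>The volume inequality is applied to the density g + \<epsilon> on the unit box and then
  mollified. On a small parallelepiped near y the density is at least g(y), so with half-side r = t
  / (4n) one gets g(y) (det B)^2 (t / (2n))^n \<le> (4W/t)^n, that is (g(y) det A)^(1/n) \<le> 8n W
  / t^2, and W / t^2 tends to A : D^2 \<Psi> after averaging. The summand \<epsilon> absorbs the
  oscillation of g and keeps the total mass positive.\<close>

lemma exists_smooth_potential:
  fixes g :: "real^'n \<Rightarrow> real"
  assumes g: "continuous_on UNIV g" "\<And>x. 0 \<le> g x" and \<epsilon>: "0 < \<epsilon>"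
  obtains \<Psi> where "smooth_fun \<Psi>"
    "\<And>y. norm y < 1/4 \<Longrightarrow> norm (grad \<Psi> y)
       \<le> CARD('n) / 2 * root CARD('n) (LINT x:unit_box|lborel. g x + \<epsilon>)"
    "\<And>y A. norm y < 1/4 \<Longrightarrow> psd_sym A \<Longrightarrow> 0 \<le> contract A (hess \<Psi> y)"
    "\<And>y A. norm y < 1/4 \<Longrightarrow> psd_sym A \<Longrightarrow>
       g y * det A \<le> (8 * CARD('n) * contract A (hess \<Psi> y)) ^ CARD('n)"
proof -
  define n where "n = CARD('n)"
  have n: "n > 0" by (simp add: n_def)
  define M where "M = (LINT x:unit_box|lborel. g x + \<epsilon>)"
  define \<nu> where "\<nu> = density lborel (\<lambda>x. ennreal (g x + \<epsilon>) * indicator (unit_box :: (real^'n) set) x)"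
  have gc: "continuous_on UNIV (\<lambda>x. g x + \<epsilon>)" by (intro continuous_intros g)
  have gb: "(\<lambda>x. g x + \<epsilon>) \<in> borel_measurable borel" by (rule borel_measurable_continuous_onI[OF gc])
  have fin: "finite_measure \<nu>" and \<nu>M: "measure \<nu> UNIV = M"
    using finite_measure_density_box[OF gc] g(2) \<epsilon> unfolding \<nu>_def M_def
    by (auto simp: add_nonneg_nonneg less_imp_le)
  interpret \<nu>: finite_measure \<nu> by (rule fin)
  have ge: "\<gamma> * measure lborel D \<le> measure \<nu> D"
    if "D \<in> sets borel" "D \<subseteq> unit_box" "\<And>x. x \<in> D \<Longrightarrow> \<gamma> \<le> g x + \<epsilon>" "0 \<le> \<gamma>" for \<gamma> D
    unfolding \<nu>_def by (rule measure_density_ge[OF gb _ that]) (use fin in \<open>simp_all add: \<nu>_def\<close>)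
  have "measure lborel (unit_box :: (real^'n) set) = 1"
    by (auto simp: content_cbox_cart interval_ne_empty_cart)
  then have "\<epsilon> * 1 \<le> measure \<nu> unit_box"
    using ge[of unit_box \<epsilon>] g(2) \<epsilon> by simp
  also have "\<dots> \<le> M" unfolding \<nu>M[symmetric] by (rule \<nu>.finite_measure_mono) (simp_all add: \<nu>_def)
  finally have M: "M > 0" using \<epsilon> by simp
  \<comment> \<open>The cube of side 2R then has volume \<open>M\<close>; the Lipschitz constant n R
    is the gradient bound of the conclusion.\<close>
  define R where "R = root n M / 2"
  have R: "R > 0" "measure \<nu> UNIV = (2 * R) ^ CARD('n)"
    using M n by (simp_all add: R_def \<nu>M n_def real_root_pow_pos2)
  have \<nu>0: "emeasure \<nu> (- unit_box) = 0"
    unfolding \<nu>_def using gb by (subst emeasure_density) (auto simp: nn_integral_0_iff_AE indicator_def)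
  obtain \<psi> where conv: "convex_on UNIV \<psi>" and lip: "\<And>x y. \<bar>\<psi> x - \<psi> y\<bar> \<le> (CARD('n) * R) * norm (x - y)"
    and vol: "\<And>q (B :: real^'n^'n) t. 0 < t \<Longrightarrow> det B \<noteq> 0 \<Longrightarrow>
       measure \<nu> ((\<lambda>z. q + B *v z) ` cbox (vec (- (t / (4 * CARD('n))))) (vec (t / (4 * CARD('n))))) * \<bar>det B\<bar>
       \<le> (4 * (\<Sum>j\<in>UNIV. sdiff \<psi> q (t *\<^sub>R column j B)) / t) ^ CARD('n)"
    using exists_convex_with_subdifferential_volume[OF _ fin compact_cbox \<nu>0 R(2,1)] by (auto simp: \<nu>_def)
  have "(CARD('n) * R)-lipschitz_on UNIV \<psi>"
    using lip R(1) by (intro lipschitz_onI) (auto simp: dist_norm)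
  then have \<psi>c: "continuous_on UNIV \<psi>" by (rule lipschitz_on_continuous_on)
  have "uniformly_continuous_on (cball 0 1) g"
    by (intro compact_uniformly_continuous continuous_on_subset[OF g(1)]) auto
  then obtain \<delta> where \<delta>: "\<delta> > 0"
    "\<And>x y. x \<in> cball 0 1 \<Longrightarrow> y \<in> cball 0 1 \<Longrightarrow> dist x y < \<delta> \<Longrightarrow> dist (g x) (g y) < \<epsilon>"
    unfolding uniformly_continuous_on_def using \<epsilon> by metis
  \<comment> \<open>Averaging moves the base point by less than \<eta>, and the parallelepiped
    extends by less than another \<eta>: together at most \<delta> from y, and inside the ball of
    radius 1/4 + 2/8 = 1/2.\<close>
  define \<eta> where "\<eta> = min (\<delta> / 2) (1/8)"
  have \<eta>: "\<eta> > 0" "2 * \<eta> \<le> \<delta>" "\<eta> \<le> 1/8" using \<delta>(1) by (auto simp: \<eta>_def)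
  define \<Psi> where "\<Psi> = mollify \<eta> \<psi>"
  have \<Psi>: "smooth_fun \<Psi>" unfolding \<Psi>_def by (rule smooth_mollify[OF \<psi>c])
  have col: "\<exists>k>0. \<forall>z. norm (B *v z) \<le> norm z * k" for B :: "real^'n^'n"
    using bounded_linear.pos_bounded[OF matrix_vector_mul_bounded_linear[of B]] by blast
  have small: "\<exists>t0>0. \<forall>t. 0 < t \<longrightarrow> t < t0 \<longrightarrow> c * t\<^sup>2 \<le> (\<Sum>j\<in>UNIV. sdiff \<Psi> y (t *\<^sub>R column j B))"
    if y: "norm y < 1/4" and t1: "t1 > 0" and c: "\<And>q t. norm (y - q) < \<eta> \<Longrightarrow> 0 < t \<Longrightarrow> t < t1 \<Longrightarrow>
        c * t\<^sup>2 \<le> (\<Sum>j\<in>UNIV. sdiff \<psi> q (t *\<^sub>R column j B))" for y c t1 and B :: "real^'n^'n"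
  proof -
    obtain k where k: "k > 0" "\<And>z. norm (B *v z) \<le> norm z * k" using col[of B] by blast
    show ?thesis
    proof (intro exI[of _ "min t1 (1 / (8 * k))"] conjI allI impI)
      fix t assume t: "0 < t" "t < min t1 (1 / (8 * k))"
      have cj: "norm (t *\<^sub>R column j B) \<le> 1/8" for j
      proof -
        have "norm (column j B) \<le> k" using k(2)[of "axis j 1"] by (simp add: matrix_vector_mult_basis)
        then have "t * norm (column j B) \<le> 1 / (8 * k) * k" using t k(1) by (intro mult_mono) auto
        then show ?thesis using t(1) k(1) by simp
      qed
      show "c * t\<^sup>2 \<le> (\<Sum>j\<in>UNIV. sdiff \<Psi> y (t *\<^sub>R column j B))"
        unfolding \<Psi>_def
      proof (rule mollify_sdiff_ge[OF \<eta>(1) \<psi>c])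
        show "norm y + \<eta> \<le> 1" using y \<eta> by simp
        show "norm y + norm (t *\<^sub>R column j B) + \<eta> \<le> 1" for j using y \<eta> cj[of j] by linarith
      qed (use c t in auto)
    qed (use t1 k(1) in auto)
  qed
  \<comment> \<open>A quadratic lower bound for \<psi>, uniform over base points within \<eta> of y
    and over small t, passes first to the average \<Psi> and then, as t tends to 0, to its
    Hessian.\<close>
  have limit: "c \<le> contract (B ** transpose B) (hess \<Psi> y)"
    if y: "norm y < 1/4" and t1: "t1 > 0" and c: "\<And>q t. norm (y - q) < \<eta> \<Longrightarrow> 0 < t \<Longrightarrow> t < t1 \<Longrightarrow>
        c * t\<^sup>2 \<le> (\<Sum>j\<in>UNIV. sdiff \<psi> q (t *\<^sub>R column j B))" for y c t1 and B :: "real^'n^'n"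
  proof -
    obtain t0 where t0: "t0 > 0" "\<And>t. 0 < t \<Longrightarrow> t < t0 \<Longrightarrow> c * t\<^sup>2 \<le> (\<Sum>j\<in>UNIV. sdiff \<Psi> y (t *\<^sub>R column j B))"
      using small[OF y t1 c] by blast
    have "\<forall>\<^sub>F t in at_right 0. c \<le> (\<Sum>j\<in>UNIV. sdiff \<Psi> y (t *\<^sub>R column j B)) / t\<^sup>2"
      using eventually_at_right_real[OF t0(1)]
      by eventually_elim (use t0(2) in \<open>auto simp: pos_le_divide_eq\<close>)
    then show ?thesis by (rule tendsto_lowerbound[OF contract_hess_limit[OF \<Psi>]]) simp
  qed
  show thesis
  proof (rule that[OF \<Psi>])
    fix y :: "real^'n" assume y: "norm y < 1/4"
    have "norm (grad \<Psi> y) \<le> CARD('n) * R"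
    proof (rule norm_grad_le[OF \<Psi>, where d = "1/4"])
      fix v :: "real^'n" assume "norm v < 1/4"
      then show "\<bar>\<Psi> (y + v) - \<Psi> y\<bar> \<le> CARD('n) * R * norm v"
        unfolding \<Psi>_def using y \<eta> norm_triangle_ineq[of y v]
        by (intro mollify_lipschitz[OF \<eta>(1) \<psi>c lip]) linarith+
    qed (use R in auto)
    then show "norm (grad \<Psi> y) \<le> CARD('n) / 2 * root CARD('n) (LINT x:unit_box|lborel. g x + \<epsilon>)"
      by (simp add: R_def n_def M_def)
  next
    fix y :: "real^'n" and A :: "real^'n^'n" assume y: "norm y < 1/4" and A: "psd_sym A"
    obtain B :: "real^'n^'n" where B: "A = B ** transpose B" using psd_sym_factorization[OF A] by blast
    show pos: "0 \<le> contract A (hess \<Psi> y)" unfolding B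
      by (rule limit[OF y zero_less_one]) (simp add: sum_nonneg sdiff_nonneg[OF conv])
    have detA: "det A = (det B)\<^sup>2" by (simp add: B det_mul det_transpose power2_eq_square)
    show "g y * det A \<le> (8 * CARD('n) * contract A (hess \<Psi> y)) ^ CARD('n)"
    proof (cases "det B = 0")
      case True
      then show ?thesis using pos by (simp add: detA)
    next
      case False
      \<comment> \<open>The target value of A : D^2 \<Psi>, obtained by solving g(y) det A = (8 n
        c)^n.\<close>
      define c where "c = root n (g y * (det B)\<^sup>2) / (8 * n)"
      have gd: "0 \<le> g y * (det B)\<^sup>2" using g(2) by simp
      have c0: "c \<ge> 0" using gd n by (simp add: c_def)
      have cn: "(8 * n * c) ^ n = g y * (det B)\<^sup>2"
        using gd n by (simp add: c_def real_root_pow_pos2)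
      obtain k where k: "k > 0" "\<And>z. norm (B *v z) \<le> norm z * k" using col[of B] by blast
      have "c \<le> contract (B ** transpose B) (hess \<Psi> y)"
      proof (rule limit[OF y])
        show "\<eta> / k > 0" using \<eta> k by simp
        fix q t assume q: "norm (y - q) < \<eta>" and t: "0 < t" "t < \<eta> / k"
        define r where "r = t / (4 * n)"
        have r: "r > 0" using t n by (simp add: r_def)
        define D where "D = (\<lambda>z. q + B *v z) ` cbox (vec (- r)) (vec r)"
        have near: "norm (x - y) < 2 * \<eta>" if "x \<in> D" for x
        proof -
          obtain z where z: "x = q + B *v z" "z \<in> cbox (vec (- r)) (vec r)" using \<open>x \<in> D\<close> by (auto simp: D_def)
          have "\<bar>z $ j\<bar> \<le> r" for j using z(2) by (simp add: mem_box_cart abs_le_iff) (metis minus_le_iff)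
          then have "(\<Sum>j\<in>UNIV. \<bar>z $ j\<bar>) \<le> (\<Sum>j\<in>(UNIV :: 'n set). r)" by (intro sum_mono)
          then have "norm z \<le> t" using norm_le_l1_cart[of z] t n by (simp add: r_def n_def)
          then have "norm z * k \<le> t * k" using k(1) by (intro mult_right_mono) auto
          also have "\<dots> < \<eta>" using t k(1) by (simp add: field_simps)
          finally have "norm (B *v z) < \<eta>" using k(2)[of z] by linarith
          then show ?thesis using q norm_triangle_ineq[of "q - y" "B *v z"]
            by (simp add: z(1) norm_minus_commute algebra_simps)
        qed
        have n1: "norm x < 1/2" if "x \<in> D" for x
          using near[OF that] y \<eta>(3) norm_triangle_ineq[of "x - y" y] by simp
        have Dsub: "D \<subseteq> unit_box"
        proof
          fix x assume "x \<in> D"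
          then have "- (1/2) \<le> x $ i \<and> x $ i \<le> 1/2" for i
            using n1[of x] component_le_norm_cart[of x i] by linarith
          then show "x \<in> unit_box" by (simp add: mem_box_cart)
        qed
        have "g y * measure lborel D \<le> measure \<nu> D"
        proof (rule ge[OF _ Dsub _ g(2)])
          show "D \<in> sets borel" unfolding D_def using r by (intro measure_parallelepiped) simp
          fix x assume x: "x \<in> D"
          have "dist (g x) (g y) < \<epsilon>"
            by (rule \<delta>(2)) (use n1[OF x] y near[OF x] \<eta>(2) in \<open>auto simp: dist_norm\<close>)
          then show "g y \<le> g x + \<epsilon>" by (simp add: dist_real_def)
        qed
        moreover have "measure lborel D = \<bar>det B\<bar> * (2 * r) ^ n"
          unfolding D_def n_def using r by (intro measure_parallelepiped) simp
        ultimately have "g y * (\<bar>det B\<bar> * (2 * r) ^ n) * \<bar>det B\<bar> \<le> measure \<nu> D * \<bar>det B\<bar>"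
          by (intro mult_right_mono) auto
        define W where "W = (\<Sum>j\<in>UNIV. sdiff \<psi> q (t *\<^sub>R column j B))"
        have W: "W \<ge> 0" unfolding W_def by (intro sum_nonneg sdiff_nonneg conv)
        note \<open>g y * (\<bar>det B\<bar> * (2 * r) ^ n) * \<bar>det B\<bar> \<le> measure \<nu> D * \<bar>det B\<bar>\<close>
        also have "measure \<nu> D * \<bar>det B\<bar> \<le> (4 * W / t) ^ n"
          using vol[OF t(1) False, of q] by (simp add: D_def r_def W_def n_def)
        finally have "g y * (\<bar>det B\<bar> * (2 * r) ^ n) * \<bar>det B\<bar> \<le> (4 * W / t) ^ n" .
        then have "(8 * n * c) ^ n * (2 * r) ^ n \<le> (4 * W / t) ^ n"
        proof -
          have "(det B)\<^sup>2 = \<bar>det B\<bar> * \<bar>det B\<bar>" by (simp add: power2_eq_square)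
          then have "g y * (det B)\<^sup>2 * (2 * r) ^ n = g y * (\<bar>det B\<bar> * (2 * r) ^ n) * \<bar>det B\<bar>"
            by (simp only: mult_ac)
          then show ?thesis using \<open>g y * (\<bar>det B\<bar> * (2 * r) ^ n) * \<bar>det B\<bar> \<le> (4 * W / t) ^ n\<close>
            unfolding cn by linarith
        qed
        then have "(8 * n * c * (2 * r)) ^ n \<le> (4 * W / t) ^ n" by (simp only: power_mult_distrib[of "8 * n * c" "2 * r"])
        then have "8 * n * c * (2 * r) \<le> 4 * W / t"
          using n c0 r W t by (subst (asm) power_mono_iff) auto
        then show "c * t\<^sup>2 \<le> (\<Sum>j\<in>UNIV. sdiff \<psi> q (t *\<^sub>R column j B))"
          using t n by (simp add: r_def W_def[symmetric] field_simps power2_eq_square)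
      qed
      then have "(8 * n * c) ^ n \<le> (8 * n * contract A (hess \<Psi> y)) ^ n"
        unfolding B using c0 by (intro power_mono mult_left_mono) auto
      then show ?thesis using cn unfolding detA n_def by linarith
    qed
  qed
qed

subsection \<open>Periodization\<close>

text \<open>The representative of z modulo Z^n nearest to the origin, so that norm (wrap (x - c)) is
  the distance of x and c on the torus.\<close>

definition wrap :: "real^'n \<Rightarrow> real^'n" where
  "wrap z = (\<chi> i. z $ i - of_int (round (z $ i)))"

definition int_vec :: "real^'n \<Rightarrow> bool" where
  "int_vec k \<longleftrightarrow> (\<forall>i. k $ i \<in> \<int>)"

lemma wrap_component_le: "\<bar>wrap z $ i\<bar> \<le> 1/2"
  using of_int_round_abs_le[of "z $ i"] by (simp add: wrap_def abs_minus_commute)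

lemma wrap_in_box: "wrap z \<in> cbox (vec (- (1/2))) (vec (1/2))"
proof -
  have "- (1/2) \<le> wrap z $ i \<and> wrap z $ i \<le> 1/2" for i
    using wrap_component_le[of z i] by linarith
  then show ?thesis by (simp add: mem_box_cart)
qed

lemma int_vec_minus_wrap: "int_vec (z - wrap z)"
  by (simp add: int_vec_def wrap_def)

lemma norm_wrap_le: "int_vec k \<Longrightarrow> norm (wrap z) \<le> norm (z - k)"
proof (rule norm_le_componentwise_cart)
  fix i assume "int_vec k"
  then obtain m where "k $ i = of_int m" by (auto simp: int_vec_def elim: Ints_cases)
  then show "norm (wrap z $ i) \<le> norm ((z - k) $ i)"
    using round_diff_minimal[of "z $ i" m] by (simp add: wrap_def)
qed

lemma wrap_add_int: "int_vec k \<Longrightarrow> wrap (z + k) = wrap z"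
proof -
  assume k: "int_vec k"
  have "wrap (z + k) $ i = wrap z $ i" for i
  proof -
    obtain m where "k $ i = of_int m" using k by (auto simp: int_vec_def elim: Ints_cases)
    moreover have "round (z $ i + of_int m) = round (z $ i) + m"
      by (simp add: round_def floor_add_int[symmetric] algebra_simps flip: floor_add_int)
    ultimately show ?thesis by (simp add: wrap_def)
  qed
  then show ?thesis by (simp add: vec_eq_iff)
qed

lemma wrap_periodic:
  fixes f :: "real^'n \<Rightarrow> 'b"
  shows "torus_periodic (\<lambda>x. f (wrap (x - c)))"
  unfolding torus_periodic_def
proof (intro allI)
  fix x :: "real^'n" and i
  have "int_vec (axis i 1 :: real^'n)" by (auto simp: int_vec_def axis_def)
  from wrap_add_int[OF this, of "x - c"] show "f (wrap (x + axis i 1 - c)) = f (wrap (x - c))"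
    by (simp add: algebra_simps)
qed

lemma borel_measurable_wrap [measurable]: "wrap \<in> borel_measurable borel"
proof (rule borel_measurable_euclidean_space[THEN iffD2], rule ballI)
  fix b :: "real^'n" assume "b \<in> Basis"
  then obtain i where b: "b = axis i 1" by (auto simp: Basis_vec_def)
  have "(\<lambda>z::real^'n. z $ i) \<in> borel_measurable borel"
    by (intro borel_measurable_continuous_onI continuous_intros)
  then have "(\<lambda>z::real^'n. z $ i - of_int \<lfloor>z $ i + 1/2\<rfloor>) \<in> borel_measurable borel" by measurable
  then show "(\<lambda>z. wrap z \<bullet> b) \<in> borel_measurable borel"
    by (simp add: b inner_axis wrap_def round_def)
qed

text \<open>If the integer translations at z and z' differ, they differ by at least 1 in some
  coordinate i. Since |wrap z'_i| and |wrap z_i| are at most 1/2 and z' is within 1/8 of z, both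
  candidate arguments have i-th coordinate of modulus at least 1/4, where F vanishes.\<close>

lemma wrap_local:
  assumes F: "\<And>z. 1/4 \<le> norm z \<Longrightarrow> F z = 0" and zz: "norm (z' - z) < 1/8"
  shows "F (wrap z') = F (z' - (z - wrap z))"
proof (cases "wrap z' = z' - (z - wrap z)")
  case False
  define k where "k = z - wrap z"
  define k' where "k' = z' - wrap z'"
  have k: "int_vec k" "int_vec k'" by (simp_all add: k_def k'_def int_vec_minus_wrap)
  have "k \<noteq> k'" using False by (auto simp: k_def k'_def)
  then obtain i where i: "k $ i \<noteq> k' $ i" by (auto simp: vec_eq_iff)
  have "1 \<le> \<bar>k $ i - k' $ i\<bar>"
  proof -
    obtain a b where "k $ i = of_int a" "k' $ i = of_int b"
      using k by (auto simp: int_vec_def elim!: Ints_cases) (metis Ints_cases)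
    then show ?thesis using i by (simp flip: of_int_diff of_int_abs)
  qed
  moreover have "\<bar>wrap z' $ i\<bar> \<le> 1/2" "\<bar>wrap z $ i\<bar> \<le> 1/2" by (rule wrap_component_le)+
  moreover have "\<bar>(z' - z) $ i\<bar> < 1/8" using component_le_norm_cart[of "z' - z" i] zz by linarith
  moreover have "(z' - k) $ i = wrap z $ i + (z' - z) $ i" "(z' - k) $ i - wrap z' $ i = k' $ i - k $ i"
    by (simp_all add: k_def k'_def)
  ultimately have "1/4 \<le> \<bar>wrap z' $ i\<bar>" "1/4 \<le> \<bar>(z' - k) $ i\<bar>" by linarith+
  then have "1/4 \<le> norm (wrap z')" "1/4 \<le> norm (z' - k)"
    using component_le_norm_cart[of "wrap z'" i] component_le_norm_cart[of "z' - k" i] by linarith+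
  then show ?thesis using F by (simp add: k_def)
qed simp

lemma smooth_wrap:
  fixes F :: "real^'n \<Rightarrow> 'b::real_normed_vector"
  assumes F: "\<And>z. 1/4 \<le> norm z \<Longrightarrow> F z = 0" and sm: "smooth_fun F"
  shows "smooth_fun (\<lambda>x. F (wrap (x - c)))"
    and "pderiv_at (\<lambda>x. F (wrap (x - c))) j x = pderiv_at F j (wrap (x - c))"
proof -
  have loc: "F (wrap (y - c)) = F (y - (x - wrap (x - c)))" if "y \<in> ball x (1/8)" for x y
    using wrap_local[of F "y - c" "x - c", OF F] that by (simp add: dist_norm norm_minus_commute algebra_simps)
  show "smooth_fun (\<lambda>x. F (wrap (x - c)))"
    unfolding smooth_fun_def
  proof
    fix k
    show "Ck_fun k (\<lambda>x. F (wrap (x - c)))"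
    proof (rule Ck_fun_local)
      fix x
      have "Ck_fun k (\<lambda>y. F (y - (x - wrap (x - c))))"
        using sm by (intro Ck_fun_translate) (simp add: smooth_fun_def)
      then show "\<exists>e>0. \<exists>g. Ck_fun k g \<and> (\<forall>y\<in>ball x e. F (wrap (y - c)) = g y)"
        using loc by (intro exI[of _ "1/8"] conjI exI[of _ "\<lambda>y. F (y - (x - wrap (x - c)))"]) auto
    qed
  qed
  have "((\<lambda>y. y - (x - wrap (x - c))) has_derivative (\<lambda>v. v)) (at x)"
    by (auto intro!: derivative_eq_intros)
  from has_derivative_compose[OF this smooth_fun_has_derivative[OF sm, of "x - (x - wrap (x - c))"]]
  have "((\<lambda>y. F (y - (x - wrap (x - c)))) has_derivative
      (\<lambda>v. \<Sum>j\<in>UNIV. v $ j *\<^sub>R pderiv_at F j (wrap (x - c)))) (at x)" by simp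
  then have "((\<lambda>x. F (wrap (x - c))) has_derivative
      (\<lambda>v. \<Sum>j\<in>UNIV. v $ j *\<^sub>R pderiv_at F j (wrap (x - c)))) (at x)"
    by (rule has_derivative_transform_within_open[of _ _ _ _ "ball x (1/8)"]) (use loc in auto)
  from pderiv_atI[OF this, of j]
  show "pderiv_at (\<lambda>x. F (wrap (x - c))) j x = pderiv_at F j (wrap (x - c))"
    by (simp add: axis_def if_distrib[where f = "\<lambda>t. t *\<^sub>R _"] cong: if_cong)
qed

lemma continuous_wrap_bounded:
  fixes h :: "real^'n \<Rightarrow> 'b::real_normed_vector"
  assumes "continuous_on UNIV h"
  obtains B where "B \<ge> 0" "\<And>x. norm (h (wrap x)) \<le> B"
proof -
  have "compact (h ` cbox (vec (- (1/2))) (vec (1/2)))"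
    by (intro compact_continuous_image continuous_on_subset[OF assms]) auto
  then have "bounded (h ` cbox (vec (- (1/2))) (vec (1/2)))" by (rule compact_imp_bounded)
  then obtain B where "\<And>z. z \<in> cbox (vec (- (1/2))) (vec (1/2)) \<Longrightarrow> norm (h z) \<le> B"
    by (auto simp: bounded_iff)
  then have "norm (h (wrap x)) \<le> \<bar>B\<bar>" for x using wrap_in_box[of x] by force
  then show thesis using that[of "\<bar>B\<bar>"] by simp
qed

lemma borel_measurable_comp_wrap:
  fixes h :: "real^'n \<Rightarrow> 'b::topological_space"
  assumes "h \<in> borel_measurable borel"
  shows "(\<lambda>x. h (wrap (x - c))) \<in> borel_measurable borel"
  using assms by measurable

lemma torus_cube_borel [measurable]: "torus_cube \<in> sets borel"
proof -
  have "torus_cube = (\<Inter>i. {x::real^'n. 0 \<le> x $ i} \<inter> {x. x $ i < 1})"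
    by (auto simp: torus_cube_def)
  also have "\<dots> \<in> sets borel"
    by (intro sets.countable_INT' sets.Int borel_closed borel_open closed_Collect_le open_Collect_less
        continuous_intros) auto
  finally show ?thesis .
qed

lemma torus_cube_lebesgue [simp]: "torus_cube \<in> sets lebesgue"
  using torus_cube_borel by simp

lemma borel_measurable_lebesgue_on:
  assumes "f \<in> borel_measurable borel"
  shows "f \<in> borel_measurable (lebesgue_on S)"
proof -
  have "f \<in> borel_measurable lebesgue"
    using assms by (intro measurable_completion) simp
  then show ?thesis by (rule measurable_restrict_space1)
qed

lemma integrable_times_bounded:
  fixes f h :: "'a \<Rightarrow> real"
  assumes "integrable M f" "h \<in> borel_measurable M" "\<And>x. \<bar>h x\<bar> \<le> B"
  shows "integrable M (\<lambda>x. f x * h x)"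
proof (rule Bochner_Integration.integrable_bound[of M "\<lambda>x. B * f x"])
  have "\<bar>f x\<bar> * \<bar>h x\<bar> \<le> \<bar>f x\<bar> * \<bar>B\<bar>" for x
    using assms(3)[of x] by (intro mult_left_mono) auto
  then show "AE x in M. norm (f x * h x) \<le> norm (B * f x)"
    by (simp add: abs_mult mult.commute)
qed (use assms in auto)

lemma integrable_times_wrap:
  fixes f :: "real^'n \<Rightarrow> real"
  assumes "integrable (lebesgue_on S) f" "continuous_on UNIV h"
  shows "integrable (lebesgue_on S) (\<lambda>x. f x * h (wrap (x - c)))"
proof -
  obtain B where "\<And>x. norm (h (wrap x)) \<le> B" using continuous_wrap_bounded[OF assms(2)] by metis
  moreover have "(\<lambda>x. h (wrap (x - c))) \<in> borel_measurable (lebesgue_on S)"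
    by (intro borel_measurable_lebesgue_on borel_measurable_comp_wrap borel_measurable_continuous_onI assms)
  ultimately show ?thesis using assms(1) by (intro integrable_times_bounded) auto
qed

text \<open>Cauchy-Schwarz for the Frobenius inner product of A with the rank-one matrix a b^T,
  whose norm is |a| |b|.\<close>

lemma abs_bilinear_form_le:
  fixes A :: "real^'n^'n"
  shows "\<bar>\<Sum>i\<in>UNIV. \<Sum>j\<in>UNIV. A $ i $ j * (b $ j * a $ i)\<bar> \<le> norm A * (norm a * norm b)"
proof -
  have "(\<Sum>i\<in>UNIV. \<Sum>j\<in>UNIV. A $ i $ j * (b $ j * a $ i)) = A \<bullet> (\<chi> i. a $ i *\<^sub>R b)"
    by (simp add: inner_vec_def sum_distrib_left mult_ac)
  also have "\<bar>\<dots>\<bar> \<le> norm A * norm (\<chi> i. a $ i *\<^sub>R b)" by (rule Cauchy_Schwarz_ineq2)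
  also have "norm (\<chi> i. a $ i *\<^sub>R b) = norm a * norm b"
  proof -
    have "norm (\<chi> i. a $ i *\<^sub>R b) = L2_set (\<lambda>i. norm ((\<chi> i. a $ i *\<^sub>R b) $ i)) UNIV"
      by (rule norm_vec_def)
    also have "\<dots> = L2_set (\<lambda>i. norm (a $ i) * norm b) UNIV" by (simp only: vec_lambda_beta norm_scaleR real_norm_def)
    also have "\<dots> = L2_set (\<lambda>i. norm (a $ i)) UNIV * norm b" by (rule L2_set_left_distrib[symmetric]) simp
    also have "L2_set (\<lambda>i. norm (a $ i)) UNIV = norm a" by (rule norm_vec_def[symmetric])
    finally show ?thesis .
  qed
  finally show ?thesis .
qed

lemma Lp_psd_1_integrable:
  assumes "Lp_psd 1 A"
  shows "integrable (lebesgue_on torus_cube) (\<lambda>x. norm (A x))"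
    "integrable (lebesgue_on torus_cube) (\<lambda>x. A x $ i $ j)"
    "AE x in lebesgue_on torus_cube. psd_sym (A x)"
    "A \<in> borel_measurable (lebesgue_on torus_cube)"
proof -
  show m: "A \<in> borel_measurable (lebesgue_on torus_cube)" and "AE x in lebesgue_on torus_cube. psd_sym (A x)"
    using assms by (simp_all add: Lp_psd_def)
  show i: "integrable (lebesgue_on torus_cube) (\<lambda>x. norm (A x))"
    using assms by (simp add: Lp_psd_def)
  have "(\<lambda>M :: real^'a^'a. M $ i $ j) \<in> borel_measurable borel"
    by (intro borel_measurable_continuous_onI continuous_intros)
  from measurable_compose[OF m this]
  have "(\<lambda>x. A x $ i $ j) \<in> borel_measurable (lebesgue_on torus_cube)" .
  moreover have "\<bar>A x $ i $ j\<bar> \<le> norm (A x)" for x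
    using component_le_norm_cart[of "A x $ i" j] Finite_Cartesian_Product.norm_nth_le[of "A x" i] by simp
  ultimately show "integrable (lebesgue_on torus_cube) (\<lambda>x. A x $ i $ j)"
    by (intro Bochner_Integration.integrable_bound[OF i]) auto
qed

text \<open>The derivative of the field \<phi> grad \<Psi> splits into \<phi> D^2 \<Psi> and the
  product of grad \<Psi> with grad \<phi>. The definition of div A then expresses the integral of
  \<phi> A : D^2 \<Psi> by the other two terms, each bounded by means of |grad \<Psi>| \<le> L,
  which is available exactly on the ball where \<phi> lives.\<close>

lemma test_field_bound:
  fixes A :: "real^'n \<Rightarrow> real^'n^'n" and \<phi> \<Psi> :: "real^'n \<Rightarrow> real" and c :: "real^'n"
  assumes X: "in_Xp 1 A \<theta> \<sigma>" and \<phi>: "smooth_fun \<phi>" "\<And>z. 0 \<le> \<phi> z"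
    and supp: "\<And>z. 1/4 \<le> norm z \<Longrightarrow> \<phi> z = 0" "\<And>z. 1/4 \<le> norm z \<Longrightarrow> grad \<phi> z = 0"
    and \<Psi>: "smooth_fun \<Psi>" and L: "\<And>z. norm z < 1/4 \<Longrightarrow> norm (grad \<Psi> z) \<le> L" and L0: "0 \<le> L"
  defines "w \<equiv> \<lambda>x. wrap (x - c)"
  shows "integrable (lebesgue_on torus_cube) (\<lambda>x. \<phi> (w x) * contract (A x) (hess \<Psi> (w x)))"
    "(LINT x|lebesgue_on torus_cube. \<phi> (w x) * contract (A x) (hess \<Psi> (w x)))
      \<le> L * ((LINT x|\<sigma>. \<phi> (w x)) + (LINT x|lebesgue_on torus_cube. norm (A x) * norm (grad \<phi> (w x))))"
proof -
  let ?Q = "lebesgue_on torus_cube :: (real^'n) measure"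
  have Lp: "Lp_psd 1 A" and div: "div_is_measure A \<theta> \<sigma>" using X by (auto simp: in_Xp_def)
  have pol: "torus_measure \<sigma>" "\<theta> \<in> borel_measurable borel" "AE x in \<sigma>. norm (\<theta> x) = 1"
    using div by (auto simp: div_is_measure_def vector_measure_polar_def)
  have \<sigma>: "sets \<sigma> = sets borel" "finite_measure \<sigma>" using pol(1) by (auto simp: torus_measure_def)
  interpret \<sigma>: finite_measure \<sigma> by fact
  note int = Lp_psd_1_integrable[OF Lp]
  \<comment> \<open>Written out in the standard basis so that smoothness follows from closure under
    sums and products.\<close>
  define F where "F z = (\<Sum>i\<in>UNIV. (\<phi> z * pderiv_at \<Psi> i z) *\<^sub>R (axis i 1 :: real^'n))" for z
  have Fi: "F z $ i = \<phi> z * pderiv_at \<Psi> i z" for z i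
    by (simp add: F_def axis_def if_distrib cong: if_cong)
  then have Fg: "F z = \<phi> z *\<^sub>R grad \<Psi> z" for z by (simp add: vec_eq_iff grad_def)
  have F0: "F z = 0" if "1/4 \<le> norm z" for z using supp(1)[OF that] by (simp add: F_def)
  have cont: "continuous_on UNIV \<phi>" "continuous_on UNIV (pderiv_at \<phi> j)" "continuous_on UNIV (pderiv_at \<Psi> i)"
    "continuous_on UNIV (pderiv_at (pderiv_at \<Psi> i) j)" for i j
    using \<phi>(1) \<Psi> by (auto intro: smooth_fun_continuous smooth_fun_pderiv)
  have Fs: "smooth_fun F" unfolding smooth_fun_def F_def
  proof (intro allI Ck_fun_sum)
    fix k i
    have "Ck_fun k (\<lambda>z. \<phi> z * pderiv_at \<Psi> i z)"
      using \<phi>(1) smooth_fun_pderiv[OF \<Psi>] by (intro Ck_fun_mult) (auto simp: smooth_fun_def)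
    then show "Ck_fun k (\<lambda>z. (\<phi> z * pderiv_at \<Psi> i z) *\<^sub>R (axis i 1 :: real^'n))"
      by (rule Ck_fun_scaleR[OF _ Ck_fun_const])
  qed
  have Fd: "pderiv_at F j z $ i = pderiv_at \<phi> j z * pderiv_at \<Psi> i z + \<phi> z * pderiv_at (pderiv_at \<Psi> i) j z" for i j z
  proof -
    have "((\<lambda>z. F z $ i) has_derivative (\<lambda>v. (\<Sum>j\<in>UNIV. v $ j *\<^sub>R pderiv_at F j z) $ i)) (at z)"
      by (rule bounded_linear.has_derivative[OF bounded_linear_vec_nth smooth_fun_has_derivative[OF Fs]])
    moreover have "((\<lambda>z. F z $ i) has_derivative (\<lambda>v. \<phi> z * (v \<bullet> grad (pderiv_at \<Psi> i) z)
        + (v \<bullet> grad \<phi> z) * pderiv_at \<Psi> i z)) (at z)"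
      unfolding Fi
      by (intro has_derivative_mult smooth_has_derivative_grad \<phi>(1) smooth_fun_pderiv \<Psi>)
    ultimately have "(\<lambda>v. (\<Sum>j\<in>UNIV. v $ j *\<^sub>R pderiv_at F j z) $ i)
        = (\<lambda>v. \<phi> z * (v \<bullet> grad (pderiv_at \<Psi> i) z) + (v \<bullet> grad \<phi> z) * pderiv_at \<Psi> i z)"
      by (rule has_derivative_unique)
    from fun_cong[OF this, of "axis j 1"]
    have "(\<Sum>k\<in>UNIV. axis j 1 $ k *\<^sub>R pderiv_at F k z) $ i
        = \<phi> z * pderiv_at (pderiv_at \<Psi> i) j z + pderiv_at \<phi> j z * pderiv_at \<Psi> i z"
      by (simp only: inner_axis') (simp add: grad_def)
    moreover have "(\<Sum>k\<in>UNIV. axis j 1 $ k *\<^sub>R pderiv_at F k z) = pderiv_at F j z"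
      by (simp add: axis_def if_distrib[where f = "\<lambda>t. t *\<^sub>R _"] cong: if_cong)
    ultimately show ?thesis by simp
  qed
  define \<Phi> where "\<Phi> x = F (w x)" for x
  have \<Phi>: "smooth_fun \<Phi>" "torus_periodic \<Phi>" "\<And>j x. pderiv_at \<Phi> j x = pderiv_at F j (w x)"
    using smooth_wrap[OF F0 Fs, of c] wrap_periodic[of F c]
    by (simp_all add: \<Phi>_def[abs_def] w_def)
  define T where "T x = (\<Sum>i\<in>UNIV. \<Sum>j\<in>UNIV. A x $ i $ j * (grad \<phi> (w x) $ j * grad \<Psi> (w x) $ i))" for x
  define H where "H x = \<phi> (w x) * contract (A x) (hess \<Psi> (w x))" for x
  have "integrable ?Q (\<lambda>x. \<Sum>i\<in>UNIV. \<Sum>j\<in>UNIV. A x $ i $ j * (\<lambda>z. \<phi> z * pderiv_at (pderiv_at \<Psi> i) j z) (wrap (x - c)))"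
    by (intro Bochner_Integration.integrable_sum integrable_times_wrap int continuous_intros cont)
  then show intH: "integrable ?Q (\<lambda>x. \<phi> (w x) * contract (A x) (hess \<Psi> (w x)))"
    by (simp add: contract_def hess_def w_def sum_distrib_left mult_ac)
  have "integrable ?Q (\<lambda>x. \<Sum>i\<in>UNIV. \<Sum>j\<in>UNIV. A x $ i $ j * (\<lambda>z. pderiv_at \<phi> j z * pderiv_at \<Psi> i z) (wrap (x - c)))"
    by (intro Bochner_Integration.integrable_sum integrable_times_wrap int continuous_intros cont)
  then have intT: "integrable ?Q T"
    unfolding T_def by (simp add: grad_def w_def)
  have gcont: "continuous_on UNIV (\<lambda>z. norm (grad \<phi> z))"
    unfolding grad_def using cont(2) by (intro continuous_intros continuous_on_vec_lambda)
  have intG: "integrable ?Q (\<lambda>x. norm (A x) * norm (grad \<phi> (w x)))"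
    unfolding w_def by (rule integrable_times_wrap[OF int(1) gcont])
  have "(LINT x|\<sigma>. \<Phi> x \<bullet> \<theta> x) = - (LINT x|?Q. (\<Sum>i\<in>UNIV. \<Sum>j\<in>UNIV. A x $ i $ j * pderiv_at \<Phi> j x $ i))"
    using div \<Phi>(1,2) by (simp add: div_is_measure_def)
  also have "(\<lambda>x. \<Sum>i\<in>UNIV. \<Sum>j\<in>UNIV. A x $ i $ j * pderiv_at \<Phi> j x $ i) = (\<lambda>x. H x + T x)"
    by (auto simp: \<Phi>(3) Fd H_def T_def contract_def hess_def grad_def fun_eq_iff sum_distrib_left
        sum.distrib algebra_simps)
  also have "(LINT x|?Q. H x + T x) = (LINT x|?Q. H x) + (LINT x|?Q. T x)"
    using intH intT by (simp add: H_def)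
  finally have eq: "(LINT x|?Q. H x) = - (LINT x|?Q. T x) - (LINT x|\<sigma>. \<Phi> x \<bullet> \<theta> x)" by simp
  have "- (LINT x|?Q. T x) \<le> (LINT x|?Q. \<bar>T x\<bar>)"
    using integral_abs_bound[of ?Q T] by linarith
  also have "\<dots> \<le> (LINT x|?Q. L * (norm (A x) * norm (grad \<phi> (w x))))"
  proof (rule integral_mono)
    fix x
    show "\<bar>T x\<bar> \<le> L * (norm (A x) * norm (grad \<phi> (w x)))"
    proof (cases "norm (w x) < 1/4")
      case True
      have "\<bar>T x\<bar> \<le> norm (A x) * (norm (grad \<Psi> (w x)) * norm (grad \<phi> (w x)))"
        unfolding T_def by (rule abs_bilinear_form_le)
      also have "\<dots> \<le> norm (A x) * (L * norm (grad \<phi> (w x)))"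
        using L[OF True] by (intro mult_left_mono mult_right_mono) auto
      finally show ?thesis by (simp add: mult_ac)
    next
      case False
      then have "grad \<phi> (w x) = 0" by (intro supp(2)) simp
      then show ?thesis by (simp add: T_def)
    qed
  qed (use intT intG in auto)
  finally have 1: "- (LINT x|?Q. T x) \<le> L * (LINT x|?Q. norm (A x) * norm (grad \<phi> (w x)))" by simp
  obtain B where B: "\<And>x. norm (\<phi> (wrap x)) \<le> B" using continuous_wrap_bounded[OF cont(1)] by metis
  have int\<phi>: "integrable \<sigma> (\<lambda>x. \<phi> (w x))"
  proof (rule \<sigma>.integrable_const_bound[of _ B])
    show "(\<lambda>x. \<phi> (w x)) \<in> borel_measurable \<sigma>"
      unfolding w_def measurable_cong_sets[OF \<sigma>(1) refl]
      by (intro borel_measurable_comp_wrap borel_measurable_continuous_onI cont)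
  qed (use B in \<open>simp add: w_def\<close>)
  have bd: "AE x in \<sigma>. \<bar>\<Phi> x \<bullet> \<theta> x\<bar> \<le> L * \<phi> (w x)"
    using pol(3)
  proof eventually_elim
    case (elim x)
    have "\<bar>\<Phi> x \<bullet> \<theta> x\<bar> \<le> norm (\<Phi> x)" using Cauchy_Schwarz_ineq2[of "\<Phi> x" "\<theta> x"] elim by simp
    also have "\<dots> = \<phi> (w x) * norm (grad \<Psi> (w x))" using \<phi>(2) by (simp add: \<Phi>_def Fg)
    also have "\<dots> \<le> \<phi> (w x) * L"
    proof (cases "norm (w x) < 1/4")
      case True
      then show ?thesis using L \<phi>(2) by (intro mult_left_mono) auto
    next
      case False
      then have "\<phi> (w x) = 0" by (intro supp(1)) simp
      then show ?thesis by simp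
    qed
    finally show ?case by (simp add: mult.commute)
  qed
  have "(\<lambda>x. \<Phi> x \<bullet> \<theta> x) \<in> borel_measurable \<sigma>"
    unfolding measurable_cong_sets[OF \<sigma>(1) refl]
    by (intro borel_measurable_inner pol(2) borel_measurable_continuous_onI smooth_fun_continuous \<Phi>(1))
  then have int\<Phi>: "integrable \<sigma> (\<lambda>x. \<Phi> x \<bullet> \<theta> x)"
    by (rule Bochner_Integration.integrable_bound[of \<sigma> "\<lambda>x. L * \<phi> (w x)", rotated])
      (use bd int\<phi> in \<open>auto elim: eventually_mono\<close>)
  have "- (LINT x|\<sigma>. \<Phi> x \<bullet> \<theta> x) \<le> (LINT x|\<sigma>. \<bar>\<Phi> x \<bullet> \<theta> x\<bar>)"
    using integral_abs_bound[of \<sigma> "\<lambda>x. \<Phi> x \<bullet> \<theta> x"] by linarith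
  also have "\<dots> \<le> (LINT x|\<sigma>. L * \<phi> (w x))"
    by (rule integral_mono_AE) (use int\<Phi> int\<phi> bd in auto)
  finally have 2: "- (LINT x|\<sigma>. \<Phi> x \<bullet> \<theta> x) \<le> L * (LINT x|\<sigma>. \<phi> (w x))" by simp
  show "(LINT x|?Q. \<phi> (w x) * contract (A x) (hess \<Psi> (w x)))
      \<le> L * ((LINT x|\<sigma>. \<phi> (w x)) + (LINT x|?Q. norm (A x) * norm (grad \<phi> (w x))))"
    using eq 1 2 by (simp add: H_def distrib_left)
qed

subsection \<open>The local determinant inequality\<close>

lemma lborel_integral_translate:
  fixes f :: "'a::euclidean_space \<Rightarrow> real"
  assumes "integrable lborel f"
  shows "integrable lborel (\<lambda>x. f (x + v))" "(LINT x|lborel. f (x + v)) = (LINT x|lborel. f x)"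
proof -
  have m: "f \<in> borel_measurable borel" using borel_measurable_integrable[OF assms] by simp
  have "integrable (distr lborel borel ((+) v)) f" using assms by (simp add: lborel_distr_plus)
  then show "integrable lborel (\<lambda>x. f (x + v))"
    by (subst (asm) integrable_distr_eq) (use m in \<open>auto simp: add.commute\<close>)
  have "(LINT x|lborel. f x) = (LINT x|distr lborel borel ((+) v). f x)" by (simp add: lborel_distr_plus)
  also have "\<dots> = (LINT x|lborel. f (v + x))" by (rule integral_distr) (use m in auto)
  finally show "(LINT x|lborel. f (x + v)) = (LINT x|lborel. f x)" by (simp add: add.commute)
qed

lemma countable_int_vec: "countable {k :: real^'n. int_vec k}"
proof -
  have "{k :: real^'n. int_vec k} \<subseteq> range (\<lambda>f :: 'n \<Rightarrow> int. \<chi> i. of_int (f i))"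
  proof
    fix k :: "real^'n" assume "k \<in> {k. int_vec k}"
    then have "k = (\<chi> i. of_int \<lfloor>k $ i\<rfloor>)" by (auto simp: int_vec_def vec_eq_iff elim!: Ints_cases)
    then show "k \<in> range (\<lambda>f :: 'n \<Rightarrow> int. \<chi> i. of_int (f i))"
      by (rule ssubst) (rule rangeI[of "\<lambda>f. \<chi> i. of_int (f i)" "\<lambda>i. \<lfloor>k $ i\<rfloor>"])
  qed
  then show ?thesis by (rule countable_subset) simp
qed

text \<open>\<open>wrap\<close> only translates by integer vectors, so the preimage lies in
  countably many translates of \<open>N\<close>.\<close>

lemma negligible_wrap_vimage:
  assumes "negligible (N :: (real^'n) set)"
  shows "negligible {x. wrap (x - c) \<in> N}"
proof (rule negligible_subset)
  have "negligible ((+) (c + k) ` N)" for k using assms by (rule negligible_translation)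
  then show "negligible (\<Union>k\<in>{k. int_vec k}. (+) (c + k) ` N)"
    by (intro negligible_countable_Union countable_image countable_int_vec) auto
  show "{x. wrap (x - c) \<in> N} \<subseteq> (\<Union>k\<in>{k. int_vec k}. (+) (c + k) ` N)"
  proof
    fix x assume x: "x \<in> {x. wrap (x - c) \<in> N}"
    have "x = (c + ((x - c) - wrap (x - c))) + wrap (x - c)" by simp
    then show "x \<in> (\<Union>k\<in>{k. int_vec k}. (+) (c + k) ` N)"
      using x int_vec_minus_wrap[of "x - c"] by blast
  qed
qed

text \<open>The representative in the fundamental domain. The map taking y to
  \<open>vfrac (y + c)\<close> undoes \<open>wrap (x - c)\<close> on the torus cube; through it a
  density on the torus is pulled back to the box centred at 0.\<close>

definition vfrac :: "real^'n \<Rightarrow> real^'n" where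
  "vfrac z = (\<chi> i. frac (z $ i))"

lemma vfrac_in_cube: "vfrac z \<in> torus_cube"
  by (simp add: vfrac_def torus_cube_def frac_lt_1)

lemma vfrac_minus_int: "int_vec k \<Longrightarrow> x \<in> torus_cube \<Longrightarrow> vfrac (x - k) = x"
proof -
  assume k: "int_vec k" and x: "x \<in> torus_cube"
  have "frac (x $ i - k $ i) = x $ i" for i
  proof -
    obtain m where "k $ i = of_int m" using k by (auto simp: int_vec_def elim: Ints_cases)
    then show ?thesis using x by (auto simp: frac_unique_iff torus_cube_def)
  qed
  then show ?thesis by (simp add: vfrac_def vec_eq_iff)
qed

lemma vfrac_wrap: "x \<in> torus_cube \<Longrightarrow> vfrac (wrap (x - c) + c) = x"
  using vfrac_minus_int[OF int_vec_minus_wrap[of "x - c"], of x] by (simp add: algebra_simps)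

lemma borel_measurable_vfrac [measurable]: "vfrac \<in> borel_measurable borel"
proof (rule borel_measurable_euclidean_space[THEN iffD2], rule ballI)
  fix b :: "real^'n" assume "b \<in> Basis"
  then obtain i where b: "b = axis i 1" by (auto simp: Basis_vec_def)
  have "(\<lambda>z::real^'n. z $ i) \<in> borel_measurable borel"
    by (intro borel_measurable_continuous_onI continuous_intros)
  then have "(\<lambda>z::real^'n. z $ i - of_int \<lfloor>z $ i\<rfloor>) \<in> borel_measurable borel" by measurable
  then show "(\<lambda>z. vfrac z \<bullet> b) \<in> borel_measurable borel"
    by (simp add: b inner_axis vfrac_def frac_def)
qed

definition shifts :: "(real^'n) set" where
  "shifts = {k. \<forall>i. k $ i \<in> {-1, 0, 1}}"

lemma finite_shifts: "finite (shifts :: (real^'n) set)"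
proof -
  have "shifts \<subseteq> (\<lambda>f. \<chi> i. f i) ` (PiE (UNIV :: 'n set) (\<lambda>_. {-1, 0, 1::real}))"
    by (auto simp: shifts_def image_iff intro!: bexI[of _ "\<lambda>i. _ $ i"] simp: vec_eq_iff)
  then show ?thesis by (rule finite_subset) (intro finite_imageI finite_PiE, auto)
qed

text \<open>The cube with centre \<open>c\<close> is covered by finitely many translates of the fundamental domain.\<close>

lemma integral_vfrac_le:
  fixes f :: "real^'n \<Rightarrow> real"
  assumes f: "f \<in> borel_measurable borel" "\<And>x. 0 \<le> f x" "\<And>x. f x \<le> N" and c: "c \<in> torus_cube"
  shows "(LINT y:unit_box|lborel. f (vfrac (y + c)))
    \<le> card (shifts :: (real^'n) set) * (LINT x:torus_cube|lborel. f x)"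
proof -
  have N: "0 \<le> N" using f(2,3) order_trans by blast
  define J where "J x = indicator torus_cube x * f x" for x
  have fin: "emeasure lborel (torus_cube :: (real^'n) set) < \<infinity>"
  proof -
    have "torus_cube \<subseteq> cbox 0 (1 :: real^'n)" by (auto simp: torus_cube_def mem_box_cart less_imp_le)
    then have "emeasure lborel (torus_cube :: (real^'n) set) \<le> emeasure lborel (cbox 0 (1 :: real^'n))"
      by (intro emeasure_mono) auto
    then show ?thesis using emeasure_lborel_cbox_finite by (rule le_less_trans)
  qed
  have J: "integrable lborel J"
  proof (rule Bochner_Integration.integrable_bound[of lborel "\<lambda>x. N * indicator torus_cube x"])
    show "integrable lborel (\<lambda>x::real^'n. N * indicator torus_cube x)"
      using fin by (intro integrable_mult_right integrable_real_indicator) auto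
    show "J \<in> borel_measurable lborel" unfolding J_def using f(1) by measurable
  qed (use f N in \<open>auto simp: J_def indicator_def\<close>)
  have le: "indicator unit_box y *\<^sub>R f (vfrac (y + c)) \<le> (\<Sum>k\<in>shifts. J (y + (c - k)))" for y :: "real^'n"
  proof (cases "y \<in> unit_box")
    case True
    define k :: "real^'n" where "k = (\<chi> i. of_int \<lfloor>y $ i + c $ i\<rfloor>)"
    \<comment> \<open>Each coordinate of y + c lies in [-1/2, 3/2), so its integer part is -1, 0 or
      1.\<close>
    have "k \<in> shifts" unfolding shifts_def
    proof (intro CollectI allI)
      fix i
      have "- (1/2) \<le> y $ i" "y $ i \<le> 1/2" "0 \<le> c $ i" "c $ i < 1"
        using True c by (auto simp: mem_box_cart torus_cube_def)
      define m where "m = \<lfloor>y $ i + c $ i\<rfloor>"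
      have "-1 \<le> m" "m < 2"
        using \<open>- (1/2) \<le> y $ i\<close> \<open>y $ i \<le> 1/2\<close> \<open>0 \<le> c $ i\<close> \<open>c $ i < 1\<close> unfolding m_def by linarith+
      then have "m = -1 \<or> m = 0 \<or> m = 1" by presburger
      then show "k $ i \<in> {-1, 0, 1}" by (auto simp: k_def m_def)
    qed
    moreover have "vfrac (y + c) = y + (c - k)" by (simp add: vfrac_def k_def frac_def vec_eq_iff)
    then have "indicator unit_box y *\<^sub>R f (vfrac (y + c)) = J (y + (c - k))"
      using True vfrac_in_cube[of "y + c"] by (simp add: J_def)
    moreover have "J (y + (c - k)) \<le> (\<Sum>k\<in>shifts. J (y + (c - k)))"
      by (rule member_le_sum[OF \<open>k \<in> shifts\<close> _ finite_shifts]) (use f(2) in \<open>simp add: J_def\<close>)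
    ultimately show ?thesis by simp
  next
    case False
    then show ?thesis using f(2) by (simp add: J_def sum_nonneg)
  qed
  have "(LINT y:unit_box|lborel. f (vfrac (y + c))) \<le> (LINT y|lborel. (\<Sum>k\<in>shifts. J (y + (c - k))))"
    unfolding set_lebesgue_integral_def
  proof (rule integral_mono_AE')
    show "integrable lborel (\<lambda>y. \<Sum>k\<in>shifts. J (y + (c - k)))"
      by (intro Bochner_Integration.integrable_sum lborel_integral_translate J)
    show "AE y in lborel. 0 \<le> (\<Sum>k\<in>shifts. J (y + (c - k)))"
      using f(2) by (auto simp: J_def intro!: sum_nonneg)
  qed (use le in auto)
  also have "\<dots> = (\<Sum>k\<in>(shifts :: (real^'n) set). LINT y|lborel. J y)"
    by (subst Bochner_Integration.integral_sum) (auto simp: lborel_integral_translate[OF J])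
  finally show ?thesis by (simp add: J_def set_lebesgue_integral_def)
qed

lemma root_le_of_le_power: "n > 0 \<Longrightarrow> 0 \<le> y \<Longrightarrow> x \<le> y ^ n \<Longrightarrow> root n x \<le> y"
  using real_root_le_mono[of n x "y ^ n"] by (simp add: real_root_power_cancel)

lemma continuous_on_det: "continuous_on S (det :: real^'n^'n \<Rightarrow> real)"
  unfolding det_def[abs_def] by (intro continuous_intros)

lemma powr_conjugate_power:
  fixes x :: real
  assumes "0 \<le> x" "2 \<le> n"
  shows "(x powr (real n / (real n - 1))) ^ (n - 1) = x ^ n" "(x powr (1 / (real n - 1))) ^ (n - 1) = x"
proof -
  have n: "real (n - 1) = real n - 1" "real n - 1 > 0" using assms(2) by auto
  have "(x powr (real n / (real n - 1))) ^ (n - 1) = x ^ n \<and> (x powr (1 / (real n - 1))) ^ (n - 1) = x"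
  proof (cases "x = 0")
    case True
    then show ?thesis using assms(2) by (simp add: power_0_left)
  next
    case False
    then have x: "x > 0" using assms(1) by simp
    have p: "(x powr a) ^ (n - 1) = x powr (a * (real n - 1))" for a
      using x n by (simp add: powr_realpow[symmetric] powr_powr)
    show ?thesis unfolding p using x n by (simp add: powr_realpow)
  qed
  then show "(x powr (real n / (real n - 1))) ^ (n - 1) = x ^ n" "(x powr (1 / (real n - 1))) ^ (n - 1) = x"
    by auto
qed

text \<open>4n^2 is the factor 8n of the Hessian bound times the factor n/2 of the gradient bound,
  and \<open>card shifts\<close> is the loss in \<open>integral_vfrac_le\<close>. The outer power
  comes from solving I^n \<le> K D^n I for I.\<close>

definition serre_const :: "'n::finite itself \<Rightarrow> real" where
  "serre_const _ = ((4 * (real CARD('n))\<^sup>2) ^ CARD('n) * card (shifts :: (real^'n) set)) powr (1 / (real CARD('n) - 1))"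

section \<open>The determinant inequality for one matrix field and one cutoff\<close>

locale local_test =
  fixes A :: "real^'n \<Rightarrow> real^'n^'n" and \<theta> :: "real^'n \<Rightarrow> real^'n" and \<sigma> :: "(real^'n) measure"
    and \<phi> :: "real^'n \<Rightarrow> real" and c :: "real^'n"
  assumes X: "in_Xp 1 A \<theta> \<sigma>" and \<phi>: "smooth_fun \<phi>" "\<And>z. 0 \<le> \<phi> z"
    and supp: "\<And>z. 1/4 \<le> norm z \<Longrightarrow> \<phi> z = 0" "\<And>z. 1/4 \<le> norm z \<Longrightarrow> grad \<phi> z = 0"
begin

definition w :: "real^'n \<Rightarrow> real^'n" where "w x = wrap (x - c)"

definition D :: real where
  "D = (LINT x|\<sigma>. \<phi> (w x)) + (LINT x|lebesgue_on torus_cube. norm (A x) * norm (grad \<phi> (w x)))"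

lemma D_nonneg: "0 \<le> D"
  unfolding D_def using \<phi>(2) by (intro add_nonneg_nonneg Bochner_Integration.integral_nonneg) auto

lemma A_props:
  "integrable (lebesgue_on torus_cube) (\<lambda>x. norm (A x))"
  "AE x in lebesgue_on torus_cube. psd_sym (A x)"
  "A \<in> borel_measurable (lebesgue_on torus_cube)"
  using X Lp_psd_1_integrable by (auto simp: in_Xp_def)

lemma det_measurable: "(\<lambda>x. det (A x)) \<in> borel_measurable (lebesgue_on torus_cube)"
  by (rule measurable_compose[OF A_props(3)]) (intro borel_measurable_continuous_onI continuous_on_det)

lemma w_measurable: "h \<in> borel_measurable borel \<Longrightarrow> (\<lambda>x. h (w x)) \<in> borel_measurable (lebesgue_on S)"
  unfolding w_def by (intro borel_measurable_lebesgue_on borel_measurable_comp_wrap)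

lemma \<phi>_measurable: "(\<lambda>x. \<phi> (w x)) \<in> borel_measurable (lebesgue_on S)"
  by (intro w_measurable borel_measurable_continuous_onI smooth_fun_continuous \<phi>)

text \<open>Taking n-th roots in g det A \<le> (8n A : D^2 \<Psi>)^n bounds the integrand pointwise
  by 8n \<phi> A : D^2 \<Psi>. The same domination yields integrability, which is not given in
  advance.\<close>

lemma det_bound_eps:
  assumes g: "continuous_on UNIV g" "\<And>x. 0 \<le> g x" and \<epsilon>: "0 < \<epsilon>"
  shows "integrable (lebesgue_on torus_cube) (\<lambda>x. \<phi> (w x) * root CARD('n) (g (w x) * det (A x)))"
    "(LINT x|lebesgue_on torus_cube. \<phi> (w x) * root CARD('n) (g (w x) * det (A x)))
      \<le> 4 * (CARD('n))\<^sup>2 * root CARD('n) (LINT x:unit_box|lborel. g x + \<epsilon>) * D"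
proof -
  let ?n = "CARD('n)" and ?Q = "lebesgue_on torus_cube :: (real^'n) measure"
  define L where "L = ?n / 2 * root ?n (LINT x:unit_box|lborel. g x + \<epsilon>)"
  have "0 \<le> (LINT x:unit_box|lborel. g x + \<epsilon>)"
    unfolding set_lebesgue_integral_def using g(2) \<epsilon>
    by (intro Bochner_Integration.integral_nonneg) (simp add: add_nonneg_nonneg less_imp_le)
  then have L0: "0 \<le> L" unfolding L_def by (intro mult_nonneg_nonneg real_root_ge_zero) auto
  obtain \<Psi> where \<Psi>: "smooth_fun \<Psi>" "\<And>y. norm y < 1/4 \<Longrightarrow> norm (grad \<Psi> y) \<le> L"
    "\<And>y A. norm y < 1/4 \<Longrightarrow> psd_sym A \<Longrightarrow> 0 \<le> contract A (hess \<Psi> y)"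
    "\<And>y A. norm y < 1/4 \<Longrightarrow> psd_sym A \<Longrightarrow>
       g y * det A \<le> (8 * CARD('n) * contract A (hess \<Psi> y)) ^ CARD('n)"
    using exists_smooth_potential[OF g \<epsilon>] unfolding L_def by metis
  have T: "integrable ?Q (\<lambda>x. \<phi> (w x) * contract (A x) (hess \<Psi> (w x)))"
    "(LINT x|?Q. \<phi> (w x) * contract (A x) (hess \<Psi> (w x))) \<le> L * D"
    unfolding D_def w_def by (rule test_field_bound[OF X \<phi> supp \<Psi>(1,2) L0]; assumption)+
  have ae: "AE x in ?Q. \<phi> (w x) * root ?n (g (w x) * det (A x))
      \<le> 8 * ?n * (\<phi> (w x) * contract (A x) (hess \<Psi> (w x)))"
    using A_props(2)
  proof eventually_elim
    case (elim x)
    show "\<phi> (w x) * root ?n (g (w x) * det (A x)) \<le> 8 * ?n * (\<phi> (w x) * contract (A x) (hess \<Psi> (w x)))"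
    proof (cases "norm (w x) < 1/4")
      case True
      have "root ?n (g (w x) * det (A x)) \<le> 8 * ?n * contract (A x) (hess \<Psi> (w x))"
        using \<Psi>(3,4)[OF True elim] by (intro root_le_of_le_power) auto
      from mult_left_mono[OF this \<phi>(2)[of "w x"]] show ?thesis by (simp only: mult_ac)
    next
      case False
      then have "\<phi> (w x) = 0" by (intro supp(1)) simp
      then show ?thesis by simp
    qed
  qed
  have ae0: "AE x in ?Q. 0 \<le> \<phi> (w x) * root ?n (g (w x) * det (A x))"
    using A_props(2)
  proof eventually_elim
    case (elim x)
    show ?case using \<phi>(2)[of "w x"] g(2)[of "w x"] psd_sym_det_nonneg[OF elim] by (simp add: real_root_ge_zero)
  qed
  have gm: "(\<lambda>x. g (w x)) \<in> borel_measurable ?Q"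
    by (intro w_measurable borel_measurable_continuous_onI g)
  have "(\<lambda>y. root ?n y) \<in> borel_measurable borel"
    by (intro borel_measurable_continuous_onI continuous_intros)
  from measurable_compose[OF borel_measurable_times[OF gm det_measurable] this]
  have m: "(\<lambda>x. \<phi> (w x) * root ?n (g (w x) * det (A x))) \<in> borel_measurable ?Q"
    by (intro borel_measurable_times \<phi>_measurable)
  have intH: "integrable ?Q (\<lambda>x. 8 * ?n * (\<phi> (w x) * contract (A x) (hess \<Psi> (w x))))"
    using T(1) by simp
  have "AE x in ?Q. norm (\<phi> (w x) * root ?n (g (w x) * det (A x)))
      \<le> norm (8 * ?n * (\<phi> (w x) * contract (A x) (hess \<Psi> (w x))))"
    using ae ae0
  proof eventually_elim
    case (elim x)
    then show ?case unfolding real_norm_def by linarith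
  qed
  then show int: "integrable ?Q (\<lambda>x. \<phi> (w x) * root ?n (g (w x) * det (A x)))"
    by (rule Bochner_Integration.integrable_bound[OF intH m])
  have "(LINT x|?Q. \<phi> (w x) * root ?n (g (w x) * det (A x)))
      \<le> (LINT x|?Q. 8 * ?n * (\<phi> (w x) * contract (A x) (hess \<Psi> (w x))))"
    by (rule integral_mono_AE[OF int intH ae])
  also have "\<dots> = 8 * ?n * (LINT x|?Q. \<phi> (w x) * contract (A x) (hess \<Psi> (w x)))" by simp
  also have "\<dots> \<le> 8 * ?n * (L * D)"
    using T(2) by (intro mult_left_mono) (auto simp: D_def)
  finally show "(LINT x|?Q. \<phi> (w x) * root ?n (g (w x) * det (A x)))
      \<le> 4 * (?n)\<^sup>2 * root ?n (LINT x:unit_box|lborel. g x + \<epsilon>) * D"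
    by (simp add: L_def power2_eq_square mult_ac)
qed

lemma unit_box_integral_continuous:
  assumes "continuous_on UNIV (g :: real^'n \<Rightarrow> real)"
  shows "set_integrable lborel unit_box g"
  unfolding set_integrable_def
  by (rule borel_integrable_compact) (auto intro: continuous_on_subset[OF assms])

lemma det_bound_continuous:
  assumes g: "continuous_on UNIV g" "\<And>x. 0 \<le> g x"
  shows "(LINT x|lebesgue_on torus_cube. \<phi> (w x) * root CARD('n) (g (w x) * det (A x)))
      \<le> 4 * (CARD('n))\<^sup>2 * root CARD('n) (LINT x:unit_box|lborel. g x) * D"
    (is "?I \<le> _")
proof (rule tendsto_lowerbound)
  let ?n = "CARD('n)"
  have e: "(LINT x:unit_box|lborel. g x + \<epsilon>) = (LINT x:unit_box|lborel. g x) + \<epsilon>" for \<epsilon>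
  proof -
    have "(LINT x:(unit_box :: (real^'n) set)|lborel. \<epsilon>) = \<epsilon>"
      by (simp add: set_lebesgue_integral_def content_cbox_cart interval_ne_empty_cart)
    then show ?thesis
      using unit_box_integral_continuous[OF g(1)] unit_box_integral_continuous[of "\<lambda>_. \<epsilon>"]
      by (simp add: set_integral_add)
  qed
  have "((\<lambda>\<epsilon>. 4 * (?n)\<^sup>2 * root ?n ((LINT x:unit_box|lborel. g x) + \<epsilon>) * D)
      \<longlongrightarrow> 4 * (?n)\<^sup>2 * root ?n ((LINT x:unit_box|lborel. g x) + 0) * D) (at_right 0)"
    by (intro tendsto_intros)
  then show "((\<lambda>\<epsilon>. 4 * (?n)\<^sup>2 * root ?n (LINT x:unit_box|lborel. g x + \<epsilon>) * D)
      \<longlongrightarrow> 4 * (?n)\<^sup>2 * root ?n (LINT x:unit_box|lborel. g x) * D) (at_right 0)"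
    by (simp add: e)
  show "\<forall>\<^sub>F \<epsilon> in at_right 0. ?I \<le> 4 * (?n)\<^sup>2 * root ?n (LINT x:unit_box|lborel. g x + \<epsilon>) * D"
    using eventually_at_right_less[of "0::real"] by eventually_elim (rule det_bound_eps[OF g])
qed simp

lemma det_integrable_measurable:
  assumes g: "g \<in> borel_measurable borel" "\<And>x. 0 \<le> g x" "\<And>x. g x \<le> N"
  shows "integrable (lebesgue_on torus_cube) (\<lambda>x. \<phi> (w x) * root CARD('n) (g (w x) * det (A x)))"
    "AE x in lebesgue_on torus_cube. norm (\<phi> (w x) * root CARD('n) (g (w x) * det (A x)))
        \<le> \<phi> (w x) * root CARD('n) (N * det (A x))"
proof -
  let ?n = "CARD('n)" and ?Q = "lebesgue_on torus_cube :: (real^'n) measure"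
  have N: "0 \<le> N" using g(2,3) order_trans by blast
  show ae: "AE x in ?Q. norm (\<phi> (w x) * root ?n (g (w x) * det (A x)))
        \<le> \<phi> (w x) * root ?n (N * det (A x))"
    using A_props(2)
  proof eventually_elim
    case (elim x)
    have d: "0 \<le> det (A x)" by (rule psd_sym_det_nonneg[OF elim])
    have "root ?n (g (w x) * det (A x)) \<le> root ?n (N * det (A x))"
      using g(3) d by (intro real_root_le_mono mult_right_mono) auto
    moreover have "0 \<le> root ?n (g (w x) * det (A x))"
      using g(2)[of "w x"] d by (simp add: real_root_ge_zero)
    ultimately show ?case using \<phi>(2)[of "w x"] by (simp add: mult_left_mono)
  qed
  have rm: "(\<lambda>y. root ?n y) \<in> borel_measurable borel"
    by (intro borel_measurable_continuous_onI continuous_intros)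
  have m: "(\<lambda>x. \<phi> (w x) * root ?n (g (w x) * det (A x))) \<in> borel_measurable ?Q"
    by (intro borel_measurable_times \<phi>_measurable
        measurable_compose[OF borel_measurable_times[OF w_measurable[OF g(1)] det_measurable] rm])
  have i: "integrable ?Q (\<lambda>x. \<phi> (w x) * root ?n (N * det (A x)))"
    using det_bound_eps(1)[of "\<lambda>_. N" 1] N by simp
  have b: "AE x in ?Q. norm (\<phi> (w x) * root ?n (g (w x) * det (A x)))
        \<le> norm (\<phi> (w x) * root ?n (N * det (A x)))"
    using ae by eventually_elim auto
  show "integrable ?Q (\<lambda>x. \<phi> (w x) * root ?n (g (w x) * det (A x)))"
    by (rule Bochner_Integration.integrable_bound[OF i m b])
qed

text \<open>A measurable g is an almost everywhere limit of continuous functions. The bound N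
  supplies the dominating function on both sides.\<close>

lemma det_bound_measurable:
  assumes g: "g \<in> borel_measurable borel" "\<And>x. 0 \<le> g x" "\<And>x. g x \<le> N"
  shows "(LINT x|lebesgue_on torus_cube. \<phi> (w x) * root CARD('n) (g (w x) * det (A x)))
      \<le> 4 * (CARD('n))\<^sup>2 * root CARD('n) (LINT x:unit_box|lborel. g x) * D"
proof -
  let ?n = "CARD('n)" and ?Q = "lebesgue_on torus_cube :: (real^'n) measure"
  have N: "0 \<le> N" using g(2,3) order_trans by blast
  have "g measurable_on UNIV"
    by (rule lebesgue_measurable_imp_measurable_on_real) (use g(1) in \<open>auto intro: measurable_completion\<close>)
  then obtain Z g0 where Z: "negligible Z" "\<And>j. continuous_on UNIV (g0 j)"
    "\<And>x. x \<notin> Z \<Longrightarrow> (\<lambda>j::nat. g0 j x) \<longlonglongrightarrow> g x"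
    unfolding measurable_on_def by auto
  \<comment> \<open>Clipping to [0, N] keeps continuity and convergence, since the limit already
    takes values in that interval.\<close>
  define gj where "gj j x = max 0 (min N (g0 j x))" for j x
  have gj: "continuous_on UNIV (gj j)" "\<And>x. 0 \<le> gj j x" "\<And>x. gj j x \<le> N" for j
    unfolding gj_def using N by (auto intro!: continuous_intros Z(2))
  have lim: "(\<lambda>j. gj j x) \<longlonglongrightarrow> g x" if "x \<notin> Z" for x
  proof -
    have "(\<lambda>j. gj j x) \<longlonglongrightarrow> max 0 (min N (g x))"
      unfolding gj_def by (intro tendsto_intros Z(3) that)
    then show ?thesis using g(2,3) by (simp add: min_absorb2)
  qed
  have "(\<lambda>j. LINT x|?Q. \<phi> (w x) * root ?n (gj j (w x) * det (A x)))
      \<longlonglongrightarrow> (LINT x|?Q. \<phi> (w x) * root ?n (g (w x) * det (A x)))"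
  proof (rule integral_dominated_convergence[where w = "\<lambda>x. \<phi> (w x) * root ?n (N * det (A x))"])
    show "(\<lambda>x. \<phi> (w x) * root ?n (g (w x) * det (A x))) \<in> borel_measurable ?Q"
      by (intro borel_measurable_integrable det_integrable_measurable[OF g])
    show "(\<lambda>x. \<phi> (w x) * root ?n (gj j (w x) * det (A x))) \<in> borel_measurable ?Q" for j
      by (intro borel_measurable_integrable det_bound_eps(1)[OF gj(1,2), of 1]) simp
    show "integrable ?Q (\<lambda>x. \<phi> (w x) * root ?n (N * det (A x)))"
      using det_bound_eps(1)[of "\<lambda>_. N" 1] N by simp
    have "negligible {x. w x \<in> Z}" unfolding w_def by (rule negligible_wrap_vimage[OF Z(1)])
    then have "AE x in lebesgue. w x \<notin> Z"
      by (intro AE_I'[of "{x. w x \<in> Z}"]) (auto simp: negligible_iff_null_sets)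
    then have "AE x in ?Q. w x \<notin> Z" by (auto simp: AE_restrict_space_iff elim: eventually_mono)
    then show "AE x in ?Q. (\<lambda>j. \<phi> (w x) * root ?n (gj j (w x) * det (A x)))
        \<longlonglongrightarrow> \<phi> (w x) * root ?n (g (w x) * det (A x))"
      by eventually_elim (intro tendsto_intros lim)
    show "AE x in ?Q. norm (\<phi> (w x) * root ?n (gj j (w x) * det (A x)))
        \<le> \<phi> (w x) * root ?n (N * det (A x))" for j
      by (rule det_integrable_measurable(2)[OF borel_measurable_continuous_onI[OF gj(1)] gj(2,3)])
  qed
  moreover have "(\<lambda>j. 4 * (?n)\<^sup>2 * root ?n (LINT x:unit_box|lborel. gj j x) * D)
      \<longlonglongrightarrow> 4 * (?n)\<^sup>2 * root ?n (LINT x:unit_box|lborel. g x) * D"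
  proof (intro tendsto_intros)
    show "(\<lambda>j. LINT x:unit_box|lborel. gj j x) \<longlonglongrightarrow> (LINT x:unit_box|lborel. g x)"
      unfolding set_lebesgue_integral_def
    proof (rule integral_dominated_convergence[where w = "\<lambda>x. indicator unit_box x *\<^sub>R N"])
      show "integrable lborel (\<lambda>x::real^'n. indicator unit_box x *\<^sub>R N)"
        using unit_box_integral_continuous[of "\<lambda>_. N"] by (simp add: set_integrable_def)
      show "(\<lambda>x. indicator unit_box x *\<^sub>R g x) \<in> borel_measurable lborel" using g(1) by measurable
      show "(\<lambda>x. indicator unit_box x *\<^sub>R gj j x) \<in> borel_measurable lborel" for j
        using unit_box_integral_continuous[OF gj(1)] unfolding set_integrable_def
        by (rule borel_measurable_integrable)
      have "Z \<in> null_sets lebesgue" using Z(1) by (simp add: negligible_iff_null_sets)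
      then have "AE x in lebesgue. x \<notin> Z" by (rule AE_not_in)
      then have "AE x in lborel. x \<notin> Z" by (simp add: AE_completion_iff)
      then show "AE x in lborel. (\<lambda>j. indicator unit_box x *\<^sub>R gj j x) \<longlonglongrightarrow> indicator unit_box x *\<^sub>R g x"
        by eventually_elim (intro tendsto_intros lim)
      show "AE x in lborel. norm (indicator unit_box x *\<^sub>R gj j x) \<le> indicator unit_box x *\<^sub>R N" for j
        using gj(2,3) by (auto simp: indicator_def)
    qed
  qed
  ultimately show ?thesis
    by (rule LIMSEQ_le) (use det_bound_continuous[OF gj(1,2)] in auto)
qed

text \<open>The n-th power of the hypothesis reads I^n \<le> K D^n I; one factor I cancels and the
  (n-1)-st root remains. Finiteness of I, which the truncation guarantees, is implicit in its being
  a real number.\<close>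

lemma truncated_self_bound:
  assumes n: "2 \<le> CARD('n)" and I: "0 \<le> I" and s: "0 \<le> s"
    and le: "I \<le> 4 * (real CARD('n))\<^sup>2 * root CARD('n) (s * I) * D"
  shows "I \<le> ((4 * (real CARD('n))\<^sup>2) ^ CARD('n) * s) powr (1 / (real CARD('n) - 1)) * D powr (real CARD('n) / (real CARD('n) - 1))"
proof (cases "I = 0")
  case False
  define m where "m = CARD('n)"
  define K where "K = (4 * (real m)\<^sup>2) ^ m * s"
  have m: "2 \<le> m" using n by (simp add: m_def)
  have K: "0 \<le> K" using s by (simp add: K_def)
  have "I ^ m \<le> (4 * (real m)\<^sup>2 * root m (s * I) * D) ^ m"
    using le I by (intro power_mono) (auto simp: m_def)
  also have "\<dots> = K * D ^ m * I"
    using I s m by (simp add: power_mult_distrib real_root_pow_pos2 K_def)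
  finally have "I ^ (m - 1) * I \<le> K * D ^ m * I"
    using m by (cases m) (auto simp: mult.commute)
  then have "I ^ (m - 1) \<le> K * D ^ m" using False I by simp
  also have "\<dots> = (K powr (1 / (real m - 1)) * D powr (real m / (real m - 1))) ^ (m - 1)"
    using powr_conjugate_power(2)[OF K m] powr_conjugate_power(1)[OF D_nonneg m]
    by (simp add: power_mult_distrib)
  finally have "I \<le> K powr (1 / (real m - 1)) * D powr (real m / (real m - 1))"
    using m by (subst (asm) power_mono_iff) (use I in auto)
  then show ?thesis by (simp add: m_def K_def)
qed (use s in simp)

lemma integral_torus_cube_lborel:
  fixes f :: "real^'n \<Rightarrow> real"
  assumes "f \<in> borel_measurable borel"
  shows "(LINT x:torus_cube|lborel. f x) = (LINT x|lebesgue_on torus_cube. f x)"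
proof -
  have "(LINT x|lebesgue_on torus_cube. f x) = (LINT x|lebesgue. indicator torus_cube x *\<^sub>R f x)"
    by (rule integral_restrict_space) simp
  also have "\<dots> = (LINT x|lborel. indicator torus_cube x *\<^sub>R f x)"
    by (rule integral_completion) (use assms in measurable)
  finally show ?thesis by (simp add: set_lebesgue_integral_def)
qed

text \<open>With f = \<phi>^p (det A)^(1/(n-1)) and g the truncation min f N, one has g \<le> \<phi>
  (g det A)^(1/n), because g^(n-1) \<le> f^(n-1) = \<phi>^n det A. Integrating bounds \<integral> g
  by a multiple of (\<integral> g)^(1/n) D; then N tends to infinity.\<close>

lemma det_power_bound:
  assumes n: "2 \<le> CARD('n)" and c: "c \<in> torus_cube"
  defines "p \<equiv> real CARD('n) / (real CARD('n) - 1)"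
  shows "(LINT x|lebesgue_on torus_cube. \<phi> (w x) powr p * det (A x) powr (1 / (real CARD('n) - 1)))
      \<le> serre_const TYPE('n) * D powr p"
proof -
  let ?n = "CARD('n)" and ?Q = "lebesgue_on torus_cube :: (real^'n) measure"
  define f where "f x = \<phi> (w x) powr p * det (A x) powr (1 / (real ?n - 1))" for x
  have f0: "0 \<le> f x" for x by (simp add: f_def)
  show ?thesis
  proof (cases "integrable ?Q f")
    case False
    \<comment> \<open>By convention the Bochner integral of a nonintegrable function is 0, which is
      below any nonnegative bound.\<close>
    then have "(LINT x|?Q. f x) = 0" by (rule not_integrable_integral_eq)
    then show ?thesis by (simp add: f_def serre_const_def)
  next
    case True
    have bound: "(LINT x|?Q. min (f x) (real N)) \<le> serre_const TYPE('n) * D powr p" for N :: nat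
    proof -
      have "(\<lambda>x. min (f x) (real N)) \<in> borel_measurable ?Q"
        using borel_measurable_integrable[OF True] by measurable
      then have "(\<lambda>x. if x \<in> torus_cube then min (f x) (real N) else 0) \<in> borel_measurable lebesgue"
        by (subst borel_measurable_if) auto
      \<comment> \<open>f is only Lebesgue measurable, while composition with \<open>vfrac\<close>
        calls for a Borel function; hence a Borel representative, clipped back to [0, N].\<close>
      from completion_ex_borel_measurable_real[OF this]
      obtain h where h0: "h \<in> borel_measurable lborel"
        and h2: "AE x in lborel. (if x \<in> torus_cube then min (f x) (real N) else 0) = h x" by blast
      have h: "h \<in> borel_measurable borel" using h0 by simp
      define f' where "f' x = max 0 (min (real N) (h x))" for x
      have f': "f' \<in> borel_measurable borel" "\<And>x. 0 \<le> f' x" "\<And>x. f' x \<le> N"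
        unfolding f'_def using h by auto
      have eq: "AE x in ?Q. f' x = min (f x) (real N)"
      proof -
        have "f' x = min (f x) (real N)" if "min (f x) (real N) = h x" for x
          using that f0[of x] unfolding f'_def that[symmetric] by simp
        then show ?thesis
          using AE_completion[OF h2] by (auto simp: AE_restrict_space_iff elim!: eventually_mono)
      qed
      define g where "g y = f' (vfrac (y + c))" for y
      have g: "g \<in> borel_measurable borel" "\<And>y. 0 \<le> g y" "\<And>y. g y \<le> N"
        unfolding g_def using f' by measurable
      have gw: "g (w x) = f' x" if "x \<in> torus_cube" for x
        using vfrac_wrap[OF that, of c] by (simp add: g_def w_def)
      define I where "I = (LINT x|?Q. min (f x) (real N))"
      have I: "I = (LINT x:torus_cube|lborel. f' x)"
        unfolding integral_torus_cube_lborel[OF f'(1)] I_def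
        by (rule integral_cong_AE) (use eq f'(1) borel_measurable_integrable[OF True] borel_measurable_lebesgue_on in
            \<open>auto elim: eventually_mono\<close>)
      have I0: "0 \<le> I" unfolding I_def using f0 by (intro Bochner_Integration.integral_nonneg) simp
      have "I \<le> (LINT x|?Q. \<phi> (w x) * root ?n (g (w x) * det (A x)))"
        unfolding I_def
      proof (rule integral_mono_AE')
        have sp: "AE x in ?Q. x \<in> torus_cube" by (rule AE_I2) simp
        show "AE x in ?Q. min (f x) (real N) \<le> \<phi> (w x) * root ?n (g (w x) * det (A x))"
          using A_props(2) eq sp
        proof eventually_elim
          case (elim x)
          define m where "m = min (f x) (real N)"
          have d: "0 \<le> det (A x)" by (rule psd_sym_det_nonneg[OF elim(1)])
          have m: "0 \<le> m" "m \<le> f x" "g (w x) = m" using f0 elim gw by (auto simp: m_def)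
          \<comment> \<open>Multiplying by m and taking the n-th root gives the pointwise inequality
            m \<le> \<phi> (m det A)^(1/n).\<close>
          have "m ^ (?n - 1) \<le> f x ^ (?n - 1)" using m by (intro power_mono)
          also have "\<dots> = \<phi> (w x) ^ ?n * det (A x)"
            unfolding f_def p_def power_mult_distrib
            using powr_conjugate_power(1)[OF \<phi>(2) n] powr_conjugate_power(2)[OF d n] by simp
          finally have "m * m ^ (?n - 1) \<le> m * (\<phi> (w x) ^ ?n * det (A x))"
            using m(1) by (rule mult_left_mono)
          then have "m ^ ?n \<le> \<phi> (w x) ^ ?n * (m * det (A x))"
            using n by (simp add: power_eq_if[of m ?n] mult_ac)
          then have "root ?n (m ^ ?n) \<le> root ?n (\<phi> (w x) ^ ?n * (m * det (A x)))"
            by (intro real_root_le_mono) auto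
          then have "m \<le> \<phi> (w x) * root ?n (m * det (A x))"
            using m(1) \<phi>(2)[of "w x"] by (simp add: real_root_mult real_root_power_cancel)
          then show ?case by (simp add: m(3) m_def[symmetric])
        qed
        show "integrable ?Q (\<lambda>x. \<phi> (w x) * root ?n (g (w x) * det (A x)))"
          by (rule det_integrable_measurable(1)[OF g])
        show "AE x in ?Q. 0 \<le> \<phi> (w x) * root ?n (g (w x) * det (A x))"
          using A_props(2)
        proof eventually_elim
          case (elim x)
          show ?case using \<phi>(2)[of "w x"] g(2)[of "w x"] psd_sym_det_nonneg[OF elim]
            by (simp add: real_root_ge_zero)
        qed
      qed
      also have "\<dots> \<le> 4 * (real ?n)\<^sup>2 * root ?n (LINT x:unit_box|lborel. g x) * D"
        using det_bound_measurable[OF g] by simp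
      also have "\<dots> \<le> 4 * (real ?n)\<^sup>2 * root ?n (card (shifts :: (real^'n) set) * I) * D"
        using integral_vfrac_le[OF f' c] D_nonneg unfolding I g_def
        by (intro mult_right_mono mult_left_mono real_root_le_mono) auto
      finally have "I \<le> 4 * (real ?n)\<^sup>2 * root ?n (card (shifts :: (real^'n) set) * I) * D" .
      from truncated_self_bound[OF n I0 _ this]
      show ?thesis by (simp add: serre_const_def I_def p_def)
    qed
    have "(\<lambda>N. LINT x|?Q. min (f x) (real N)) \<longlonglongrightarrow> (LINT x|?Q. f x)"
    proof (rule integral_dominated_convergence[where w = f])
      show "f \<in> borel_measurable ?Q" using True by (rule borel_measurable_integrable)
      then show "(\<lambda>x. min (f x) (real N)) \<in> borel_measurable ?Q" for N by measurable
      show "AE x in ?Q. (\<lambda>N. min (f x) (real N)) \<longlonglongrightarrow> f x"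
      proof (rule AE_I2)
        fix x
        obtain N0 :: nat where "f x \<le> N0" using real_arch_simple by blast
        then have "\<forall>\<^sub>F N in sequentially. f x = min (f x) (real N)"
          by (intro eventually_sequentiallyI[of N0]) simp
        then show "(\<lambda>N. min (f x) (real N)) \<longlonglongrightarrow> f x"
          by (rule Lim_transform_eventually[OF tendsto_const])
      qed
    qed (use True f0 in auto)
    then show ?thesis unfolding f_def by (rule LIMSEQ_le_const2) (use bound in \<open>auto simp: f_def\<close>)
  qed
qed

end

subsection \<open>The local estimate in the limit\<close>

definition tball :: "real \<Rightarrow> real^'n \<Rightarrow> (real^'n) set" where
  "tball r c = {x. norm (wrap (x - c)) < r}"

lemma int_vec_add: "int_vec a \<Longrightarrow> int_vec b \<Longrightarrow> int_vec (a + b)"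
  and int_vec_uminus: "int_vec a \<Longrightarrow> int_vec (- a)"
  by (simp_all add: int_vec_def)

text \<open>The sum of the two integer translations is a competitor for a + b in the minimality of
  \<open>wrap\<close>.\<close>

lemma norm_wrap_triangle: "norm (wrap (a + b)) \<le> norm (wrap a) + norm (wrap b)"
proof -
  have "norm (wrap (a + b)) \<le> norm (a + b - ((a - wrap a) + (b - wrap b)))"
    by (intro norm_wrap_le int_vec_add int_vec_minus_wrap)
  also have "\<dots> \<le> norm (wrap a) + norm (wrap b)" by (simp add: norm_triangle_ineq)
  finally show ?thesis .
qed

lemma norm_wrap_uminus: "norm (wrap (- a)) = norm (wrap a)"
proof -
  have *: "norm (wrap (- a)) \<le> norm (wrap a)" for a :: "real^'n"
    using norm_wrap_le[OF int_vec_uminus[OF int_vec_minus_wrap[of a]], of "- a"] by simp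
  from *[of a] *[of "- a"] show ?thesis by simp
qed

lemma norm_wrap_le_norm: "norm (wrap a) \<le> norm a"
  using norm_wrap_le[of 0 a] by (simp add: int_vec_def)

lemma norm_wrap_continuous: "continuous_on S (\<lambda>x. norm (wrap x))"
proof -
  have *: "norm (wrap a) - norm (wrap b) \<le> norm (a - b)" for a b :: "real^'n"
    using norm_wrap_triangle[of b "a - b"] norm_wrap_le_norm[of "a - b"] by simp
  have "1-lipschitz_on S (\<lambda>x. norm (wrap x))"
  proof (rule lipschitz_onI)
    fix x y :: "real^'n"
    show "dist (norm (wrap x)) (norm (wrap y)) \<le> 1 * dist x y"
      using *[of x y] *[of y x] by (simp add: dist_norm abs_le_iff norm_minus_commute)
  qed simp
  then show ?thesis by (rule lipschitz_on_continuous_on)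
qed

lemma open_tball: "open (tball r c)"
  unfolding tball_def
  by (intro open_Collect_less continuous_on_compose2[OF norm_wrap_continuous] continuous_intros) auto

lemma borel_tball [measurable]: "tball r c \<in> sets borel"
  by (intro borel_open open_tball)

lemma tball_subset: "norm (wrap (c - z)) \<le> s \<Longrightarrow> tball r c \<subseteq> tball (r + s) z"
proof
  fix x assume "norm (wrap (c - z)) \<le> s" "x \<in> tball r c"
  then show "x \<in> tball (r + s) z"
    using norm_wrap_triangle[of "x - c" "c - z"] by (simp add: tball_def)
qed

lemma torus_cube_diff_int:
  assumes "x \<in> torus_cube" "y \<in> torus_cube" "wrap (x - y) = 0"
  shows "x = y"
proof -
  have "int_vec (x - y)" using int_vec_minus_wrap[of "x - y"] assms(3) by simp
  then have "vfrac (x - (x - y)) = x" using assms(1) by (intro vfrac_minus_int)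
  moreover have "vfrac (y - 0) = y" using assms(2) by (intro vfrac_minus_int) (simp_all add: int_vec_def)
  ultimately show ?thesis by simp
qed

text \<open>For x and c in the fundamental domain the translation from x - c to its wrapped value
  has entries -1, 0, 1, so the torus ball lies in finitely many cubes of side 2r.\<close>

lemma measure_tball_le:
  fixes c :: "real^'n" and r :: real
  assumes c: "c \<in> torus_cube" and r: "0 < r"
  shows "measure lebesgue (torus_cube \<inter> tball r c) \<le> card (shifts :: (real^'n) set) * (2 * r) ^ CARD('n)"
proof -
  have sub: "torus_cube \<inter> tball r c \<subseteq> (\<Union>k\<in>shifts. cbox (c + k - vec r) (c + k + vec r))"
  proof
    fix x assume x: "x \<in> torus_cube \<inter> tball r c"
    define k where "k = x - c - wrap (x - c)"
    have "k $ i \<in> {-1, 0, 1}" for i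
    proof -
      define m where "m = round (x $ i - c $ i)"
      have b: "0 \<le> x $ i" "x $ i < 1" "0 \<le> c $ i" "c $ i < 1" using x c by (auto simp: torus_cube_def)
      have "\<bar>of_int m - (x $ i - c $ i)\<bar> \<le> 1/2" unfolding m_def by (rule of_int_round_abs_le)
      with b have "-2 < m" "m < 2" by linarith+
      then have "m = -1 \<or> m = 0 \<or> m = 1" by presburger
      then show ?thesis by (auto simp: k_def wrap_def m_def)
    qed
    then have "k \<in> shifts" by (simp add: shifts_def)
    moreover have "c $ i + k $ i - r \<le> x $ i \<and> x $ i \<le> c $ i + k $ i + r" for i
    proof -
      have "\<bar>wrap (x - c) $ i\<bar> < r" using x component_le_norm_cart[of "wrap (x - c)" i] by (auto simp: tball_def)
      moreover have "x $ i = c $ i + k $ i + wrap (x - c) $ i" by (simp add: k_def)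
      ultimately show ?thesis by linarith
    qed
    then have "x \<in> cbox (c + k - vec r) (c + k + vec r)" by (simp add: mem_box_cart)
    ultimately show "x \<in> (\<Union>k\<in>shifts. cbox (c + k - vec r) (c + k + vec r))" by blast
  qed
  have "measure lebesgue (torus_cube \<inter> tball r c)
      \<le> measure lebesgue (\<Union>k\<in>shifts. cbox (c + k - vec r) (c + k + vec r))"
    by (rule measure_mono_fmeasurable[OF sub]) (auto intro!: fmeasurable.finite_UN finite_shifts)
  also have "\<dots> \<le> (\<Sum>k\<in>(shifts :: (real^'n) set). measure lebesgue (cbox (c + k - vec r) (c + k + vec r)))"
    by (rule measure_UNION_le[OF finite_shifts]) auto
  also have "\<dots> = (\<Sum>k\<in>(shifts :: (real^'n) set). (2 * r) ^ CARD('n))"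
    using r by (intro sum.cong) (auto simp: content_cbox_cart interval_ne_empty_cart)
  finally show ?thesis by simp
qed

text \<open>Young's inequality for the conjugate exponents n/(n-1) and n, without the factors below
  1. If x \<le> y^(n-1) the product is at most y^n; otherwise y is at most x^(1/(n-1)).\<close>

lemma young_crude:
  fixes x y :: real
  assumes "0 \<le> x" "0 \<le> y" "2 \<le> n"
  shows "x * y \<le> x powr (real n / (real n - 1)) + y ^ n"
proof (cases "x \<le> y ^ (n - 1)")
  case True
  then have "x * y \<le> y ^ (n - 1) * y" using assms by (intro mult_right_mono)
  also have "\<dots> = y ^ n" using assms(3) by (cases n) auto
  finally show ?thesis by (simp add: add_increasing)
next
  case False
  define z where "z = x powr (1 / (real n - 1))"
  have z: "0 \<le> z" "z ^ (n - 1) = x" unfolding z_def using powr_conjugate_power(2)[OF assms(1,3)] by auto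
  have "y \<le> z"
  proof (rule ccontr)
    assume "\<not> y \<le> z"
    then have "z ^ (n - 1) \<le> y ^ (n - 1)" using z by (intro power_mono) auto
    then show False using False z by simp
  qed
  then have "x * y \<le> x * z" using assms by (intro mult_left_mono)
  also have "x * z = x powr (real n / (real n - 1))"
  proof (cases "x = 0")
    case False
    then have "x * z = x powr (1 + 1 / (real n - 1))" using assms by (simp add: z_def powr_add)
    moreover have "1 + 1 / (real n - 1) = real n / (real n - 1)" using assms(3) by (simp add: field_simps)
    ultimately show ?thesis by simp
  qed simp
  finally show ?thesis using assms by (simp add: add_increasing2)
qed

text \<open>Hoelder's inequality obtained from Young's with a weight a: |u|/r \<le> a^p |u|^p + (a
  r)^(-n). The volume of the ball, of order r^n, cancels r^(-n), so the bound does not depend on r.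
  A positive majorant V stands for the energy in the ball, since the optimal weight is a negative
  power of V.\<close>

lemma holder_tball:
  fixes u :: "real^'n \<Rightarrow> real" and c :: "real^'n"
  defines "p \<equiv> real CARD('n) / (real CARD('n) - 1)"
  assumes n: "2 \<le> CARD('n)" and c: "c \<in> torus_cube" and r: "0 < r"
    and u: "integrable (lebesgue_on torus_cube) u"
    and up: "integrable (lebesgue_on torus_cube) (\<lambda>x. \<bar>u x\<bar> powr p)"
    and V: "0 < V" "(LINT x|lebesgue_on torus_cube. indicator (tball r c) x * \<bar>u x\<bar> powr p) \<le> V"
  shows "(LINT x|lebesgue_on torus_cube. indicator (tball r c) x * (\<bar>u x\<bar> / r))
      \<le> (1 + card (shifts :: (real^'n) set) * 2 ^ CARD('n)) * V powr (1 / p)"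
proof -
  let ?n = "CARD('n)" and ?Q = "lebesgue_on torus_cube :: (real^'n) measure"
  let ?T = "indicator (tball r c) :: real^'n \<Rightarrow> real"
  have n1: "real ?n > 1" using n by simp
  \<comment> \<open>This weight balances a^p V with a^(-n): because n + p = n p, both equal
    V^(1/p).\<close>
  define a where "a = V powr (- (1 / (real ?n + p)))"
  have a: "a > 0" using V by (simp add: a_def)
  have p: "p > 1" "p > 0" using n1 by (auto simp: p_def field_simps)
  have ex: "real ?n + p = p * real ?n" using n1 by (simp add: p_def field_simps)
  have ex2: "real ?n / (real ?n + p) = 1 / p" using ex p n1 by simp
  have an: "(1 / a) ^ ?n = V powr (1 / p)"
  proof -
    have "1 / a = V powr (1 / (real ?n + p))" by (simp add: a_def powr_minus_divide)
    then have "(1 / a) ^ ?n = V powr (1 / (real ?n + p) * real ?n)"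
      using V(1) by (simp add: powr_realpow[symmetric] powr_powr)
    then show ?thesis using ex2 by simp
  qed
  have ap: "a powr p * V = V powr (1 / p)"
  proof -
    have "a powr p = V powr (- (1 / (real ?n + p)) * p)" by (simp only: a_def powr_powr)
    then have "a powr p * V = V powr (- (1 / (real ?n + p)) * p + 1)"
      using V(1) powr_add[of V "- (1 / (real ?n + p)) * p" 1] by simp
    also have "- (1 / (real ?n + p)) * p + 1 = real ?n / (real ?n + p)"
      using p n1 by (simp add: field_simps)
    finally show ?thesis using ex2 by simp
  qed
  have Tm: "?T \<in> borel_measurable ?Q" by (intro borel_measurable_lebesgue_on) simp
  have Tb: "\<bar>?T x\<bar> \<le> 1" for x by (simp add: indicator_def)
  have i1: "integrable ?Q (\<lambda>x. ?T x * (\<bar>u x\<bar> / r))"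
    using integrable_times_bounded[OF _ Tm Tb, of "\<lambda>x. \<bar>u x\<bar> / r"] u by (simp add: mult.commute)
  have i2: "integrable ?Q (\<lambda>x. ?T x * \<bar>u x\<bar> powr p)"
    using integrable_times_bounded[OF up Tm Tb] by (simp add: mult.commute)
  have sub: "torus_cube \<inter> tball r c \<in> lmeasurable"
  proof (rule bounded_set_imp_lmeasurable)
    have "torus_cube \<subseteq> cbox 0 (1 :: real^'n)" by (auto simp: torus_cube_def mem_box_cart less_imp_le)
    then show "bounded (torus_cube \<inter> tball r c)" using bounded_cbox bounded_subset by blast
  qed simp
  have Tint: "(LINT x|?Q. ?T x) = measure lebesgue (torus_cube \<inter> tball r c)"
    using sub by (simp add: measure_restrict_space Int_commute)
  have i3: "integrable ?Q ?T"
  proof -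
    have "(\<lambda>x. indicator torus_cube x *\<^sub>R ?T x) = indicator (torus_cube \<inter> tball r c)"
      by (auto simp: indicator_def fun_eq_iff)
    moreover have "integrable lebesgue (indicator (torus_cube \<inter> tball r c) :: real^'n \<Rightarrow> real)"
      using sub by (intro integrable_real_indicator) (auto simp: fmeasurable_def)
    ultimately show ?thesis by (simp add: integrable_restrict_space)
  qed
  have "(LINT x|?Q. ?T x * (\<bar>u x\<bar> / r))
      \<le> (LINT x|?Q. a powr p * (?T x * \<bar>u x\<bar> powr p) + (1 / (a * r)) ^ ?n * ?T x)"
  proof (rule integral_mono[OF i1])
    show "integrable ?Q (\<lambda>x. a powr p * (?T x * \<bar>u x\<bar> powr p) + (1 / (a * r)) ^ ?n * ?T x)"
      using i2 i3 by simp
    fix x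
    have "(a * \<bar>u x\<bar>) * (1 / (a * r)) \<le> (a * \<bar>u x\<bar>) powr p + (1 / (a * r)) ^ ?n"
      unfolding p_def using a r n by (intro young_crude) auto
    then have "\<bar>u x\<bar> / r \<le> a powr p * \<bar>u x\<bar> powr p + (1 / (a * r)) ^ ?n"
      using a by (simp add: powr_mult)
    then show "?T x * (\<bar>u x\<bar> / r) \<le> a powr p * (?T x * \<bar>u x\<bar> powr p) + (1 / (a * r)) ^ ?n * ?T x"
      by (simp add: indicator_def)
  qed
  also have "\<dots> = a powr p * (LINT x|?Q. ?T x * \<bar>u x\<bar> powr p) + (1 / (a * r)) ^ ?n * (LINT x|?Q. ?T x)"
    using i2 i3 by simp
  also have "\<dots> \<le> a powr p * V + (1 / (a * r)) ^ ?n * (card (shifts :: (real^'n) set) * (2 * r) ^ ?n)"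
    unfolding Tint using V a r measure_tball_le[OF c r] by (intro add_mono mult_left_mono) auto
  also have "(1 / (a * r)) ^ ?n * (card (shifts :: (real^'n) set) * (2 * r) ^ ?n)
      = card (shifts :: (real^'n) set) * 2 ^ ?n * (1 / a) ^ ?n"
    using r by (simp add: power_mult_distrib power_divide)
  finally show ?thesis unfolding ap an by (simp add: algebra_simps)
qed

lemma powr_add_le:
  fixes a b p :: real
  assumes "0 \<le> a" "0 \<le> b" "0 \<le> p"
  shows "(a + b) powr p \<le> 2 powr p * (a powr p + b powr p)"
proof -
  have "(a + b) powr p \<le> (2 * max a b) powr p" using assms by (intro powr_mono2) auto
  also have "\<dots> = 2 powr p * (max a b) powr p" using assms by (simp add: powr_mult)
  also have "(max a b) powr p \<le> a powr p + b powr p" by (simp add: max_def)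
  finally show ?thesis by (simp add: mult_left_mono)
qed

text \<open>The factor exp 2 compensates the lower bound exp (-2) of the bump on the half ball, so
  the cutoff is at least 1 on radius r and supported in radius 2r.\<close>

definition cutoff :: "real \<Rightarrow> real^'n \<Rightarrow> real" where
  "cutoff r z = exp 2 * bump (2 * r) z"

lemma cutoff_props:
  fixes z :: "real^'n"
  assumes r: "0 < r"
  shows "smooth_fun (cutoff r :: real^'n \<Rightarrow> real)" "0 \<le> cutoff r z" "cutoff r z \<le> exp 2"
    "2 * r \<le> norm z \<Longrightarrow> cutoff r z = 0" "2 * r \<le> norm z \<Longrightarrow> grad (cutoff r) z = 0"
    "norm z \<le> r \<Longrightarrow> 1 \<le> cutoff r z" "norm (grad (cutoff r) z) \<le> 2 * exp 2 / r"
proof -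
  show "smooth_fun (cutoff r :: real^'n \<Rightarrow> real)"
    unfolding smooth_fun_def cutoff_def[abs_def]
    using smooth_bump by (intro allI Ck_fun_mult Ck_fun_const) (auto simp: smooth_fun_def)
  show "0 \<le> cutoff r z" "cutoff r z \<le> exp 2"
    using bump_nonneg[of "2 * r" z] bump_le_1[of "2 * r" z] by (auto simp: cutoff_def)
  show "2 * r \<le> norm z \<Longrightarrow> cutoff r z = 0" using bump_eq_0[of "2 * r" z] r by (simp add: cutoff_def)
  show "1 \<le> cutoff r z" if "norm z \<le> r"
  proof -
    have "exp 2 * exp (- 2) \<le> cutoff r z"
      unfolding cutoff_def using bump_ge[of "2 * r" z] r that by (intro mult_left_mono) auto
    then show ?thesis by (simp add: exp_minus)
  qed
  have "pderiv_at (cutoff r) j z = exp 2 * pderiv_at (bump (2 * r)) j z" for j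
  proof -
    have "(cutoff r has_derivative (\<lambda>v. exp 2 * (v \<bullet> grad (bump (2 * r)) z))) (at z)"
      unfolding cutoff_def[abs_def]
      by (rule has_derivative_mult_right[OF smooth_has_derivative_grad[OF smooth_bump]])
    from pderiv_atI[OF this] show ?thesis by (simp add: inner_axis' grad_def)
  qed
  then have g: "grad (cutoff r) z = exp 2 *\<^sub>R grad (bump (2 * r)) z" by (simp add: grad_def vec_eq_iff)
  show "grad (cutoff r) z = 0" if "2 * r \<le> norm z"
    unfolding g using gradient_bump_eq_0[of "2 * r" z] r that by (simp add: grad_def vec_eq_iff)
  have "norm (grad (bump (2 * r)) z) \<le> 4 / (2 * r)"
    using norm_gradient_bump_le[of "2 * r" z] r unfolding grad_def by simp
  from mult_left_mono[OF this, of "exp 2"] have "norm (grad (cutoff r) z) \<le> exp 2 * (4 / (2 * r))"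
    unfolding g by simp
  then show "norm (grad (cutoff r) z) \<le> 2 * exp 2 / r" by (simp add: mult.commute)
qed

text \<open>Inside the sum, \<open>exp 2\<close> is the maximum of the cutoff, which meets \<nu>;
  the other summand is the gradient bound 4 exp 2 / (2r) without 1/(2r), times the constant of
  \<open>holder_tball\<close>, both raised to p. The factor 2^p splits the power of a sum.\<close>

definition ball_const :: "'n::finite itself \<Rightarrow> real \<Rightarrow> real" where
  "ball_const _ p = serre_const TYPE('n) * (2 powr p * (exp 2 powr p +
     (4 * exp 2 * (1 + card (shifts :: (real^'n) set) * 2 ^ CARD('n))) powr p))"

lemma serre_const_nonneg: "0 \<le> serre_const TYPE('n::finite)"
  by (simp add: serre_const_def)

lemma ball_const_nonneg: "0 \<le> ball_const TYPE('n::finite) p"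
  by (simp add: ball_const_def serre_const_nonneg)

lemma torus_measure_facts:
  assumes "torus_measure M"
  shows "finite_measure M" "sets M = sets borel" "space M = UNIV"
  using assms sets_eq_imp_space_eq[of M borel] by (auto simp: torus_measure_def)

locale limit_setup =
  fixes As :: "nat \<Rightarrow> real^'n \<Rightarrow> real^'n^'n" and \<Theta>s :: "nat \<Rightarrow> real^'n \<Rightarrow> real^'n"
    and \<Sigma>s :: "nat \<Rightarrow> (real^'n) measure" and u :: "real^'n \<Rightarrow> real" and \<mu> \<nu> :: "(real^'n) measure"
    and p :: real
  assumes n: "2 \<le> CARD('n)" and p_def: "p = real CARD('n) / (real CARD('n) - 1)"
    and X: "\<And>k. in_Xp 1 (As k) (\<Theta>s k) (\<Sigma>s k)"
    and u: "integrable (lebesgue_on torus_cube) u"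
    and uconv: "weak_L1_conv (\<lambda>k x. norm (As k x)) u"
    and up: "integrable (lebesgue_on torus_cube) (\<lambda>x. \<bar>u x\<bar> powr p)"
    and \<mu>: "torus_measure \<mu>" and \<nu>: "torus_measure \<nu>"
    and \<mu>conv: "\<And>\<phi>::real^'n \<Rightarrow> real. continuous_on UNIV \<phi> \<Longrightarrow> torus_periodic \<phi> \<Longrightarrow>
          (\<lambda>k. \<integral>x. \<phi> x * det (As k x) powr (1 / (real CARD('n) - 1)) \<partial>lebesgue_on torus_cube)
            \<longlonglongrightarrow> (\<integral>x. \<phi> x \<partial>\<mu>)"
    and \<nu>conv: "weakstar_conv \<Sigma>s \<nu>"
begin

lemma p_gt_1: "p > 1"
  using n by (simp add: p_def field_simps)

text \<open>Each term is an admissible test: the p-th power of the cutoff is continuous and tested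
  against the determinants, the cutoff against the measures |div A_k|, and the norm of its gradient,
  bounded and measurable, against |A_k|, which converges weakly in L^1. The condition r \<le> 1/8
  puts the support 2r inside the ball of radius 1/4.\<close>

lemma local_limit:
  assumes c: "c \<in> torus_cube" and r: "0 < r" "r \<le> 1/8"
  shows "(LINT x|\<mu>. cutoff r (wrap (x - c)) powr p) \<le> serre_const TYPE('n) *
    ((LINT x|\<nu>. cutoff r (wrap (x - c)))
      + (LINT x|lebesgue_on torus_cube. u x * norm (grad (cutoff r) (wrap (x - c))))) powr p" (is "?L \<le> _ * ?R powr p")
    and "0 \<le> (LINT x|\<nu>. cutoff r (wrap (x - c)))
      + (LINT x|lebesgue_on torus_cube. u x * norm (grad (cutoff r) (wrap (x - c))))"
proof -
  let ?Q = "lebesgue_on torus_cube :: (real^'n) measure"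
  have lt: "local_test (As k) (\<Theta>s k) (\<Sigma>s k) (cutoff r)" for k
  proof
    fix z :: "real^'n" assume "1/4 \<le> norm z"
    then have "2 * r \<le> norm z" using r(2) by simp
    then show "cutoff r z = 0" "grad (cutoff r) z = 0" by (rule cutoff_props(4,5)[OF r(1)])+
  qed (rule X cutoff_props(1,2)[OF r(1)])+
  define Dk where "Dk k = (LINT x|\<Sigma>s k. cutoff r (wrap (x - c)))
      + (LINT x|?Q. norm (As k x) * norm (grad (cutoff r) (wrap (x - c))))" for k
  have bound: "(LINT x|?Q. cutoff r (wrap (x - c)) powr p * det (As k x) powr (1 / (real CARD('n) - 1)))
      \<le> serre_const TYPE('n) * Dk k powr p" for k
    using local_test.det_power_bound[OF lt n c, of k]
    by (simp add: local_test.w_def[OF lt] local_test.D_def[OF lt] Dk_def p_def)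
  have Dk0: "0 \<le> Dk k" for k
    using local_test.D_nonneg[OF lt, of k c] by (simp add: local_test.w_def[OF lt] local_test.D_def[OF lt] Dk_def)
  have sm: "smooth_fun (cutoff r :: real^'n \<Rightarrow> real)" by (rule cutoff_props(1)[OF r(1)])
  have "smooth_fun (\<lambda>x. cutoff r (wrap (x - c)))"
  proof (rule smooth_wrap(1)[OF _ sm])
    fix z :: "real^'n" assume "1/4 \<le> norm z"
    then show "cutoff r z = 0" using r(2) by (intro cutoff_props(4)[OF r(1)]) simp
  qed
  then have cont: "continuous_on UNIV (\<lambda>x. cutoff r (wrap (x - c)))" by (rule smooth_fun_continuous)
  have per: "torus_periodic (\<lambda>x. cutoff r (wrap (x - c)))" by (rule wrap_periodic)
  have "(\<lambda>k. LINT x|?Q. cutoff r (wrap (x - c)) powr p * det (As k x) powr (1 / (real CARD('n) - 1)))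
      \<longlonglongrightarrow> ?L"
  proof (rule \<mu>conv)
    show "continuous_on UNIV (\<lambda>x. cutoff r (wrap (x - c)) powr p)"
      using cutoff_props(2)[OF r(1)] p_gt_1 by (intro continuous_on_powr' cont continuous_intros) auto
    show "torus_periodic (\<lambda>x. cutoff r (wrap (x - c)) powr p)"
      by (rule wrap_periodic[of "\<lambda>z. cutoff r z powr p"])
  qed
  moreover have Dlim: "Dk \<longlonglongrightarrow> ?R"
    unfolding Dk_def
  proof (rule tendsto_add)
    show "(\<lambda>k. LINT x|\<Sigma>s k. cutoff r (wrap (x - c))) \<longlonglongrightarrow> (LINT x|\<nu>. cutoff r (wrap (x - c)))"
      using \<nu>conv cont per by (simp add: weakstar_conv_def)
    have "continuous_on UNIV (grad (cutoff r :: real^'n \<Rightarrow> real))"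
      unfolding grad_def[abs_def]
      by (intro continuous_on_vec_lambda smooth_fun_continuous smooth_fun_pderiv sm)
    then have "(\<lambda>x. norm (grad (cutoff r) (wrap (x - c)))) \<in> borel_measurable ?Q"
      by (intro borel_measurable_lebesgue_on borel_measurable_comp_wrap[of "\<lambda>z. norm (grad (cutoff r) z)"]
          borel_measurable_continuous_onI continuous_on_norm)
    moreover have "bounded (range (\<lambda>x. norm (grad (cutoff r) (wrap (x - c)))))"
      using cutoff_props(7)[OF r(1)] by (auto simp: bounded_iff intro!: exI[of _ "2 * exp 2 / r"])
    ultimately show "(\<lambda>k. LINT x|?Q. norm (As k x) * norm (grad (cutoff r) (wrap (x - c))))
        \<longlonglongrightarrow> (LINT x|?Q. u x * norm (grad (cutoff r) (wrap (x - c))))"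
      using uconv unfolding weak_L1_conv_def by (simp add: inner_real_def)
  qed
  then show R0: "0 \<le> ?R" by (rule LIMSEQ_le_const) (use Dk0 in auto)
  have "(\<lambda>k. serre_const TYPE('n) * Dk k powr p) \<longlonglongrightarrow> serre_const TYPE('n) * ?R powr p"
    using p_gt_1 Dk0 by (intro tendsto_intros tendsto_powr' Dlim) auto
  ultimately show "?L \<le> serre_const TYPE('n) * ?R powr p"
    by (intro LIMSEQ_le) (use bound in auto)
qed

text \<open>The cutoff lies above the indicator of the ball of radius r and below exp 2 times that
  of radius 2r. The gradient term is handled by \<open>holder_tball\<close> on the larger ball, with
  the p-th power undoing the exponent 1/p of the energy.\<close>

lemma tball_estimate:
  assumes c: "c \<in> torus_cube" and r: "0 < r" "r \<le> 1/8"
  shows "measure \<mu> (tball r c) \<le> ball_const TYPE('n) p * (measure \<nu> (tball (2 * r) c) powr p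
    + (LINT x|lebesgue_on torus_cube. indicator (tball (2 * r) c) x * \<bar>u x\<bar> powr p))"
proof -
  let ?Q = "lebesgue_on torus_cube :: (real^'n) measure"
  let ?f = "\<lambda>x::real^'n. cutoff r (wrap (x - c))"
  define U where "U = (LINT x|?Q. indicator (tball (2 * r) c) x * \<bar>u x\<bar> powr p)"
  define C1 where "C1 = 1 + card (shifts :: (real^'n) set) * 2 ^ CARD('n)"
  interpret \<mu>: finite_measure \<mu> using torus_measure_facts[OF \<mu>] by simp
  interpret \<nu>: finite_measure \<nu> using torus_measure_facts[OF \<nu>] by simp
  have fm: "?f \<in> borel_measurable borel"
    by (intro borel_measurable_comp_wrap borel_measurable_continuous_onI smooth_fun_continuous cutoff_props(1) r)
  have U0: "0 \<le> U" unfolding U_def by (intro Bochner_Integration.integral_nonneg) simp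
  have le1: "measure \<mu> (tball r c) \<le> (LINT x|\<mu>. ?f x powr p)"
  proof -
    have "measure \<mu> (tball r c) = (LINT x|\<mu>. indicator (tball r c) x)"
      using torus_measure_facts[OF \<mu>] by simp
    also have "\<dots> \<le> (LINT x|\<mu>. ?f x powr p)"
    proof (rule integral_mono)
      show "integrable \<mu> (indicator (tball r c) :: _ \<Rightarrow> real)"
        using torus_measure_facts[OF \<mu>] by (intro integrable_real_indicator) (auto simp: less_top[symmetric])
      have "(\<lambda>x. ?f x powr p) \<in> borel_measurable \<mu>"
        using fm torus_measure_facts(2)[OF \<mu>] by (simp cong: measurable_cong_sets)
      moreover have "AE x in \<mu>. norm (?f x powr p) \<le> exp 2 powr p"
      proof (rule AE_I2)
        fix x
        have "?f x powr p \<le> exp 2 powr p" using p_gt_1 by (intro powr_mono2 cutoff_props(2,3)[OF r(1)]) simp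
        then show "norm (?f x powr p) \<le> exp 2 powr p" by simp
      qed
      ultimately show "integrable \<mu> (\<lambda>x. ?f x powr p)" by (intro \<mu>.integrable_const_bound)
      fix x
      show "indicator (tball r c) x \<le> ?f x powr p"
      proof (cases "x \<in> tball r c")
        case True
        then have "1 \<le> ?f x" using cutoff_props(6)[OF r(1), of "wrap (x - c)"] by (simp add: tball_def)
        then have "1 \<le> ?f x powr p" using p_gt_1 by (intro ge_one_powr_ge_zero) auto
        then show ?thesis using True by simp
      qed simp
    qed
    finally show ?thesis .
  qed
  have le2: "(LINT x|\<nu>. ?f x) \<le> exp 2 * measure \<nu> (tball (2 * r) c)"
  proof -
    have "(LINT x|\<nu>. ?f x) \<le> (LINT x|\<nu>. exp 2 * indicator (tball (2 * r) c) x)"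
    proof (rule integral_mono')
      show "integrable \<nu> (\<lambda>x. exp 2 * indicator (tball (2 * r) c) x :: real)"
        using torus_measure_facts[OF \<nu>] by (intro integrable_mult_right integrable_real_indicator) (auto simp: less_top[symmetric])
      show "?f x \<le> exp 2 * indicator (tball (2 * r) c) x" for x
        using cutoff_props(3,4)[OF r(1), of "wrap (x - c)"] by (auto simp: indicator_def tball_def)
      show "0 \<le> exp 2 * (indicator (tball (2 * r) c) x :: real)" for x :: "real^'n" by simp
    qed
    then show ?thesis using torus_measure_facts[OF \<nu>] by simp
  qed
  have le3: "(LINT x|?Q. u x * norm (grad (cutoff r) (wrap (x - c)))) \<le> 4 * exp 2 * C1 * V powr (1 / p)"
    if V: "0 < V" "U \<le> V" for V
  proof -
    have i: "integrable ?Q (\<lambda>x. indicator (tball (2 * r) c) x * (\<bar>u x\<bar> / (2 * r)))"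
      using integrable_times_bounded[of ?Q "\<lambda>x. \<bar>u x\<bar> / (2 * r)" "indicator (tball (2 * r) c)" 1]
        u borel_measurable_lebesgue_on[of "indicator (tball (2 * r) c)" torus_cube]
      by (simp add: mult.commute indicator_def)
    have "(LINT x|?Q. u x * norm (grad (cutoff r) (wrap (x - c))))
        \<le> (LINT x|?Q. 4 * exp 2 * (indicator (tball (2 * r) c) x * (\<bar>u x\<bar> / (2 * r))))"
    proof (rule integral_mono'[OF integrable_mult_right[OF i]])
      fix x
      show "u x * norm (grad (cutoff r) (wrap (x - c))) \<le> 4 * exp 2 * (indicator (tball (2 * r) c) x * (\<bar>u x\<bar> / (2 * r)))"
      proof (cases "x \<in> tball (2 * r) c")
        case True
        have "u x * norm (grad (cutoff r) (wrap (x - c))) \<le> \<bar>u x\<bar> * (2 * exp 2 / r)"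
          using cutoff_props(7)[OF r(1)] by (intro mult_mono) auto
        then show ?thesis using True r by (simp add: mult_ac)
      next
        case False
        then show ?thesis using cutoff_props(5)[OF r(1), of "wrap (x - c)"] by (simp add: tball_def)
      qed
      show "0 \<le> 4 * exp 2 * (indicator (tball (2 * r) c) x * (\<bar>u x\<bar> / (2 * r)))" using r by simp
    qed
    also have "\<dots> = 4 * exp 2 * (LINT x|?Q. indicator (tball (2 * r) c) x * (\<bar>u x\<bar> / (2 * r)))"
      by (rule integral_mult_right_zero)
    also have "\<dots> \<le> 4 * exp 2 * (C1 * V powr (1 / p))"
      unfolding C1_def using holder_tball[OF n c _ u up[unfolded p_def] V(1), of "2 * r"] V(2) r(1)
      by (intro mult_left_mono) (auto simp: U_def p_def)
    finally show ?thesis by simp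
  qed
  have C1: "0 \<le> C1" by (simp add: C1_def)
  have K: "0 \<le> ball_const TYPE('n) p" by (rule ball_const_nonneg)
  have est: "measure \<mu> (tball r c) \<le> ball_const TYPE('n) p * (measure \<nu> (tball (2 * r) c) powr p + V)"
    if V: "0 < V" "U \<le> V" for V
  proof -
    let ?D = "(LINT x|\<nu>. ?f x) + (LINT x|?Q. u x * norm (grad (cutoff r) (wrap (x - c))))"
    define t where "t = measure \<nu> (tball (2 * r) c)"
    have t: "0 \<le> t" by (simp add: t_def)
    have "?D powr p \<le> (exp 2 * t + 4 * exp 2 * C1 * V powr (1 / p)) powr p"
      using le2 le3[OF V] local_limit(2)[OF c r] p_gt_1 unfolding t_def by (intro powr_mono2 add_mono) auto
    also have "\<dots> \<le> 2 powr p * ((exp 2 * t) powr p + (4 * exp 2 * C1 * V powr (1 / p)) powr p)"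
      using t C1 p_gt_1 by (intro powr_add_le) auto
    also have "(exp 2 * t) powr p = exp 2 powr p * t powr p" using t by (simp add: powr_mult)
    also have "(4 * exp 2 * C1 * V powr (1 / p)) powr p = (4 * exp 2 * C1) powr p * V"
      using C1 V p_gt_1 by (simp add: powr_mult powr_powr)
    also have "exp 2 powr p * t powr p + (4 * exp 2 * C1) powr p * V
        \<le> (exp 2 powr p + (4 * exp 2 * C1) powr p) * (t powr p + V)"
      using V t by (simp add: algebra_simps)
    finally have "?D powr p \<le> 2 powr p * ((exp 2 powr p + (4 * exp 2 * C1) powr p) * (t powr p + V))"
      by (simp add: mult_left_mono)
    then have "serre_const TYPE('n) * ?D powr p
        \<le> serre_const TYPE('n) * (2 powr p * ((exp 2 powr p + (4 * exp 2 * C1) powr p) * (t powr p + V)))"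
      by (rule mult_left_mono[OF _ serre_const_nonneg])
    then show ?thesis using le1 local_limit(1)[OF c r] by (simp add: ball_const_def C1_def t_def mult_ac)
  qed
  show ?thesis unfolding U_def[symmetric]
  \<comment> \<open>The energy U in the ball may vanish, but Hoelder's inequality was stated for a
    positive majorant; U + d with small d is used instead.\<close>
  proof (rule field_le_epsilon)
    fix e :: real assume e: "0 < e"
    define d where "d = e / (ball_const TYPE('n) p + 1)"
    have d: "0 < d" "ball_const TYPE('n) p * d \<le> e"
      using e K by (auto simp: d_def field_simps)
    have "measure \<mu> (tball r c) \<le> ball_const TYPE('n) p * (measure \<nu> (tball (2 * r) c) powr p + (U + d))"
      using d U0 by (intro est) auto
    also have "\<dots> \<le> ball_const TYPE('n) p * (measure \<nu> (tball (2 * r) c) powr p + U) + e"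
      using d by (simp add: algebra_simps)
    finally show "measure \<mu> (tball r c) \<le> ball_const TYPE('n) p * (measure \<nu> (tball (2 * r) c) powr p + U) + e" .
  qed
qed

end

subsection \<open>Covering\<close>

lemma measure_torus_Int:
  assumes "torus_measure M" "S \<in> sets borel"
  shows "measure M (S \<inter> torus_cube) = measure M S"
proof (rule measure_eq_AE)
  have "UNIV - torus_cube \<in> null_sets M"
    using assms(1) by (intro null_setsI) (auto simp: torus_measure_def)
  then have "AE x in M. x \<notin> UNIV - torus_cube" by (rule AE_not_in)
  then show "AE x in M. (x \<in> S \<inter> torus_cube) = (x \<in> S)" by eventually_elim auto
qed (use assms in \<open>auto simp: torus_measure_def\<close>)

definition tnbhd :: "(real^'n) set \<Rightarrow> real \<Rightarrow> (real^'n) set" where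
  "tnbhd K e = (\<Union>z\<in>K. tball e z)"

lemma borel_tnbhd [measurable]: "tnbhd K e \<in> sets borel"
  unfolding tnbhd_def by (intro borel_open open_UN) (auto intro: open_tball)

lemma tnbhd_mono: "d \<le> e \<Longrightarrow> tnbhd K d \<subseteq> tnbhd K e"
  by (auto simp: tnbhd_def tball_def intro: order.strict_trans2)

text \<open>A point near K in the torus distance at every scale has, by compactness, torus distance
  0 from some point of K; two such points of the fundamental domain coincide. Intersecting with the
  domain excludes the other periodic copies of K.\<close>

lemma tnbhd_inter:
  fixes K :: "(real^'n) set"
  assumes K: "compact K" "K \<subseteq> torus_cube"
  shows "(\<Inter>k. tnbhd K (1 / real (Suc k)) \<inter> torus_cube) = K"
proof (intro equalityI subsetI)
  fix y assume y: "y \<in> (\<Inter>k. tnbhd K (1 / real (Suc k)) \<inter> torus_cube)"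
  then have "\<forall>k. \<exists>z\<in>K. norm (wrap (y - z)) < 1 / real (Suc k)" by (auto simp: tnbhd_def tball_def)
  then obtain z where z: "\<And>k. z k \<in> K" "\<And>k. norm (wrap (y - z k)) < 1 / real (Suc k)" by metis
  obtain l s where l: "l \<in> K" "strict_mono s" "(z \<circ> s) \<longlonglongrightarrow> l"
    using K(1) z(1) unfolding compact_def by metis
  have "continuous_on UNIV (\<lambda>x::real^'n. norm (wrap x))" by (rule norm_wrap_continuous)
  then have "isCont (\<lambda>x. norm (wrap x)) (y - l)" by (simp add: continuous_on_eq_continuous_at)
  moreover have "(\<lambda>k. y - z (s k)) \<longlonglongrightarrow> y - l" using l(3) by (intro tendsto_intros) (simp add: o_def)
  ultimately have "(\<lambda>k. norm (wrap (y - z (s k)))) \<longlonglongrightarrow> norm (wrap (y - l))"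
    by (rule isCont_tendsto_compose)
  moreover have "(\<lambda>k. norm (wrap (y - z (s k)))) \<longlonglongrightarrow> 0"
  proof (rule tendsto_sandwich[of "\<lambda>_. 0"])
    show "(\<lambda>k. 1 / real (Suc (s k))) \<longlonglongrightarrow> 0"
      using LIMSEQ_subseq_LIMSEQ[OF LIMSEQ_inverse_real_of_nat l(2)] by (simp add: o_def inverse_eq_divide)
  qed (use z(2) in \<open>auto intro: less_imp_le always_eventually\<close>)
  ultimately have "norm (wrap (y - l)) = 0" using LIMSEQ_unique by blast
  then have "wrap (y - l) = 0" by simp
  moreover have "y \<in> torus_cube" using y by blast
  moreover have "l \<in> torus_cube" using l(1) K(2) by blast
  ultimately have "y = l" by (rule torus_cube_diff_int[rotated 2])
  then show "y \<in> K" using l(1) by simp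
next
  fix y assume "y \<in> K"
  moreover have "norm (wrap (y - y)) < 1 / real (Suc k)" for k using norm_wrap_le_norm[of "y - y"]
    by (simp add: order.strict_trans1)
  ultimately show "y \<in> (\<Inter>k. tnbhd K (1 / real (Suc k)) \<inter> torus_cube)"
    using K(2) unfolding tnbhd_def tball_def by blast
qed

lemma measure_tnbhd_tendsto:
  assumes M: "torus_measure M" and K: "compact K" "K \<subseteq> torus_cube"
  shows "(\<lambda>k. measure M (tnbhd K (1 / real (Suc k)))) \<longlonglongrightarrow> measure M K"
proof -
  interpret finite_measure M using torus_measure_facts[OF M] by simp
  have "(\<lambda>k. measure M (tnbhd K (1 / real (Suc k)) \<inter> torus_cube))
      \<longlonglongrightarrow> measure M (\<Inter>k. tnbhd K (1 / real (Suc k)) \<inter> torus_cube)"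
  proof (rule finite_Lim_measure_decseq)
    show "range (\<lambda>k. tnbhd K (1 / real (Suc k)) \<inter> torus_cube) \<subseteq> sets M"
      using torus_measure_facts[OF M] by auto
    show "decseq (\<lambda>k. tnbhd K (1 / real (Suc k)) \<inter> torus_cube)"
    proof (rule decseq_SucI)
      fix k
      have "1 / real (Suc (Suc k)) \<le> 1 / real (Suc k)" by (simp add: frac_le)
      from tnbhd_mono[OF this]
      show "tnbhd K (1 / real (Suc (Suc k))) \<inter> torus_cube \<subseteq> tnbhd K (1 / real (Suc k)) \<inter> torus_cube" by blast
    qed
  qed
  then show ?thesis unfolding tnbhd_inter[OF K] by (simp add: measure_torus_Int[OF M borel_tnbhd])
qed

lemma exists_small_tnbhd:
  assumes "torus_measure M" "compact K" "K \<subseteq> torus_cube" "measure M K < e"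
  shows "\<exists>d>0. measure M (tnbhd K d) < e"
proof -
  have "\<forall>\<^sub>F k in sequentially. measure M (tnbhd K (1 / real (Suc k))) < e"
    by (rule order_tendstoD(2)[OF measure_tnbhd_tendsto[OF assms(1-3)] assms(4)])
  then obtain k where "measure M (tnbhd K (1 / real (Suc k))) < e" by (auto simp: eventually_sequentially)
  then show ?thesis by (intro exI[of _ "1 / real (Suc k)"]) simp
qed

text \<open>Continuity from above gives a small ball at each point without an atom. A finite
  subcover by balls of half those radii makes the radius uniform, as in the Lebesgue number
  lemma.\<close>

lemma uniformly_small_tballs:
  assumes M: "torus_measure M" and K: "compact K" "K \<subseteq> torus_cube"
    and atom: "\<And>x. x \<in> K \<Longrightarrow> measure M {x} = 0" and e: "0 < e"
  shows "\<exists>d>0. \<forall>z\<in>K. measure M (tball d z) < e"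
proof -
  interpret finite_measure M using torus_measure_facts[OF M] by simp
  have "\<exists>d>0. measure M (tball d z) < e" if "z \<in> K" for z
  proof -
    have "\<exists>d>0. measure M (tnbhd {z} d) < e"
      using atom[OF that] that K(2) e by (intro exists_small_tnbhd M) auto
    then show ?thesis by (simp add: tnbhd_def)
  qed
  then obtain d where d: "\<And>z. z \<in> K \<Longrightarrow> 0 < d z" "\<And>z. z \<in> K \<Longrightarrow> measure M (tball (d z) z) < e" by metis
  have "K \<subseteq> (\<Union>z\<in>K. ball z (d z / 2))" using d(1) by fastforce
  then obtain F where F: "F \<subseteq> K" "finite F" "K \<subseteq> (\<Union>z\<in>F. ball z (d z / 2))"
    using compactE_image[OF K(1), of K "\<lambda>z. ball z (d z / 2)"] by auto
  show ?thesis
  proof (cases "F = {}")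
    case True
    then show ?thesis using F(3) by (intro exI[of _ 1]) auto
  next
    case False
    define d0 where "d0 = Min ((\<lambda>z. d z / 2) ` F)"
    have d0: "0 < d0" unfolding d0_def using F(1,2) False d(1) by (auto simp: subset_eq)
    have d0': "d0 \<le> d z / 2" if "z \<in> F" for z
      unfolding d0_def using F(2) that by (intro Min_le) auto
    have "measure M (tball d0 y) < e" if "y \<in> K" for y
    proof -
      obtain z where z: "z \<in> F" "norm (y - z) < d z / 2"
        using F(3) \<open>y \<in> K\<close> by (auto simp: dist_norm norm_minus_commute)
      have "tball d0 y \<subseteq> tball (d0 + d z / 2) z"
        using norm_wrap_le_norm[of "y - z"] z(2) by (intro tball_subset) simp
      also have "\<dots> \<subseteq> tball (d z) z" using d0'[OF z(1)] by (auto simp: tball_def)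
      finally have "measure M (tball d0 y) \<le> measure M (tball (d z) z)"
        using torus_measure_facts[OF M] by (intro finite_measure_mono) auto
      also have "\<dots> < e" using d(2) z(1) F(1) by auto
      finally show ?thesis .
    qed
    then show ?thesis using d0 by blast
  qed
qed

section \<open>Grids of centres with bounded overlap\<close>

definition grid :: "nat \<Rightarrow> (real^'n) set" where
  "grid m = {c. \<forall>i. \<exists>j<m. c $ i = real j / real m}"

lemma finite_grid: "finite (grid m :: (real^'n) set)"
proof -
  have "grid m \<subseteq> (\<lambda>f. \<chi> i. real (f i) / real m) ` (PiE (UNIV :: 'n set) (\<lambda>_. {..<m}))"
  proof
    fix c :: "real^'n" assume "c \<in> grid m"
    then obtain f where f: "\<And>i. f i < m" "\<And>i. c $ i = real (f i) / real m" unfolding grid_def by simp metis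
    then have "c = (\<chi> i. real (f i) / real m)" by (simp add: vec_eq_iff)
    then show "c \<in> (\<lambda>f. \<chi> i. real (f i) / real m) ` (PiE (UNIV :: 'n set) (\<lambda>_. {..<m}))"
      using f(1) by auto
  qed
  then show ?thesis by (rule finite_subset) (intro finite_imageI finite_PiE, auto)
qed

lemma grid_in_cube: "c \<in> grid m \<Longrightarrow> c \<in> torus_cube"
  unfolding grid_def torus_cube_def by (auto simp: field_simps) (metis divide_less_eq_1 of_nat_0_less_iff
      of_nat_less_iff gr0I less_nat_zero_code divide_nonneg_nonneg of_nat_0_le_iff)+

lemma grid_near:
  fixes x :: "real^'n"
  assumes x: "x \<in> torus_cube" and m: "0 < m"
  shows "\<exists>c\<in>grid m. norm (x - c) \<le> CARD('n) / m"
proof -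
  define c :: "real^'n" where "c = (\<chi> i. real (nat \<lfloor>m * x $ i\<rfloor>) / m)"
  have x01: "0 \<le> x $ i" "x $ i < 1" for i using x by (auto simp: torus_cube_def)
  have fl: "real (nat \<lfloor>m * x $ i\<rfloor>) \<le> m * x $ i" "m * x $ i < real (nat \<lfloor>m * x $ i\<rfloor>) + 1" for i
    using x01(1)[of i] m by (auto simp: of_nat_nat)
  have "nat \<lfloor>m * x $ i\<rfloor> < m" for i
  proof -
    have "real (nat \<lfloor>m * x $ i\<rfloor>) < m * 1" using fl(1)[of i] x01(2)[of i] m
      by (intro order.strict_trans1[OF fl(1)] mult_strict_left_mono) auto
    then show ?thesis by simp
  qed
  then have "c \<in> grid m" by (auto simp: grid_def c_def)
  moreover have "\<bar>(x - c) $ i\<bar> \<le> 1 / m" for i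
  proof -
    have "c $ i \<le> x $ i" "x $ i \<le> c $ i + 1 / m"
      using fl[of i] m by (auto simp: c_def field_simps)
    then show ?thesis by simp
  qed
  then have "(\<Sum>i\<in>UNIV. \<bar>(x - c) $ i\<bar>) \<le> (\<Sum>i\<in>(UNIV :: 'n set). 1 / m)" by (intro sum_mono)
  then have "norm (x - c) \<le> CARD('n) / m" using norm_le_l1_cart[of "x - c"] by simp
  ultimately show ?thesis by blast
qed

definition offsets :: "('n::finite \<Rightarrow> int) set" where
  "offsets = PiE UNIV (\<lambda>_. {- (4 * int CARD('n)) - 1 .. 4 * int CARD('n) + 1})"

lemma finite_offsets: "finite (offsets :: ('n::finite \<Rightarrow> int) set)"
  unfolding offsets_def by (intro finite_PiE) auto

text \<open>Such a centre is recovered, modulo m, from the integer offsets between m times its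
  coordinates and the integer parts of m x. Each offset lies within 4n + 1 of 0, so the count does
  not depend on m.\<close>

lemma card_grid_overlap:
  fixes x :: "real^'n"
  assumes m: "0 < m"
  shows "card {c \<in> grid m. x \<in> tball (4 * CARD('n) / m) c} \<le> card (offsets :: ('n \<Rightarrow> int) set)"
proof -
  define F :: "('n \<Rightarrow> int) \<Rightarrow> real^'n" where "F d = (\<chi> i. of_int ((d i + \<lfloor>m * x $ i\<rfloor>) mod int m) / m)" for d
  have "{c \<in> grid m. x \<in> tball (4 * CARD('n) / m) c} \<subseteq> F ` offsets"
  proof
    fix c assume "c \<in> {c \<in> grid m. x \<in> tball (4 * CARD('n) / m) c}"
    then have c: "c \<in> grid m" "norm (wrap (x - c)) < 4 * CARD('n) / m" by (auto simp: tball_def)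
    obtain j where j: "\<And>i. j i < m" "\<And>i. c $ i = real (j i) / real m" using c(1) unfolding grid_def by simp metis
    define k where "k i = round (x $ i - c $ i)" for i
    define e where "e i = int (j i) + int m * k i" for i
    define d where "d i = e i - \<lfloor>m * x $ i\<rfloor>" for i
    have d: "d i \<in> {- (4 * int CARD('n)) - 1 .. 4 * int CARD('n) + 1}" for i
    proof -
      have "\<bar>x $ i - c $ i - of_int (k i)\<bar> < 4 * CARD('n) / m"
        using component_le_norm_cart[of "wrap (x - c)" i] c(2) by (simp add: wrap_def k_def)
      then have "m * \<bar>x $ i - c $ i - of_int (k i)\<bar> < 4 * CARD('n)"
        using m by (simp add: pos_less_divide_eq mult.commute)
      then have "\<bar>m * (x $ i - c $ i - of_int (k i))\<bar> < 4 * CARD('n)"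
        by (simp only: abs_mult abs_of_nat)
      moreover have "m * (x $ i - c $ i - of_int (k i)) = m * x $ i - of_int (e i)"
        using m by (simp add: j(2) e_def field_simps)
      ultimately have "\<bar>m * x $ i - of_int (e i)\<bar> < 4 * CARD('n)" by simp
      moreover have "of_int \<lfloor>m * x $ i\<rfloor> \<le> m * x $ i" "m * x $ i < of_int \<lfloor>m * x $ i\<rfloor> + 1" by linarith+
      ultimately have "of_int (d i) < 4 * real CARD('n) + 1" "- (4 * real CARD('n)) - 1 < of_int (d i)"
        unfolding d_def of_int_diff by linarith+
      then have "real_of_int (d i) < real_of_int (4 * int CARD('n) + 1)"
        "real_of_int (- (4 * int CARD('n)) - 1) < real_of_int (d i)" by simp_all
      then show ?thesis unfolding of_int_less_iff by simp
    qed
    have "c = F d"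
    proof -
      have "(d i + \<lfloor>m * x $ i\<rfloor>) mod int m = int (j i)" for i
        using j(1)[of i] by (simp add: d_def e_def)
      then show ?thesis by (simp add: F_def vec_eq_iff j(2))
    qed
    then show "c \<in> F ` offsets" using d by (auto simp: offsets_def)
  qed
  then have "card {c \<in> grid m. x \<in> tball (4 * CARD('n) / m) c} \<le> card (F ` offsets)"
    by (intro card_mono finite_imageI finite_offsets)
  also have "\<dots> \<le> card (offsets :: ('n \<Rightarrow> int) set)" by (rule card_image_le[OF finite_offsets])
  finally show ?thesis .
qed

text \<open>Integration of the counting function of the family, which is at most N on
  \<open>W\<close> and 0 outside.\<close>

lemma (in finite_measure) sum_measure_bounded_overlap:
  assumes fin: "finite \<Gamma>" and S: "\<And>c. c \<in> \<Gamma> \<Longrightarrow> S c \<in> sets M" "\<And>c. c \<in> \<Gamma> \<Longrightarrow> S c \<subseteq> W" and W: "W \<in> sets M"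
    and N: "\<And>x. card {c \<in> \<Gamma>. x \<in> S c} \<le> N"
  shows "(\<Sum>c\<in>\<Gamma>. measure M (S c)) \<le> N * measure M W"
proof -
  have int: "integrable M (indicator A :: 'a \<Rightarrow> real)" if "A \<in> sets M" for A
    using that by (intro integrable_real_indicator) (auto simp: less_top[symmetric])
  have "(\<Sum>c\<in>\<Gamma>. measure M (S c)) = (\<Sum>c\<in>\<Gamma>. LINT x|M. indicator (S c) x)"
    using S(1) sets.sets_into_space by (intro sum.cong) (auto simp: Int_absorb2)
  also have "\<dots> = (LINT x|M. (\<Sum>c\<in>\<Gamma>. indicator (S c) x))"
    using S(1) int by (subst Bochner_Integration.integral_sum) auto
  also have "\<dots> \<le> (LINT x|M. real N * indicator W x)"
  proof (rule integral_mono)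
    show "integrable M (\<lambda>x. \<Sum>c\<in>\<Gamma>. indicator (S c) x :: real)"
      using S(1) int by (intro Bochner_Integration.integrable_sum) auto
    show "integrable M (\<lambda>x. real N * indicator W x :: real)" using int[OF W] by simp
    fix x
    have "(\<Sum>c\<in>\<Gamma>. indicator (S c) x :: real) = card {c \<in> \<Gamma>. x \<in> S c}"
      using fin by (simp add: indicator_def sum.If_cases Int_def)
    also have "\<dots> \<le> real N * indicator W x"
    proof (cases "x \<in> W")
      case False
      then have "{c \<in> \<Gamma>. x \<in> S c} = {}" using S(2) by auto
      then have "card {c \<in> \<Gamma>. x \<in> S c} = 0" by (simp only: card.empty)
      then show ?thesis by simp
    qed (use N[of x] in simp)
    finally show "(\<Sum>c\<in>\<Gamma>. indicator (S c) x :: real) \<le> real N * indicator W x" .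
  qed
  also have "\<dots> = N * measure M W" using W sets.sets_into_space[OF W] by (simp add: Int_absorb2)
  finally show ?thesis .
qed

text \<open>Isolates the measure theory: \<rho> will be the energy measure |u|^p dx. Concentration
  of \<mu> on atoms of \<nu>, up to \<rho>, follows from p > 1 alone.\<close>

locale tball_comparison =
  fixes \<mu> \<nu> \<rho> :: "(real^'n) measure" and C p :: real
  assumes \<mu>: "torus_measure \<mu>" and \<nu>: "torus_measure \<nu>" and \<rho>: "torus_measure \<rho>"
    and C: "0 \<le> C" and p: "1 < p"
    and cmp: "\<And>c r. c \<in> torus_cube \<Longrightarrow> 0 < r \<Longrightarrow> r \<le> 1/8 \<Longrightarrow>
      measure \<mu> (tball r c) \<le> C * (measure \<nu> (tball (2 * r) c) powr p + measure \<rho> (tball (2 * r) c))"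
begin

sublocale \<mu>: finite_measure \<mu> using torus_measure_facts[OF \<mu>] by simp
sublocale \<nu>: finite_measure \<nu> using torus_measure_facts[OF \<nu>] by simp
sublocale \<rho>: finite_measure \<rho> using torus_measure_facts[OF \<rho>] by simp

lemma atom_bound:
  assumes x: "x \<in> torus_cube"
  shows "measure \<mu> {x} \<le> C * (measure \<nu> {x} powr p + measure \<rho> {x})"
proof -
  have K: "compact {x}" "{x} \<subseteq> torus_cube" using x by auto
  have lim: "(\<lambda>k. measure M (tball (1 / real (Suc k)) x)) \<longlonglongrightarrow> measure M {x}" if "torus_measure M" for M
    using measure_tnbhd_tendsto[OF that K] by (simp add: tnbhd_def)
  have "(\<lambda>k. C * (measure \<nu> (tball (1 / real (Suc k)) x) powr p + measure \<rho> (tball (1 / real (Suc k)) x)))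
      \<longlonglongrightarrow> C * (measure \<nu> {x} powr p + measure \<rho> {x})"
    using p by (intro tendsto_intros tendsto_powr' lim \<nu> \<rho>) auto
  moreover have "measure \<mu> {x} \<le> C * (measure \<nu> (tball (1 / real (Suc k)) x) powr p + measure \<rho> (tball (1 / real (Suc k)) x))"
    if "k \<ge> 4" for k
  proof -
    \<comment> \<open>Half the radius is used in the estimate, so that its doubled balls have radius
      1/(k+1); k \<ge> 4 keeps the half below 1/8.\<close>
    have r: "0 < 1 / real (Suc k) / 2" "1 / real (Suc k) / 2 \<le> 1/8"
      using that by (auto simp: field_simps)
    have "x \<in> tball (1 / real (Suc k) / 2) x"
      using norm_wrap_le_norm[of "x - x"] r(1) unfolding tball_def by (simp add: order.strict_trans1)
    then have "measure \<mu> {x} \<le> measure \<mu> (tball (1 / real (Suc k) / 2) x)"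
      using torus_measure_facts[OF \<mu>] by (intro \<mu>.finite_measure_mono) auto
    also have "\<dots> \<le> C * (measure \<nu> (tball (2 * (1 / real (Suc k) / 2)) x) powr p
        + measure \<rho> (tball (2 * (1 / real (Suc k) / 2)) x))" by (rule cmp[OF x r])
    also have "2 * (1 / real (Suc k) / 2) = 1 / real (Suc k)" by (simp del: of_nat_Suc)
    finally show ?thesis .
  qed
  ultimately show ?thesis by (intro LIMSEQ_le_const[of _ _ "measure \<mu> {x}"]) blast+
qed

text \<open>On balls with \<nu>-mass at most \<delta> one has \<nu>^p \<le> \<delta>^(p-1) \<nu>,
  which is linear in \<nu>. Summing over a cover of bounded overlap gives a small multiple of the
  total mass of \<nu>, plus a multiple of the \<rho>-mass of a neighbourhood of K, which is small
  because K is \<rho>-null.\<close>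

lemma compact_null:
  assumes K: "compact K" "K \<subseteq> torus_cube" and \<rho>K: "measure \<rho> K = 0"
    and atom: "\<And>x. x \<in> K \<Longrightarrow> measure \<nu> {x} = 0"
  shows "measure \<mu> K = 0"
proof -
  define N where "N = card (offsets :: ('n \<Rightarrow> int) set)"
  define V where "V = measure \<nu> UNIV"
  have V: "0 \<le> V" by (simp add: V_def)
  have est: "measure \<mu> K \<le> C * (N * (V + 1)) * e" if e: "0 < e" for e
  proof -
    \<comment> \<open>Solves \<delta>^(p-1) = e.\<close>
    define \<delta> where "\<delta> = e powr (1 / (p - 1))"
    have \<delta>: "0 < \<delta>" "\<delta> powr (p - 1) = e" using e p by (auto simp: \<delta>_def powr_powr)
    obtain d1 where d1: "0 < d1" "\<And>z. z \<in> K \<Longrightarrow> measure \<nu> (tball d1 z) < \<delta>"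
      using uniformly_small_tballs[OF \<nu> K atom \<delta>(1)] by blast
    obtain d2 where d2: "0 < d2" "measure \<rho> (tnbhd K d2) < e"
      using exists_small_tnbhd[OF \<rho> K, of e] \<rho>K e by auto
    define d where "d = min (min d1 d2) (3/8)"
    have d: "0 < d" "d \<le> d1" "d \<le> d2" "d \<le> 3/8" using d1 d2 by (auto simp: d_def)
    obtain m :: nat where m: "6 * CARD('n) / d < m" using reals_Archimedean2 by blast
    then have m0: "0 < m" using d(1) by (cases m) (auto simp: divide_less_0_iff not_less)
    \<comment> \<open>Twice n/m, the distance within which every point has a grid point; 2r = 4n/m
      is the radius in \<open>card_grid_overlap\<close>. A ball of radius 2r whose half-size ball
      meets K lies within 3r \<le> d of K, and d \<le> 3/8 gives r \<le> 1/8.\<close>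
    define r where "r = 2 * CARD('n) / m"
    have r: "0 < r" "3 * r \<le> d" using m m0 d by (auto simp: r_def field_simps)
    then have r8: "r \<le> 1/8" using d(4) by linarith
    define \<Gamma> where "\<Gamma> = {c \<in> grid m. tball r c \<inter> K \<noteq> {}}"
    have fin: "finite \<Gamma>" by (rule finite_subset[OF _ finite_grid[of m]]) (auto simp: \<Gamma>_def)
    have near: "\<exists>z\<in>K. tball (2 * r) c \<subseteq> tball d z" if "c \<in> \<Gamma>" for c
    proof -
      obtain z where z: "z \<in> K" "norm (wrap (z - c)) < r" using \<open>c \<in> \<Gamma>\<close> by (auto simp: \<Gamma>_def tball_def)
      have "norm (wrap (c - z)) \<le> r" using z(2) norm_wrap_uminus[of "z - c"] by simp
      from tball_subset[OF this, of "2 * r"] have "tball (2 * r) c \<subseteq> tball d z"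
        using r(2) by (auto simp: tball_def)
      then show ?thesis using z(1) by blast
    qed
    have sm: "measure \<nu> (tball (2 * r) c) \<le> \<delta>" "tball (2 * r) c \<subseteq> tnbhd K d2" if "c \<in> \<Gamma>" for c
    proof -
      obtain z where z: "z \<in> K" "tball (2 * r) c \<subseteq> tball d z" using near[OF \<open>c \<in> \<Gamma>\<close>] by blast
      have "tball d z \<subseteq> tball d1 z" "tball d z \<subseteq> tball d2 z" using d(2,3) by (auto simp: tball_def)
      then have s: "tball (2 * r) c \<subseteq> tball d1 z" "tball (2 * r) c \<subseteq> tball d2 z" using z(2) by auto
      then show "tball (2 * r) c \<subseteq> tnbhd K d2" using z(1) by (auto simp: tnbhd_def)
      have "measure \<nu> (tball (2 * r) c) \<le> measure \<nu> (tball d1 z)"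
        using s(1) torus_measure_facts[OF \<nu>] by (intro \<nu>.finite_measure_mono) auto
      then show "measure \<nu> (tball (2 * r) c) \<le> \<delta>" using d1(2)[OF z(1)] by simp
    qed
    have ov: "card {c \<in> \<Gamma>. x \<in> tball (2 * r) c} \<le> N" for x
    proof -
      have "card {c \<in> \<Gamma>. x \<in> tball (2 * r) c} \<le> card {c \<in> grid m. x \<in> tball (4 * CARD('n) / m) c}"
        by (rule card_mono) (auto simp: \<Gamma>_def r_def finite_grid)
      also have "\<dots> \<le> N" unfolding N_def by (rule card_grid_overlap[OF m0])
      finally show ?thesis .
    qed
    have cover: "K \<subseteq> (\<Union>c\<in>\<Gamma>. tball r c)"
    proof
      fix x assume x: "x \<in> K"
      then obtain c where c: "c \<in> grid m" "norm (x - c) \<le> CARD('n) / m" using grid_near[OF _ m0] K(2) by blast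
      have "CARD('n) / m < r" using m0 by (simp add: r_def divide_strict_right_mono)
      then have "norm (wrap (x - c)) < r" using c(2) norm_wrap_le_norm[of "x - c"] by linarith
      then show "x \<in> (\<Union>c\<in>\<Gamma>. tball r c)" using x c(1) by (auto simp: \<Gamma>_def tball_def)
    qed
    have "measure \<mu> K \<le> measure \<mu> (\<Union>c\<in>\<Gamma>. tball r c)"
      using torus_measure_facts[OF \<mu>] fin by (intro \<mu>.finite_measure_mono cover sets.finite_UN) auto
    also have "\<dots> \<le> (\<Sum>c\<in>\<Gamma>. measure \<mu> (tball r c))"
      using torus_measure_facts[OF \<mu>] fin by (intro \<mu>.finite_measure_subadditive_finite) auto
    also have "\<dots> \<le> (\<Sum>c\<in>\<Gamma>. C * (e * measure \<nu> (tball (2 * r) c) + measure \<rho> (tball (2 * r) c)))"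
    proof (rule sum_mono)
      fix c assume c: "c \<in> \<Gamma>"
      define t where "t = measure \<nu> (tball (2 * r) c)"
      have t: "0 \<le> t" "t \<le> \<delta>" using sm(1)[OF c] by (auto simp: t_def)
      have "t powr p \<le> e * t"
      proof (cases "t = 0")
        case False
        then have "t powr p = t powr (p - 1) * t" using t powr_add[of t "p - 1" 1] by simp
        also have "\<dots> \<le> \<delta> powr (p - 1) * t" using t p by (intro mult_right_mono powr_mono2) auto
        finally show ?thesis using \<delta>(2) by simp
      qed simp
      then have "C * (t powr p + measure \<rho> (tball (2 * r) c)) \<le> C * (e * t + measure \<rho> (tball (2 * r) c))"
        using C by (intro mult_left_mono) auto
      moreover have "c \<in> torus_cube" using c by (auto simp: \<Gamma>_def intro: grid_in_cube)
      ultimately show "measure \<mu> (tball r c) \<le> C * (e * measure \<nu> (tball (2 * r) c) + measure \<rho> (tball (2 * r) c))"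
        using cmp[OF _ r(1) r8, of c] by (simp add: t_def)
    qed
    also have "\<dots> = C * (e * (\<Sum>c\<in>\<Gamma>. measure \<nu> (tball (2 * r) c)) + (\<Sum>c\<in>\<Gamma>. measure \<rho> (tball (2 * r) c)))"
      by (simp add: sum.distrib sum_distrib_left distrib_left)
    also have "\<dots> \<le> C * (e * (N * V) + N * e)"
    proof (intro mult_left_mono add_mono)
      show "(\<Sum>c\<in>\<Gamma>. measure \<nu> (tball (2 * r) c)) \<le> N * V"
        unfolding V_def using torus_measure_facts[OF \<nu>] ov fin
        by (intro \<nu>.sum_measure_bounded_overlap) auto
      have "(\<Sum>c\<in>\<Gamma>. measure \<rho> (tball (2 * r) c)) \<le> N * measure \<rho> (tnbhd K d2)"
        using torus_measure_facts[OF \<rho>] ov fin sm(2)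
        by (intro \<rho>.sum_measure_bounded_overlap) auto
      also have "\<dots> \<le> N * e" using d2(2) by (intro mult_left_mono) auto
      finally show "(\<Sum>c\<in>\<Gamma>. measure \<rho> (tball (2 * r) c)) \<le> N * e" .
    qed (use C e in auto)
    finally show ?thesis by (simp add: algebra_simps)
  qed
  have "measure \<mu> K \<le> 0"
  proof (rule field_le_epsilon)
    fix e :: real assume e: "0 < e"
    define L where "L = C * (N * (V + 1))"
    have L: "0 \<le> L" using C V by (simp add: L_def)
    have "measure \<mu> K \<le> L * (e / (L + 1))" unfolding L_def[symmetric] using est[of "e / (L + 1)"] e L
      by (simp add: L_def)
    also have "\<dots> \<le> e" using e L by (simp add: field_simps)
    finally show "measure \<mu> K \<le> 0 + e" by simp
  qed
  then show ?thesis by (simp add: measure_le_0_iff)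
qed

text \<open>Inner regularity of a finite Borel measure reduces the claim to compact subsets.\<close>

lemma null_of_no_atoms:
  assumes E: "E \<in> sets borel" "E \<subseteq> torus_cube" and \<rho>E: "measure \<rho> E = 0"
    and atom: "\<And>x. x \<in> E \<Longrightarrow> measure \<nu> {x} = 0"
  shows "emeasure \<mu> E = 0"
proof -
  have "emeasure \<mu> E = (SUP K \<in> {K. K \<subseteq> E \<and> compact K}. emeasure \<mu> K)"
    by (rule inner_regular) (use torus_measure_facts[OF \<mu>] E in auto)
  also have "\<dots> \<le> 0"
  proof (rule SUP_least)
    fix K assume "K \<in> {K. K \<subseteq> E \<and> compact K}"
    then have K: "K \<subseteq> E" "compact K" by auto
    have "measure \<rho> K \<le> measure \<rho> E"
      using K E torus_measure_facts[OF \<rho>] by (intro \<rho>.finite_measure_mono) auto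
    then have "measure \<rho> K = 0" using \<rho>E by (simp add: measure_le_0_iff)
    then have "measure \<mu> K = 0" using K E atom by (intro compact_null) auto
    then show "emeasure \<mu> K \<le> 0" by (simp add: \<mu>.emeasure_eq_measure)
  qed
  finally show ?thesis by simp
qed

end

subsection \<open>The singular parts\<close>

context limit_setup
begin

text \<open>The measure |u|^p dx. The density lives on Lebesgue sets of the fundamental domain; the
  push-forward under the identity turns it into a Borel measure on the whole space, as
  \<open>torus_measure\<close> demands.\<close>

definition energy_measure :: "(real^'n) measure" where
  "energy_measure = distr (density (lebesgue_on torus_cube) (\<lambda>x. ennreal (\<bar>u x\<bar> powr p))) borel (\<lambda>x. x)"

lemma emeasure_energy_measure:
  assumes S: "S \<in> sets borel"
  shows "emeasure energy_measure S = ennreal (LINT x|lebesgue_on torus_cube. indicator S x * \<bar>u x\<bar> powr p)"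
proof -
  let ?Q = "lebesgue_on torus_cube :: (real^'n) measure"
  have um: "(\<lambda>x. \<bar>u x\<bar> powr p) \<in> borel_measurable ?Q" using up by (rule borel_measurable_integrable)
  have id: "(\<lambda>x. x) \<in> measurable ?Q borel"
    using borel_measurable_lebesgue_on[of "\<lambda>x. x" torus_cube] by simp
  have S': "S \<inter> space ?Q \<in> sets ?Q" using measurable_sets[OF id S] by simp
  have Sm: "indicator S \<in> borel_measurable ?Q" using borel_measurable_lebesgue_on[of "indicator S" torus_cube] S by simp
  have "emeasure energy_measure S = emeasure (density ?Q (\<lambda>x. ennreal (\<bar>u x\<bar> powr p))) (S \<inter> space ?Q)"
    unfolding energy_measure_def using id S by (subst emeasure_distr) auto
  also have "\<dots> = (\<integral>\<^sup>+x. ennreal (\<bar>u x\<bar> powr p) * indicator (S \<inter> space ?Q) x \<partial>?Q)"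
    using um S' by (intro emeasure_density) auto
  also have "\<dots> = (\<integral>\<^sup>+x. ennreal (indicator S x * \<bar>u x\<bar> powr p) \<partial>?Q)"
    by (intro nn_integral_cong) (auto simp: indicator_def)
  also have "\<dots> = ennreal (LINT x|?Q. indicator S x * \<bar>u x\<bar> powr p)"
  proof (rule nn_integral_eq_integral)
    show "integrable ?Q (\<lambda>x. indicator S x * \<bar>u x\<bar> powr p)"
      using integrable_times_bounded[OF up Sm, of 1] by (simp add: mult.commute indicator_def)
  qed simp
  finally show ?thesis .
qed

lemma measure_energy_measure:
  "S \<in> sets borel \<Longrightarrow> measure energy_measure S = (LINT x|lebesgue_on torus_cube. indicator S x * \<bar>u x\<bar> powr p)"
  unfolding measure_def by (simp add: emeasure_energy_measure)

lemma torus_measure_energy: "torus_measure energy_measure"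
  unfolding torus_measure_def
proof (intro conjI)
  show s: "sets energy_measure = sets borel" by (simp add: energy_measure_def)
  have "space energy_measure = UNIV" by (simp add: energy_measure_def)
  then show "finite_measure energy_measure"
    by (intro finite_measureI) (simp add: emeasure_energy_measure)
  have "(LINT x|lebesgue_on torus_cube. indicator (UNIV - torus_cube) x * \<bar>u x\<bar> powr p)
      = (LINT x|lebesgue_on (torus_cube :: (real^'n) set). 0)"
    by (rule Bochner_Integration.integral_cong) auto
  then show "emeasure energy_measure (UNIV - torus_cube) = 0"
    by (subst emeasure_energy_measure) auto
qed

lemma energy_measure_null:
  assumes S: "S \<in> sets borel" "emeasure lborel S = 0"
  shows "measure energy_measure S = 0"
proof -
  have "S \<in> null_sets lebesgue" using S by (intro null_sets_completionI) auto
  then have "AE x in lebesgue. x \<notin> S" by (rule AE_not_in)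
  then have "AE x in lebesgue_on torus_cube. x \<notin> S"
    by (auto simp: AE_restrict_space_iff elim: eventually_mono)
  then have "AE x in lebesgue_on torus_cube. indicator S x * \<bar>u x\<bar> powr p = 0"
    by eventually_elim simp
  then show ?thesis by (simp add: measure_energy_measure[OF S(1)] integral_eq_zero_AE)
qed

sublocale tball_comparison \<mu> \<nu> energy_measure "ball_const TYPE('n) p" p
  by unfold_locales
    (use \<mu> \<nu> torus_measure_energy ball_const_nonneg p_gt_1 tball_estimate in \<open>auto simp: measure_energy_measure\<close>)

text \<open>\<mu>s is dominated by \<mu> and carried by a Lebesgue null set, on which the energy
  measure vanishes. Off the countably many atoms of \<nu> this set is therefore \<mu>-null, and at
  an atom the energy term drops out of \<open>atom_bound\<close>. Countability allows summation over
  the points.\<close>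

lemma singular_part_concentration:
  assumes \<mu>s: "leb_singular_part \<mu> \<mu>s" and \<nu>s: "leb_singular_part \<nu> \<nu>s"
  shows "emeasure \<mu>s (UNIV - {x. 0 < measure \<nu>s {x}}) = 0"
    and "E \<in> sets borel \<Longrightarrow> emeasure \<mu>s E \<le> ennreal (ball_const TYPE('n) p) *
      (\<integral>\<^sup>+ x. ennreal (measure \<nu>s {x} powr p) \<partial>count_space (E \<inter> {x. 0 < measure \<nu>s {x}}))"
proof -
  have sets: "sets \<mu>s = sets borel" using \<mu>s by (simp add: leb_singular_part_def)
  have le: "emeasure \<mu>s A \<le> emeasure \<mu> A" if "A \<in> sets borel" for A
    using \<mu>s that unfolding leb_singular_part_def by (metis le_iff_add add.commute)
  \<comment> \<open>The absolutely continuous part does not charge points, so \<nu> and \<nu>s have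
    the same atoms.\<close>
  have at: "measure \<nu>s {x} = measure \<nu> {x}" for x
  proof -
    obtain \<nu>a where a: "absolutely_continuous lborel \<nu>a" "\<And>A. A \<in> sets borel \<Longrightarrow> emeasure \<nu> A = emeasure \<nu>a A + emeasure \<nu>s A"
      using \<nu>s unfolding leb_singular_part_def by blast
    have "{x} \<in> null_sets lborel" by (intro null_setsI) auto
    then have "{x} \<in> null_sets \<nu>a" using a(1) by (auto simp: absolutely_continuous_def)
    then have "emeasure \<nu>a {x} = 0" by auto
    then show ?thesis using a(2)[of "{x}"] by (simp add: measure_def)
  qed
  define S where "S = {x. 0 < measure \<nu> {x}}"
  have S: "{x. 0 < measure \<nu>s {x}} = S" by (simp add: at S_def)
  have "S = {x. measure \<nu> {x} \<noteq> 0}" by (auto simp: S_def less_le)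
  then have countS: "countable S" using \<nu>.countable_support by simp
  then have Sb: "S \<in> sets borel" by (rule sets.countable[rotated]) simp
  obtain N where N: "N \<in> sets borel" "emeasure lborel N = 0" "emeasure \<mu>s (UNIV - N) = 0"
    using \<mu>s unfolding leb_singular_part_def by blast
  \<comment> \<open>What remains of the carrier of \<mu>s in the fundamental domain after removal of
    the atoms of \<nu>.\<close>
  define E0 where "E0 = (N \<inter> torus_cube) - S"
  have E0: "E0 \<in> sets borel" "E0 \<subseteq> torus_cube" using N(1) Sb by (auto simp: E0_def)
  have "emeasure lborel E0 \<le> emeasure lborel N" using N(1) by (intro emeasure_mono) (auto simp: E0_def)
  then have "measure energy_measure E0 = 0" using N(2) E0(1) by (intro energy_measure_null) auto
  then have "emeasure \<mu> E0 = 0"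
    by (intro null_of_no_atoms E0) (auto simp: E0_def S_def less_le)
  then have 1: "emeasure \<mu>s E0 = 0" using le[OF E0(1)] by simp
  have 2: "emeasure \<mu>s (UNIV - torus_cube) = 0"
    using le[of "UNIV - torus_cube"] \<mu> by (simp add: torus_measure_def)
  have "UNIV - S \<subseteq> (UNIV - N) \<union> ((UNIV - torus_cube) \<union> E0)" by (auto simp: E0_def)
  then have "emeasure \<mu>s (UNIV - S) \<le> emeasure \<mu>s ((UNIV - N) \<union> ((UNIV - torus_cube) \<union> E0))"
    using sets N(1) E0(1) by (intro emeasure_mono) auto
  also have "\<dots> \<le> emeasure \<mu>s (UNIV - N) + emeasure \<mu>s ((UNIV - torus_cube) \<union> E0)"
    using sets N(1) E0(1) by (intro emeasure_subadditive) auto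
  also have "emeasure \<mu>s ((UNIV - torus_cube) \<union> E0) \<le> emeasure \<mu>s (UNIV - torus_cube) + emeasure \<mu>s E0"
    using sets E0(1) by (intro emeasure_subadditive) auto
  finally have 3: "emeasure \<mu>s (UNIV - S) = 0" using N(3) 1 2 by simp
  then show "emeasure \<mu>s (UNIV - {x. 0 < measure \<nu>s {x}}) = 0" unfolding S .
  assume E: "E \<in> sets borel"
  have "emeasure \<mu>s E \<le> emeasure \<mu>s ((E \<inter> S) \<union> (UNIV - S))"
    using sets E Sb by (intro emeasure_mono) auto
  also have "\<dots> \<le> emeasure \<mu>s (E \<inter> S) + emeasure \<mu>s (UNIV - S)"
    using sets E Sb by (intro emeasure_subadditive) auto
  also have "\<dots> = emeasure \<mu>s (E \<inter> S)" using 3 by simp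
  also have "\<dots> = (\<integral>\<^sup>+x. emeasure \<mu>s {x} \<partial>count_space (E \<inter> S))"
    using countS sets by (intro emeasure_countable_singleton) auto
  also have "\<dots> \<le> (\<integral>\<^sup>+x. ennreal (ball_const TYPE('n) p) * ennreal (measure \<nu>s {x} powr p) \<partial>count_space (E \<inter> S))"
  proof (rule nn_integral_mono)
    fix x assume "x \<in> space (count_space (E \<inter> S))"
    then have xS: "0 < measure \<nu> {x}" by (simp add: S_def)
    have x: "x \<in> torus_cube"
    proof (rule ccontr)
      assume "x \<notin> torus_cube"
      then have "{x} \<inter> torus_cube = {}" by simp
      then show False using measure_torus_Int[OF \<nu>, of "{x}"] xS by simp
    qed
    have "measure energy_measure {x} = 0" by (rule energy_measure_null) auto
    then have "measure \<mu> {x} \<le> ball_const TYPE('n) p * measure \<nu>s {x} powr p"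
      using atom_bound[OF x] by (simp add: at)
    then have "emeasure \<mu> {x} \<le> ennreal (ball_const TYPE('n) p * measure \<nu>s {x} powr p)"
      unfolding \<mu>.emeasure_eq_measure by (rule ennreal_leI)
    then show "emeasure \<mu>s {x} \<le> ennreal (ball_const TYPE('n) p) * ennreal (measure \<nu>s {x} powr p)"
      using le[of "{x}"] by (simp add: ennreal_mult ball_const_nonneg)
  qed
  also have "\<dots> = ennreal (ball_const TYPE('n) p) * (\<integral>\<^sup>+x. ennreal (measure \<nu>s {x} powr p) \<partial>count_space (E \<inter> S))"
    by (rule nn_integral_cmult) simp
  finally show "emeasure \<mu>s E \<le> ennreal (ball_const TYPE('n) p) *
      (\<integral>\<^sup>+ x. ennreal (measure \<nu>s {x} powr p) \<partial>count_space (E \<inter> {x. 0 < measure \<nu>s {x}}))"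
    unfolding S .
qed

end

theorem mainTheorem2:
  assumes "CARD('n) \<ge> 2"
  shows "\<exists>C::real. C > 0 \<and>
    (\<forall>(As :: nat \<Rightarrow> real^'n \<Rightarrow> real^'n^'n) \<Theta>s \<Sigma>s A \<theta> \<sigma> (u :: real^'n \<Rightarrow> real) \<mu> \<nu> \<mu>s \<nu>s.
       (\<forall>k. in_Xp 1 (As k) (\<Theta>s k) (\<Sigma>s k)) \<and> in_Xp 1 A \<theta> \<sigma> \<and>
       weak_L1_conv As A \<and> weakstar_conv_vec \<Theta>s \<Sigma>s \<theta> \<sigma> \<and>
       integrable (lebesgue_on torus_cube) u \<and>
       weak_L1_conv (\<lambda>k x. norm (As k x)) u \<and>
       u \<in> borel_measurable (lebesgue_on torus_cube) \<and>
       integrable (lebesgue_on torus_cube) (\<lambda>x. \<bar>u x\<bar> powr (real CARD('n) / (real CARD('n) - 1))) \<and>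
       torus_measure \<mu> \<and> torus_measure \<nu> \<and>
       (\<forall>\<phi>::real^'n \<Rightarrow> real. continuous_on UNIV \<phi> \<and> torus_periodic \<phi> \<longrightarrow>
          (\<lambda>k. \<integral>x. \<phi> x * det (As k x) powr (1 / (real CARD('n) - 1)) \<partial>lebesgue_on torus_cube)
            \<longlonglongrightarrow> (\<integral>x. \<phi> x \<partial>\<mu>)) \<and>
       weakstar_conv \<Sigma>s \<nu> \<and>
       leb_singular_part \<mu> \<mu>s \<and> leb_singular_part \<nu> \<nu>s
     \<longrightarrow>
       emeasure \<mu>s (UNIV - {x. 0 < measure \<nu>s {x}}) = 0 \<and>
       (\<forall>E\<in>sets borel. emeasure \<mu>s E \<le> ennreal C *
          (\<integral>\<^sup>+ x. ennreal (measure \<nu>s {x} powr (real CARD('n) / (real CARD('n) - 1)))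
             \<partial>count_space (E \<inter> {x. 0 < measure \<nu>s {x}}))))"
proof (intro exI[of _ "ball_const TYPE('n) (real CARD('n) / (real CARD('n) - 1)) + 1"] conjI allI impI, goal_cases)
  case 1
  \<comment> \<open>\<open>ball_const\<close> is only shown to be nonnegative; adding 1 makes the
    constant positive.\<close>
  show ?case using ball_const_nonneg[where 'n = 'n] by (simp add: add_nonneg_pos)
next
  case (2 As \<Theta>s \<Sigma>s A \<theta> \<sigma> u \<mu> \<nu> \<mu>s \<nu>s)
  then interpret limit_setup As \<Theta>s \<Sigma>s u \<mu> \<nu> "real CARD('n) / (real CARD('n) - 1)"
    using assms by unfold_locales auto
  show ?case using singular_part_concentration(1)[of \<mu>s \<nu>s] 2 by auto
next
  case (3 As \<Theta>s \<Sigma>s A \<theta> \<sigma> u \<mu> \<nu> \<mu>s \<nu>s)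
  then interpret limit_setup As \<Theta>s \<Sigma>s u \<mu> \<nu> "real CARD('n) / (real CARD('n) - 1)"
    using assms by unfold_locales auto
  show ?case
  proof
    fix E :: "(real^'n) set" assume E: "E \<in> sets borel"
    let ?p = "real CARD('n) / (real CARD('n) - 1)"
    let ?I = "\<integral>\<^sup>+ x. ennreal (measure \<nu>s {x} powr ?p) \<partial>count_space (E \<inter> {x. 0 < measure \<nu>s {x}})"
    have "emeasure \<mu>s E \<le> ennreal (ball_const TYPE('n) ?p) * ?I"
      using singular_part_concentration(2)[of \<mu>s \<nu>s, OF _ _ E] 3 by auto
    also have "\<dots> \<le> ennreal (ball_const TYPE('n) ?p + 1) * ?I"
      by (intro mult_right_mono ennreal_leI) auto
    finally show "emeasure \<mu>s E \<le> ennreal (ball_const TYPE('n) ?p + 1) * ?I" .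
  qed
qed

end
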